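(* Let $n\ge 1$. The $K$-orbit decomposition of $X_n$ is $$X_n=\bigsqcup_{\lambda\in\Lambda_n^+} K\cdot x_\lambda ,$$ that is, every $x\in X_n$ lies in $K\cdot x_\lambda$ for exactly one $\lambda\in\Lambda_n^+$, where $\Lambda_n^+=\{\lambda\in\mathbb{Z}^n:\lambda_1\ge\lambda_2\ge\cdots\ge\lambda_n\ge 0\}$ and $x_\lambda=\mathrm{Diag}(\pi^{\lambda_1},\ldots,\pi^{\lambda_n},1,\pi^{-\lambda_n},\ldots,\pi^{-\lambda_1})$.
   Context: Let $k$ be a finite extension of $\mathbb{Q}_p$ with $p$ odd, $k'$ the unramified quadratic extension of $k$, $a\mapsto a^*$ the nontrivial automorphism of $k'/k$; for a matrix $a$ over $k'$, $a^*$ is its conjugate transpose. Let $\mathcal{O}_k,\mathcal{O}_{k'}$ be the rings of integers and $\pi$ a prime element of $k$. For $m\ge1$ let $j_m\in GL_m(k)$ be the matrix with all anti-diagonal entries $1$ and all other entries $0$. Put $G=G_n=\{g\in GL_{2n+1}(k'): g^*j_{2n+1}g=j_{2n+1}\}$, $K=K_n=G\cap M_{2n+1}(\mathcal{O}_{k'})$, and $X=X_n=\{x\in G: x^*=x,\ \det(t\cdot 1_{2n+1}-xj_{2n+1})=(t^2-1)^n(t-1)\}$, with $G$ acting on $X$ by $g\cdot x=gxg^*$; $K\cdot x=\{kxk^*:k\in K\}$. *)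

theory Defs
  imports
    "HOL-Analysis.Abstract_Metric_Spaces"
    "HOL-Algebra.Algebraic_Closure_Type"
    "Jordan_Normal_Form.Char_Poly"
begin

subsection \<open>Finite extensions of \<open>\<rat>\<^sub>p\<close>\<close>

definition padic_val :: "nat \<Rightarrow> rat \<Rightarrow> int" where
  "padic_val p q =
     int (multiplicity (int p) (fst (quotient_of q))) - int (multiplicity (int p) (snd (quotient_of q)))"

definition padic_abs :: "nat \<Rightarrow> rat \<Rightarrow> real" where
  "padic_abs p q = (if q = 0 then 0 else real p powi (- padic_val p q))"

definition absolute_value :: "('a::field \<Rightarrow> real) \<Rightarrow> bool" where
  "absolute_value v \<longleftrightarrow>
     (\<forall>x. 0 \<le> v x) \<and> (\<forall>x. v x = 0 \<longleftrightarrow> x = 0) \<and>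
     (\<forall>x y. v (x * y) = v x * v y) \<and> (\<forall>x y. v (x + y) \<le> v x + v y)"

text \<open>
  All fields considered are subfields of one ambient field, the type \<open>'a\<close>, which carries an absolute
  value \<open>v\<close>. The following says that the subfield \<open>F\<close> is the field of \<open>p\<close>-adic numbers: it is the
  completion of \<open>\<rat>\<close> with respect to the \<open>p\<close>-adic absolute value, that is, \<open>v\<close> extends the \<open>p\<close>-adic
  absolute value, \<open>F\<close> is complete and \<open>\<rat>\<close> is dense in \<open>F\<close>.
\<close>

definition padic_numbers :: "nat \<Rightarrow> ('a::field_char_0 \<Rightarrow> real) \<Rightarrow> 'a set \<Rightarrow> bool" where
  "padic_numbers p v F \<longleftrightarrow>
     subfield F (ring_of_type_algebra :: 'a ring) \<and>
     (\<forall>q. v (of_rat q) = padic_abs p q) \<and>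
     Metric_space.mcomplete F (\<lambda>x y. v (x - y)) \<and>
     (\<forall>x\<in>F. \<forall>e>0. \<exists>q. v (x - of_rat q) < e)"

definition finite_extension :: "'a::field set \<Rightarrow> 'a set \<Rightarrow> bool" where
  "finite_extension F E \<longleftrightarrow>
     subfield F (ring_of_type_algebra :: 'a ring) \<and>
     subfield E (ring_of_type_algebra :: 'a ring) \<and> F \<subseteq> E \<and>
     ring.finite_dimension (ring_of_type_algebra :: 'a ring) F E"

text \<open>
  The ambient field is an unramified quadratic extension of \<open>k\<close>: it has degree 2 and ramification
  index 1, i.e. the value groups coincide. Separability of the residue field extension is not
  listed, because over an extension of \<open>\<rat>\<^sub>p\<close> of finite degree the residue fields are finite.
\<close>

definition unramified_quadratic :: "('a::field \<Rightarrow> real) \<Rightarrow> 'a set \<Rightarrow> bool" where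
  "unramified_quadratic v k \<longleftrightarrow>
     subfield k (ring_of_type_algebra :: 'a ring) \<and>
     ring.dimension (ring_of_type_algebra :: 'a ring) 2 k UNIV \<and>
     v ` (UNIV - {0}) = v ` (k - {0})"

definition nontrivial_automorphism :: "'a::field set \<Rightarrow> ('a \<Rightarrow> 'a) \<Rightarrow> bool" where
  "nontrivial_automorphism k \<sigma> \<longleftrightarrow>
     \<sigma> \<in> ring_iso (ring_of_type_algebra :: 'a ring) ring_of_type_algebra \<and>
     (\<forall>x\<in>k. \<sigma> x = x) \<and> \<sigma> \<noteq> id"

definition ring_of_integers :: "('a::field \<Rightarrow> real) \<Rightarrow> 'a set \<Rightarrow> 'a set" where
  "ring_of_integers v F = {x \<in> F. v x \<le> 1}"

text \<open>A prime element of \<open>F\<close> is a generator of the maximal ideal of its ring of integers.\<close>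

definition prime_element_of :: "('a::field \<Rightarrow> real) \<Rightarrow> 'a set \<Rightarrow> 'a \<Rightarrow> bool" where
  "prime_element_of v F \<pi> \<longleftrightarrow>
     \<pi> \<in> F \<and> \<pi> \<noteq> 0 \<and> {x \<in> F. v x < 1} = (\<lambda>a. \<pi> * a) ` ring_of_integers v F"


subsection \<open>Unitary groups and unitary hermitian matrices\<close>

definition conj_transpose :: "('a \<Rightarrow> 'a) \<Rightarrow> 'a mat \<Rightarrow> 'a mat" where
  "conj_transpose \<sigma> A = transpose_mat (map_mat \<sigma> A)"

definition antidiag :: "nat \<Rightarrow> 'a::zero_neq_one mat" where
  "antidiag m = mat m m (\<lambda>(i, j). if i + j + 1 = m then 1 else 0)"

definition unitary_G :: "('a::field \<Rightarrow> 'a) \<Rightarrow> nat \<Rightarrow> 'a mat set" where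
  "unitary_G \<sigma> n =
     {g \<in> carrier_mat (2 * n + 1) (2 * n + 1). invertible_mat g \<and>
        conj_transpose \<sigma> g * antidiag (2 * n + 1) * g = antidiag (2 * n + 1)}"

definition unitary_K :: "('a::field \<Rightarrow> real) \<Rightarrow> ('a \<Rightarrow> 'a) \<Rightarrow> nat \<Rightarrow> 'a mat set" where
  "unitary_K v \<sigma> n = {g \<in> unitary_G \<sigma> n. elements_mat g \<subseteq> ring_of_integers v UNIV}"

definition unitary_X :: "('a::field \<Rightarrow> 'a) \<Rightarrow> nat \<Rightarrow> 'a mat set" where
  "unitary_X \<sigma> n =
     {x \<in> unitary_G \<sigma> n. conj_transpose \<sigma> x = x \<and>
        char_poly (x * antidiag (2 * n + 1)) = ([:0, 1:] ^ 2 - 1) ^ n * ([:0, 1:] - 1)}"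

definition K_orbit :: "('a::field \<Rightarrow> real) \<Rightarrow> ('a \<Rightarrow> 'a) \<Rightarrow> nat \<Rightarrow> 'a mat \<Rightarrow> 'a mat set" where
  "K_orbit v \<sigma> n x = {h * x * conj_transpose \<sigma> h | h. h \<in> unitary_K v \<sigma> n}"

definition Lambda_plus :: "nat \<Rightarrow> int vec set" where
  "Lambda_plus n =
     {l \<in> carrier_vec n. (\<forall>i j. i \<le> j \<longrightarrow> j < n \<longrightarrow> l $ j \<le> l $ i) \<and> (\<forall>i<n. 0 \<le> l $ i)}"

text \<open>Indices are counted from 0, so the entry of \<open>x_mat \<pi> n l\<close> at \<open>2 * n - i\<close> is inverse to that at \<open>i\<close>.\<close>

definition x_mat :: "'a::field \<Rightarrow> nat \<Rightarrow> int vec \<Rightarrow> 'a mat" where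
  "x_mat \<pi> n l = mat_diag (2 * n + 1)
     (\<lambda>i. if i < n then \<pi> powi (l $ i) else if i = n then 1 else \<pi> powi (- (l $ (2 * n - i))))"

end

theory Submission
  imports Defs "HOL-Library.Function_Algebras"
begin

text \<open>
  On row vectors let \<open>h(u, w) = u j w\<^sup>*\<close> and let \<open>T\<close> be the operator \<open>u \<mapsto> u x j\<close>. For \<open>x \<in> X\<^sub>n\<close> it is an
  \<open>h\<close>-selfadjoint involution of trace 1, and \<open>K\<close> is the stabiliser of \<open>h\<close> and of the unimodular lattice
  \<open>L\<close> of integral vectors. Planes are split off greedily: if the values of \<open>h(T u, w)\<close> on the part of
  \<open>L\<close> that is left have maximal size \<open>|\<pi>|\<^sup>-\<^sup>m\<close>, polarisation gives \<open>z\<close> with \<open>h(T z, z)\<close> of that size.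
  For \<open>m > 0\<close> the plane spanned by \<open>z\<close> and \<open>\<pi>\<^sup>m T z\<close> is unimodular and \<open>T\<close>-stable, and Hensel's lemma
  and the surjectivity of the norm on units give it a hyperbolic basis \<open>e, f\<close> with \<open>T e = \<pi>\<^sup>m f\<close>. For
  \<open>m = 0\<close> unit vectors in the two eigenspaces combine to such a basis, unless \<open>T\<close> acts as a scalar on what is
  left; then the trace forces a line with \<open>T = 1\<close>. Since \<open>m\<close> never increases, the
  exponents come out sorted.

  For uniqueness, \<open>g x\<^sub>\<lambda> g\<^sup>* = x\<^sub>\<mu>\<close> with \<open>\<mu>\<^sub>r > \<lambda>\<^sub>r\<close> would make a block of \<open>g\<close> vanish modulo \<open>\<pi>\<close> that is so
  large that \<open>det g\<close> vanishes modulo \<open>\<pi>\<close>.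
\<close>

section \<open>Nonarchimedean absolute values\<close>

text \<open>The rows of \<open>g\<close> are the basis that is sought: the entries of
  \<open>g x g^*\<close> are the numbers h(T u, w) for rows u, w of \<open>g\<close>, and
  \<open>g\<close> lies in G exactly when its rows have Gram matrix j under h.

  The obstacle is that sublattices and their complements would each need a carrier and a rank of
  their own. Instead the space and L stay fixed, and what is left is recorded by an orthogonal
  projection P that commutes with T and preserves L; its rank is read off from the trace of P. For
  the existence of a representative the characteristic polynomial enters only through the trace of x
  j, since x being hermitian and unitary already makes x j an involution.

  Of the local fields only this is retained: 2 is a unit (p is odd), \<pi> generates the value group
  of k' (unramified), units of k are norms, and a quadratic with small leading and unit linear
  coefficient has an integral root. The last two rest on completeness and on the finiteness of the
  residue field, which are inherited from the p-adic numbers along a finite basis.\<close>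

locale nonarchimedean =
  fixes v :: "'a::field \<Rightarrow> real"
  assumes v_nonneg [simp]: "0 \<le> v x"
    and v_eq_0_iff [simp]: "v x = 0 \<longleftrightarrow> x = 0"
    and v_mult: "v (x * y) = v x * v y"
    and v_add_le_max: "v (x + y) \<le> max (v x) (v y)"
begin

lemma v_0 [simp]: "v 0 = 0"
  by simp

lemma v_1 [simp]: "v 1 = 1"
proof -
  have "v 1 * v 1 = v 1" by (metis mult_1 v_mult)
  then show ?thesis by simp
qed

lemma v_pos_iff [simp]: "0 < v x \<longleftrightarrow> x \<noteq> 0"
  using v_nonneg[of x] v_eq_0_iff[of x] by linarith

lemma v_power: "v (x ^ n) = v x ^ n"
  by (induction n) (simp_all add: v_mult)

lemma v_uminus [simp]: "v (- x) = v x"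
proof -
  have "v (- 1) ^ 2 = 1" by (simp flip: v_power)
  then have "v (- 1) = 1" using v_nonneg[of "- 1"] by (simp add: power2_eq_1_iff)
  then show ?thesis using v_mult[of "- 1" x] by simp
qed

lemma v_minus_commute: "v (x - y) = v (y - x)"
  by (metis minus_diff_eq v_uminus)

lemma v_inverse: "v (inverse x) = inverse (v x)"
proof (cases "x = 0")
  case False
  then have "v x * v (inverse x) = 1" by (simp flip: v_mult)
  then show ?thesis by (metis inverse_unique)
qed simp

lemma v_divide: "v (x / y) = v x / v y"
  by (simp add: divide_inverse v_mult v_inverse)

lemma v_powi: "v (x powi m) = v x powi m"
  by (simp add: power_int_def v_power v_inverse)

lemma v_diff_le_max: "v (x - y) \<le> max (v x) (v y)"
  using v_add_le_max[of x "- y"] by simp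

lemma v_add_le: "v x \<le> c \<Longrightarrow> v y \<le> c \<Longrightarrow> v (x + y) \<le> c"
  using v_add_le_max[of x y] by simp

lemma v_diff_le: "v x \<le> c \<Longrightarrow> v y \<le> c \<Longrightarrow> v (x - y) \<le> c"
  using v_diff_le_max[of x y] by simp

lemma v_add_less: "v x < c \<Longrightarrow> v y < c \<Longrightarrow> v (x + y) < c"
  using v_add_le_max[of x y] by simp

lemma v_diff_less: "v x < c \<Longrightarrow> v y < c \<Longrightarrow> v (x - y) < c"
  using v_diff_le_max[of x y] by simp

lemma v_add_eq_left: "v y < v x \<Longrightarrow> v (x + y) = v x"
  using v_add_le_max[of x y] v_diff_le_max[of "x + y" y] by auto

lemma v_eq_of_close: "v (x - y) < v y \<Longrightarrow> v x = v y"
  using v_add_eq_left[of "x - y" y] by simp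

lemma v_triangle: "v (x - z) < e" if "v (x - y) < e" "v (y - z) < e"
  using v_add_less[OF that] by simp

lemma v_mult_le_1: "v x \<le> 1 \<Longrightarrow> v y \<le> 1 \<Longrightarrow> v (x * y) \<le> 1"
  by (simp add: v_mult mult_le_one)

lemma v_sum_le: "0 \<le> c \<Longrightarrow> (\<And>i. i \<in> A \<Longrightarrow> v (f i) \<le> c) \<Longrightarrow> v (sum f A) \<le> c"
  by (induction A rule: infinite_finite_induct) (auto intro!: v_add_le)

lemma v_sum_less: "0 < c \<Longrightarrow> (\<And>i. i \<in> A \<Longrightarrow> v (f i) < c) \<Longrightarrow> v (sum f A) < c"
  by (induction A rule: infinite_finite_induct) (auto intro!: v_add_less)

lemma v_prod: "v (prod f A) = (\<Prod>i\<in>A. v (f i))"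
  by (induction A rule: infinite_finite_induct) (auto simp: v_mult)

section \<open>Completeness and total boundedness of subsets of the field\<close>

definition Cauchy_seq :: "(nat \<Rightarrow> 'a) \<Rightarrow> bool" where
  "Cauchy_seq s \<longleftrightarrow> (\<forall>e>0. \<exists>M. \<forall>m\<ge>M. \<forall>n\<ge>M. v (s m - s n) < e)"

definition tends_to :: "(nat \<Rightarrow> 'a) \<Rightarrow> 'a \<Rightarrow> bool" where
  "tends_to s l \<longleftrightarrow> (\<forall>e>0. \<exists>M. \<forall>n\<ge>M. v (s n - l) < e)"

definition seq_complete :: "'a set \<Rightarrow> bool" where
  "seq_complete E \<longleftrightarrow> (\<forall>s. range s \<subseteq> E \<longrightarrow> Cauchy_seq s \<longrightarrow> (\<exists>l\<in>E. tends_to s l))"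

text \<open>With completeness this is local compactness. It passes along a basis more easily than
  finiteness of the residue field, for which it is finally used with \<open>C = e = 1\<close>. The
  centres \<open>R\<close> need not lie in \<open>E\<close>.\<close>

definition bounded_covers :: "'a set \<Rightarrow> bool" where
  "bounded_covers E \<longleftrightarrow>
     (\<forall>C. \<forall>e>0. \<exists>R. finite R \<and> (\<forall>x\<in>E. v x \<le> C \<longrightarrow> (\<exists>r\<in>R. v (x - r) < e)))"

lemma tends_to_imp_Cauchy_seq: "tends_to s l \<Longrightarrow> Cauchy_seq s"
  unfolding tends_to_def Cauchy_seq_def
proof (intro allI impI)
  fix e :: real
  assume *: "\<forall>e>0. \<exists>M. \<forall>n\<ge>M. v (s n - l) < e" and "0 < e"
  then obtain M where M: "\<And>n. n \<ge> M \<Longrightarrow> v (s n - l) < e" by meson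
  have "v (s m - s n) < e" if "m \<ge> M" "n \<ge> M" for m n
    using v_triangle[of "s m" l e "s n"] M[OF that(1)] M[OF that(2)] by (simp add: v_minus_commute)
  then show "\<exists>M. \<forall>m\<ge>M. \<forall>n\<ge>M. v (s m - s n) < e" by blast
qed

lemma tends_to_unique:
  assumes "tends_to s l" "tends_to s l'"
  shows "l = l'"
proof (rule ccontr)
  assume "l \<noteq> l'"
  then have e: "0 < v (l - l')" by simp
  obtain M M' where "\<forall>n\<ge>M. v (s n - l) < v (l - l')" "\<forall>n\<ge>M'. v (s n - l') < v (l - l')"
    using assms e unfolding tends_to_def by meson
  then have "v (l - s (max M M')) < v (l - l')" "v (s (max M M') - l') < v (l - l')"
    by (simp_all add: v_minus_commute)
  from v_triangle[OF this] show False by simp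
qed

lemma tends_to_linear:
  assumes "tends_to s a" "tends_to Y b"
  shows "tends_to (\<lambda>n. s n * w + Y n) (a * w + b)"
  unfolding tends_to_def
proof (intro allI impI)
  fix e :: real assume e: "0 < e"
  \<comment> \<open>The case \<open>w = 0\<close> gets the default 1, since any positive radius
    serves there.\<close>
  define e' where "e' = (if w = 0 then 1 else e / v w)"
  have "0 < e'" using e by (simp add: e'_def)
  then obtain M where M: "\<And>n. n \<ge> M \<Longrightarrow> v (s n - a) < e'"
    using assms(1) unfolding tends_to_def by meson
  obtain M' where M': "\<And>n. n \<ge> M' \<Longrightarrow> v (Y n - b) < e"
    using assms(2) e unfolding tends_to_def by meson
  have "v (s n * w + Y n - (a * w + b)) < e" if "n \<ge> max M M'" for n
  proof -
    have "v ((s n - a) * w) < e"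
      using M[of n] that e by (auto simp: v_mult e'_def pos_less_divide_eq split: if_splits)
    from v_add_less[OF this M'[of n]] that show ?thesis by (simp add: algebra_simps)
  qed
  then show "\<exists>M. \<forall>n\<ge>M. v (s n * w + Y n - (a * w + b)) < e" by blast
qed

text \<open>Otherwise points of \<open>E\<close> at distance below \<open>1 / (n + 1)\<close> would
  converge to \<open>w\<close>, and completeness with uniqueness of limits puts \<open>w\<close>
  into \<open>E\<close>.\<close>

lemma seq_complete_dist_pos:
  assumes "seq_complete E" "w \<notin> E"
  shows "\<exists>d>0. \<forall>e\<in>E. d \<le> v (w - e)"
proof (rule ccontr)
  assume "\<not> ?thesis"
  then have "\<exists>e\<in>E. v (w - e) < d" if "d > 0" for d
    using that by (meson not_le)
  then have "\<exists>e\<in>E. v (w - e) < inverse (Suc n)" for n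
    by simp
  then obtain s where s: "\<And>n. s n \<in> E" "\<And>n. v (w - s n) < inverse (Suc n)"
    by metis
  have "tends_to s w"
    unfolding tends_to_def
  proof (intro allI impI)
    fix e :: real assume "0 < e"
    then obtain M where M: "inverse (Suc M) < e" using reals_Archimedean by blast
    have "v (s n - w) < e" if "n \<ge> M" for n
    proof -
      have "inverse (real (Suc n)) \<le> inverse (real (Suc M))" using that by simp
      then show ?thesis using s(2)[of n] M unfolding v_minus_commute[of _ w] by linarith
    qed
    then show "\<exists>M. \<forall>n\<ge>M. v (s n - w) < e" by blast
  qed
  moreover from this obtain l where "l \<in> E" "tends_to s l"
    using assms(1) s(1) tends_to_imp_Cauchy_seq unfolding seq_complete_def by blast
  ultimately show False using assms(2) tends_to_unique by blast
qed

end

text \<open>Closure laws on the type's own operations. As \<open>inverse 0 = 0\<close>, closure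
  under inverses needs no exception for 0.\<close>

definition type_subfield :: "'a::field set \<Rightarrow> bool" where
  "type_subfield F \<longleftrightarrow> 0 \<in> F \<and> 1 \<in> F \<and> (\<forall>x\<in>F. \<forall>y\<in>F. x + y \<in> F \<and> x * y \<in> F) \<and>
     (\<forall>x\<in>F. - x \<in> F \<and> inverse x \<in> F)"

lemma type_subfieldD:
  assumes "type_subfield F"
  shows "0 \<in> F" "1 \<in> F" "x \<in> F \<Longrightarrow> y \<in> F \<Longrightarrow> x + y \<in> F" "x \<in> F \<Longrightarrow> y \<in> F \<Longrightarrow> x * y \<in> F"
    "x \<in> F \<Longrightarrow> - x \<in> F" "x \<in> F \<Longrightarrow> inverse x \<in> F"
    "x \<in> F \<Longrightarrow> y \<in> F \<Longrightarrow> x - y \<in> F" "x \<in> F \<Longrightarrow> y \<in> F \<Longrightarrow> x / y \<in> F"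
    "x \<in> F \<Longrightarrow> x ^ m \<in> F" "x \<in> F \<Longrightarrow> x powi i \<in> F" "2 \<in> F"
proof -
  show c: "0 \<in> F" "1 \<in> F" "\<And>x y. x \<in> F \<Longrightarrow> y \<in> F \<Longrightarrow> x + y \<in> F"
     "\<And>x y. x \<in> F \<Longrightarrow> y \<in> F \<Longrightarrow> x * y \<in> F"
    "\<And>x. x \<in> F \<Longrightarrow> - x \<in> F" "\<And>x. x \<in> F \<Longrightarrow> inverse x \<in> F"
    using assms unfolding type_subfield_def by auto
  show "x \<in> F \<Longrightarrow> y \<in> F \<Longrightarrow> x - y \<in> F" "x \<in> F \<Longrightarrow> y \<in> F \<Longrightarrow> x / y \<in> F"
    using c(3)[of x "-y"] c(4,5,6) by (auto simp: divide_inverse)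
  show pow: "x \<in> F \<Longrightarrow> x ^ m \<in> F" for x m by (induction m) (auto intro: c)
  show "x \<in> F \<Longrightarrow> x powi i \<in> F" by (auto simp: power_int_def intro!: pow c)
  show "2 \<in> F" using c(3)[OF c(2) c(2)] by simp
qed

lemma ring_of_type_algebra_simps [simp]:
  "carrier ring_of_type_algebra = UNIV" "monoid.mult ring_of_type_algebra = (*)"
  "monoid.one ring_of_type_algebra = 1" "ring.zero ring_of_type_algebra = 0"
  "ring.add ring_of_type_algebra = (+)"
  by (simp_all add: ring_of_type_algebra_def)

lemma subfield_imp_type_subfield:
  assumes "subfield F (ring_of_type_algebra :: 'a::field ring)"
  shows "type_subfield F"
proof -
  interpret R: field "ring_of_type_algebra :: 'a ring" by (rule field_from_type_algebra)
  note sr = subfieldE(1)[OF assms]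
  note s = subringE[OF sr]
  have inv: "inverse x \<in> F" if "x \<in> F" for x
  proof (cases "x = 0")
    case False
    then have "inv\<^bsub>ring_of_type_algebra\<^esub> x \<in> F" "x * inv\<^bsub>ring_of_type_algebra\<^esub> x = 1"
      using R.subfield_m_inv[OF assms, of x] that by auto
    then show ?thesis by (metis inverse_unique)
  qed (use that in auto)
  have um: "- x \<in> F" if "x \<in> F" for x
  proof -
    have "x + a_inv ring_of_type_algebra x = 0" using R.r_neg[of x] by simp
    then show ?thesis using s(5)[OF that] by (metis add.inverse_unique)
  qed
  show ?thesis using s inv um unfolding type_subfield_def by auto
qed

section \<open>Completeness of finite-dimensional extensions\<close>

context nonarchimedean
begin

text \<open>The distance \<open>d\<close> of \<open>w\<close> from the complete \<open>E\<close> is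
  positive, so the coefficient \<open>a\<close> in \<open>a * w + e\<close> is controlled by the
  sum: \<open>v a \<le> v (a * w + e) / d\<close>. Hence both coordinates of a Cauchy sequence are
  Cauchy, and covers of the two coordinates combine to one of \<open>E'\<close>.\<close>

lemma line_extension_complete:
  assumes F: "type_subfield F" "seq_complete F" "bounded_covers F"
    and E: "seq_complete E" "bounded_covers E" "\<And>a e. a \<in> F \<Longrightarrow> e \<in> E \<Longrightarrow> a * e \<in> E"
      "\<And>e e'. e \<in> E \<Longrightarrow> e' \<in> E \<Longrightarrow> e - e' \<in> E"
    and w: "w \<notin> E"
  defines "E' \<equiv> {a * w + e | a e. a \<in> F \<and> e \<in> E}"
  shows "seq_complete E' \<and> bounded_covers E'"
proof -
  note F' = type_subfieldD[OF F(1)]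
  obtain d where d: "d > 0" "\<And>e. e \<in> E \<Longrightarrow> d \<le> v (w - e)"
    using seq_complete_dist_pos[OF E(1) w] by blast
  \<comment> \<open>\<open>a * w + e\<close> is \<open>a\<close> times the difference of
    \<open>w\<close> and \<open>- e / a\<close>, and the latter lies in \<open>E\<close> because
    \<open>E\<close> is stable under \<open>F\<close>.\<close>
  have bound: "v a \<le> v (a * w + e) / d" if "a \<in> F" "e \<in> E" for a e
  proof (cases "a = 0")
    case True then show ?thesis using d(1) by simp
  next
    case False
    have "(- inverse a) * e \<in> E" using E(3)[OF F'(5)[OF F'(6)[OF that(1)]] that(2)] .
    from d(2)[OF this] have "d * v a \<le> v (w + inverse a * e) * v a" by (simp add: mult_right_mono)
    also have "\<dots> = v ((w + inverse a * e) * a)" by (simp add: v_mult)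
    also have "(w + inverse a * e) * a = a * w + e" using False by (simp add: field_simps)
    finally show ?thesis using d(1) by (simp add: field_simps)
  qed
  \<comment> \<open>A nonempty \<open>E\<close> contains 0 as a difference, so \<open>w = 0\<close>
    outside \<open>E\<close> forces \<open>E\<close> to be empty.\<close>
  have w0: "w \<noteq> 0 \<or> E = {}" using E(4) w by fastforce
  have "seq_complete E'"
    unfolding seq_complete_def
  proof (intro allI impI)
    fix s assume s: "range s \<subseteq> E'" "Cauchy_seq s"
    then have "\<exists>a e. a \<in> F \<and> e \<in> E \<and> s n = a * w + e" for n
      unfolding E'_def by blast
    then obtain a e where ae: "\<And>n. a n \<in> F" "\<And>n. e n \<in> E" "\<And>n. s n = a n * w + e n"
      by metis
    have diff: "v (a m - a n) \<le> v (s m - s n) / d" for m n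
      using bound[of "a m - a n" "e m - e n"] ae E(4) F'(7) by (simp add: algebra_simps)
    have "Cauchy_seq a"
      unfolding Cauchy_seq_def
    proof (intro allI impI)
      fix c :: real assume "0 < c"
      then have "0 < c * d" using d by simp
      then obtain M where M: "\<forall>m\<ge>M. \<forall>n\<ge>M. v (s m - s n) < c * d"
        using s(2) unfolding Cauchy_seq_def by meson
      have "v (a m - a n) < c" if "m \<ge> M" "n \<ge> M" for m n
      proof -
        have "v (s m - s n) / d < c" using M that d(1) by (simp add: pos_divide_less_eq)
        then show ?thesis using diff[of m n] by simp
      qed
      then show "\<exists>M. \<forall>m\<ge>M. \<forall>n\<ge>M. v (a m - a n) < c" by blast
    qed
    then obtain a0 where a0: "a0 \<in> F" "tends_to a a0"
      using F(2) ae(1) unfolding seq_complete_def by blast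
    have "Cauchy_seq e"
      unfolding Cauchy_seq_def
    proof (intro allI impI)
      fix c :: real assume c: "0 < c"
      have "w \<noteq> 0" using w0 ae(2) by auto
      then have "0 < c / v w" using c by simp
      then obtain M where M: "\<And>m n. m\<ge>M \<Longrightarrow> n\<ge>M \<Longrightarrow> v (a m - a n) < c / v w"
        using \<open>Cauchy_seq a\<close> unfolding Cauchy_seq_def by meson
      obtain M' where M': "\<And>m n. m\<ge>M' \<Longrightarrow> n\<ge>M' \<Longrightarrow> v (s m - s n) < c"
        using s(2) c unfolding Cauchy_seq_def by meson
      have "v (e m - e n) < c" if "m \<ge> max M M'" "n \<ge> max M M'" for m n
      proof -
        have "v ((a m - a n) * w) < c" using M[of m n] that \<open>w \<noteq> 0\<close> by (simp add: v_mult pos_less_divide_eq)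
        from v_diff_less[OF M'[of m n] this] that show ?thesis by (simp add: ae(3) algebra_simps)
      qed
      then show "\<exists>M. \<forall>m\<ge>M. \<forall>n\<ge>M. v (e m - e n) < c" by blast
    qed
    then obtain e0 where e0: "e0 \<in> E" "tends_to e e0"
      using E(1) ae(2) unfolding seq_complete_def by blast
    have "s = (\<lambda>n. a n * w + e n)" using ae(3) by auto
    then have "tends_to s (a0 * w + e0)"
      using tends_to_linear[OF a0(2) e0(2)] by simp
    then show "\<exists>l\<in>E'. tends_to s l" using a0(1) e0(1) unfolding E'_def by blast
  qed
  moreover have "bounded_covers E'"
    unfolding bounded_covers_def
  proof (intro allI impI)
    fix C c :: real assume c: "0 < c"
    define c' where "c' = (if w = 0 then 1 else c / v w)"
    have c': "0 < c'" using c by (simp add: c'_def)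
    obtain R where R: "finite R" "\<And>x. x \<in> F \<Longrightarrow> v x \<le> C / d \<Longrightarrow> \<exists>r\<in>R. v (x - r) < c'"
      using F(3) c' unfolding bounded_covers_def by meson
    \<comment> \<open>The second radius bounds \<open>e = x - a * w\<close>, where
      \<open>v a \<le> C / d\<close>.\<close>
    obtain S where S: "finite S" "\<And>x. x \<in> E \<Longrightarrow> v x \<le> max C (C / d * v w) \<Longrightarrow> \<exists>r\<in>S. v (x - r) < c"
      using E(2) c unfolding bounded_covers_def by meson
    have "\<exists>q\<in>(\<lambda>(r, s). r * w + s) ` (R \<times> S). v (x - q) < c" if x: "x \<in> E'" "v x \<le> C" for x
    proof -
      obtain a e where ae: "a \<in> F" "e \<in> E" "x = a * w + e" using x(1) unfolding E'_def by blast
      have "v x / d \<le> C / d" using that(2) d(1) by (simp add: divide_right_mono)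
      then have va: "v a \<le> C / d" using bound[OF ae(1,2)] ae(3) by simp
      then obtain r where r: "r \<in> R" "v (a - r) < c'" using R(2) ae(1) by blast
      have "v (a * w) \<le> C / d * v w" using mult_right_mono[OF va v_nonneg[of w]] by (simp only: v_mult)
      then have "v e \<le> max C (C / d * v w)"
        using v_diff_le_max[of x "a * w"] that(2) ae(3) by auto
      then obtain s where s: "s \<in> S" "v (e - s) < c" using S(2) ae(2) by blast
      have "v ((a - r) * w) < c"
        using r(2) c by (auto simp: v_mult c'_def pos_less_divide_eq split: if_splits)
      from v_add_less[OF this s(2)] have "v (x - (r * w + s)) < c" by (simp add: ae(3) algebra_simps)
      then show ?thesis using r s by (intro bexI[of _ "r * w + s"]) auto
    qed
    moreover have "finite ((\<lambda>(r, s). r * w + s) ` (R \<times> S))" using R S by simp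
    ultimately show "\<exists>R. finite R \<and> (\<forall>x\<in>E'. v x \<le> C \<longrightarrow> (\<exists>r\<in>R. v (x - r) < c))" by blast
  qed
  ultimately show ?thesis ..
qed

lemma finite_dimension_complete:
  assumes F: "type_subfield F" "seq_complete F" "bounded_covers F"
    and dim: "ring.finite_dimension ring_of_type_algebra F E"
  shows "seq_complete E \<and> bounded_covers E"
proof -
  interpret R: field "ring_of_type_algebra :: 'a ring" by (rule field_from_type_algebra)
  note F' = type_subfieldD[OF F(1)]
  obtain n where "R.dimension n F E" using dim unfolding R.finite_dimension_def by blast
  \<comment> \<open>Stability under scalars and differences is part of the induction because adding
    a vector to the basis relies on it.\<close>
  then have "seq_complete E \<and> bounded_covers E \<and> (\<forall>a\<in>F. \<forall>e\<in>E. a * e \<in> E) \<and> (\<forall>e\<in>E. \<forall>e'\<in>E. e - e' \<in> E)"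
    using F
  proof (induction rule: R.dimension.induct)
    case (zero_dim K)
    have "seq_complete {0}"
      unfolding seq_complete_def tends_to_def by (auto simp: image_subset_iff)
    moreover have "bounded_covers {0}"
      unfolding bounded_covers_def by (auto intro!: exI[of _ "{0}"])
    ultimately show ?case by simp
  next
    case (Suc_dim w E n K)
    note K = type_subfieldD[OF Suc_dim.prems(1)]
    have eq: "R.line_extension K w E = {a * w + e | a e. a \<in> K \<and> e \<in> E}"
      unfolding Set.set_eq_iff by (simp add: R.line_extension_mem_iff) blast
    have IH: "seq_complete E" "bounded_covers E" "\<And>a e. a \<in> K \<Longrightarrow> e \<in> E \<Longrightarrow> a * e \<in> E"
      "\<And>e e'. e \<in> E \<Longrightarrow> e' \<in> E \<Longrightarrow> e - e' \<in> E"
      using Suc_dim.IH Suc_dim.prems by auto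
    have "\<exists>a'' e''. a * w + e - (a' * w + e') = a'' * w + e'' \<and> a'' \<in> K \<and> e'' \<in> E"
      if "a \<in> K" "e \<in> E" "a' \<in> K" "e' \<in> E" for a e a' e'
      using that K(7) IH(4) by (intro exI[of _ "a - a'"] exI[of _ "e - e'"]) (auto simp: algebra_simps)
    moreover have "\<exists>a'' e''. c * (a * w + e) = a'' * w + e'' \<and> a'' \<in> K \<and> e'' \<in> E"
      if "a \<in> K" "e \<in> E" "c \<in> K" for a e c
      using that K(4) IH(3) by (intro exI[of _ "c * a"] exI[of _ "c * e"]) (auto simp: algebra_simps)
    ultimately show ?case
      using line_extension_complete[OF Suc_dim.prems IH] Suc_dim.hyps unfolding eq by auto
  qed
  then show ?thesis by blast
qed

end

section \<open>The ultrametric inequality from bounded integers\<close>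

lemma power_le_linear_imp_le_1:
  fixes q :: real
  assumes "\<And>n. q ^ n \<le> real n + 1"
  shows "q \<le> 1"
proof (rule ccontr)
  assume "\<not> q \<le> 1"
  define t where "t = q - 1"
  have t: "t > 0" "q = 1 + t" using \<open>\<not> q \<le> 1\<close> by (auto simp: t_def)
  obtain n where n: "3 / t\<^sup>2 < real n" using reals_Archimedean2 by blast
  have "0 < 3 / t\<^sup>2" using t by simp
  then have n1: "1 \<le> real n" using n by (cases n) auto
  have nt: "3 < real n * t\<^sup>2" using n t by (simp add: pos_divide_less_eq)
  \<comment> \<open>Bernoulli's bound is only linear in \<open>n\<close>; its square bounds
    \<open>q ^ (2 * n)\<close> below by a quadratic, and \<open>3 < n * t^2\<close> makes that
    exceed \<open>2 * n + 1\<close>.\<close>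
  have "1 + real n * t \<le> q ^ n" using Bernoulli_inequality[of t n] t by (simp add: mult.commute)
  then have "(1 + real n * t)\<^sup>2 \<le> (q ^ n)\<^sup>2" using t by (intro power_mono) auto
  also have "\<dots> = q ^ (2 * n)" by (simp add: power_mult[symmetric] mult.commute)
  also have "\<dots> \<le> 2 * real n + 1" using assms[of "2 * n"] by simp
  finally have "1 + 2 * real n * t + real n * (real n * t\<^sup>2) \<le> 2 * real n + 1"
    by (simp add: power2_eq_square algebra_simps)
  moreover have "real n * 3 \<le> real n * (real n * t\<^sup>2)" using nt n1 by (intro mult_left_mono) auto
  moreover have "0 \<le> 2 * real n * t" using t by simp
  ultimately show False using n1 by linarith
qed

text \<open>Binomial coefficients have size at most 1, so the binomial theorem gives
  \<open>v (x + y) ^ n \<le> (n + 1) * M ^ n\<close> for \<open>M = max (v x) (v y)\<close>; the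
  factor \<open>n + 1\<close> disappears because the powers of a number above 1 outgrow it.\<close>

lemma absolute_value_nonarchimedean:
  assumes av: "absolute_value v" and le1: "\<And>n::nat. v (of_nat n) \<le> 1"
  shows "nonarchimedean v"
proof -
  have nonneg: "0 \<le> v x" and eq0: "v x = 0 \<longleftrightarrow> x = 0" and mul: "v (x * y) = v x * v y"
    and tri: "v (x + y) \<le> v x + v y" for x y
    using av unfolding absolute_value_def by auto
  have one: "v 1 = 1"
  proof -
    have "v 1 * v 1 = v 1" by (metis mult_1 mul)
    then show ?thesis using eq0[of 1] by simp
  qed
  have pow: "v (x ^ n) = v x ^ n" for x n by (induction n) (simp_all add: mul one)
  have sum: "v (sum f A) \<le> (\<Sum>i\<in>A. v (f i))" if "finite A" for f :: "nat \<Rightarrow> 'a" and A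
    using that
  proof (induction A)
    case empty
    then show ?case using eq0[of 0] by simp
  next
    case (insert x A)
    then show ?case using tri[of "f x" "sum f A"] by simp
  qed
  have "v (x + y) \<le> max (v x) (v y)" for x y
  proof (cases "x = 0 \<and> y = 0")
    case True then show ?thesis by (simp add: eq0)
  next
    case False
    define M where "M = max (v x) (v y)"
    have M: "M > 0" using False nonneg[of x] nonneg[of y] eq0[of x] eq0[of y] unfolding M_def by linarith
    have "(v (x + y) / M) ^ n \<le> real n + 1" for n
    proof -
      have "v (x + y) ^ n = v (\<Sum>i\<le>n. of_nat (n choose i) * x ^ i * y ^ (n - i))"
        by (simp add: binomial_ring flip: pow)
      also have "\<dots> \<le> (\<Sum>i\<le>n. v (of_nat (n choose i) * x ^ i * y ^ (n - i)))" by (rule sum) simp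
      also have "\<dots> \<le> (\<Sum>i\<le>n. M ^ n)"
      proof (rule sum_mono)
        fix i assume "i \<in> {..n}"
        then have "M ^ n = 1 * M ^ i * M ^ (n - i)" by (simp flip: power_add)
        moreover have "v x ^ i \<le> M ^ i" "v y ^ (n - i) \<le> M ^ (n - i)"
          by (auto intro!: power_mono nonneg simp: M_def)
        moreover have "v (of_nat (n choose i)) * v x ^ i * v y ^ (n - i) \<le> 1 * M ^ i * M ^ (n - i)"
          using M calculation by (intro mult_mono) (simp_all add: le1 nonneg)
        ultimately show "v (of_nat (n choose i) * x ^ i * y ^ (n - i)) \<le> M ^ n"
          by (simp only: mul pow)
      qed
      also have "\<dots> = (real n + 1) * M ^ n" by simp
      finally show ?thesis using M by (simp add: power_divide pos_divide_le_eq)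
    qed
    then have "v (x + y) / M \<le> 1" by (rule power_le_linear_imp_le_1)
    then show ?thesis using M by (simp add: pos_divide_le_eq M_def)
  qed
  then show ?thesis using nonneg eq0 mul by unfold_locales
qed

section \<open>The field of p-adic numbers\<close>

lemma padic_abs_of_int:
  assumes "prime p"
  shows "padic_abs p (of_int t) \<le> 1"
    and "\<not> int p dvd t \<Longrightarrow> padic_abs p (of_int t) = 1"
    and "padic_abs p (of_nat p) = 1 / real p"
proof -
  have p1: "1 < real p" using prime_gt_1_nat[OF assms] by simp
  show "padic_abs p (of_int t) \<le> 1"
    using p1 by (simp add: padic_abs_def padic_val_def power_int_minus field_simps)
  show "padic_abs p (of_int t) = 1" if "\<not> int p dvd t"
    using that by (auto simp: padic_abs_def padic_val_def not_dvd_imp_multiplicity_0)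
  have "padic_val p (of_int (int p)) = 1"
    using assms by (simp add: padic_val_def)
  then show "padic_abs p (of_nat p) = 1 / real p"
    using p1 by (simp add: padic_abs_def power_int_minus field_simps)
qed

lemma padic_numbers_nonarchimedean:
  assumes "prime p" "absolute_value v" "padic_numbers p v F"
  shows "nonarchimedean v"
proof (rule absolute_value_nonarchimedean[OF assms(2)])
  fix n :: nat
  have "v (of_rat (of_int (int n))) = padic_abs p (of_int (int n))"
    using assms(3) unfolding padic_numbers_def by blast
  then show "v (of_nat n) \<le> 1" using padic_abs_of_int(1)[OF assms(1), of "int n"] by simp
qed

lemma (in nonarchimedean) mcomplete_imp_seq_complete:
  assumes "Metric_space.mcomplete F (\<lambda>x y. v (x - y))"
  shows "seq_complete F"
proof -
  interpret M: Metric_space F "\<lambda>x y. v (x - y)"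
  proof
    show "v (x - z) \<le> v (x - y) + v (y - z)" for x y z
    proof -
      have "v (x - z) \<le> max (v (x - y)) (v (y - z))" using v_add_le_max[of "x - y" "y - z"] by simp
      also have "\<dots> \<le> v (x - y) + v (y - z)" by (rule max.boundedI) simp_all
      finally show ?thesis .
    qed
  qed (auto simp: v_minus_commute)
  show ?thesis
    unfolding seq_complete_def
  proof (intro allI impI)
    fix s assume "range s \<subseteq> F" "Cauchy_seq s"
    then have "M.MCauchy s" unfolding M.MCauchy_def Cauchy_seq_def by meson
    then obtain l where "limitin M.mtopology s l sequentially"
      using assms unfolding M.mcomplete_def by blast
    then show "\<exists>l\<in>F. tends_to s l"
      unfolding M.limit_metric_sequentially tends_to_def by meson
  qed
qed

text \<open>Up to an error of size \<open>1 / p ^ l\<close>, every element of size below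
  \<open>p ^ M\<close> is a fraction \<open>c / p ^ M\<close> with
  \<open>0 \<le> c < p ^ (M + l)\<close>. Density first replaces the element by a rational
  number.\<close>

lemma padic_numbers_bounded_covers:
  assumes p: "prime p" and v: "absolute_value v" and F: "padic_numbers p v F"
  shows "nonarchimedean.bounded_covers v F"
proof -
  interpret nonarchimedean v using padic_numbers_nonarchimedean[OF assms] .
  have p1: "1 < real p" using prime_gt_1_nat[OF p] by simp
  have rat: "v (of_rat q) = padic_abs p q" for q using F unfolding padic_numbers_def by blast
  have int_le: "v (of_int t) \<le> 1" for t using rat[of "of_int t"] padic_abs_of_int(1)[OF p] by simp
  have int_1: "v (of_int t) = 1" if "\<not> int p dvd t" for t
    using rat[of "of_int t"] padic_abs_of_int(2)[OF p that] by simp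
  have vp: "v (of_nat p) = 1 / real p" using rat[of "of_nat p"] padic_abs_of_int(3)[OF p] by simp
  have vpn: "v (of_nat p ^ i) = 1 / real p ^ i" for i by (simp add: v_power vp power_divide)
  have div_le: "v (of_int t) \<le> 1 / real p ^ i" if pt: "int p ^ i dvd t" for t i
  proof -
    obtain s where "t = int p ^ i * s" using pt by blast
    then have "v (of_int t) = 1 / real p ^ i * v (of_int s)" using vpn[of i] by (simp add: v_mult)
    also have "\<dots> \<le> 1 / real p ^ i * 1" using p1 by (intro mult_left_mono int_le) auto
    finally show ?thesis by simp
  qed
  show ?thesis
    unfolding bounded_covers_def
  proof (intro allI impI)
    fix C e :: real assume e: "0 < e"
    obtain M where M: "C < real p ^ M" using real_arch_pow[OF p1] by blast
    obtain l where l: "1 / e < real p ^ l" using real_arch_pow[OF p1] by blast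
    define P where "P = (of_nat p :: 'a) ^ M"
    have vP: "v P = 1 / real p ^ M" by (simp add: P_def vpn)
    have P0: "P \<noteq> 0" using p1 by (auto simp: P_def)
    define R where "R = (\<lambda>c. of_int c / P) ` {0..<int p ^ (M + l)}"
    have "\<exists>r\<in>R. v (x - r) < e" if x: "x \<in> F" "v x \<le> C" for x
    proof -
      \<comment> \<open>The bound \<open>p ^ M\<close> keeps \<open>q\<close> itself in the ball
        that contains \<open>x\<close>.\<close>
      have "0 < min e (real p ^ M)" using e p1 by simp
      then obtain q where q: "v (x - of_rat q) < min e (real p ^ M)"
        using F x(1) unfolding padic_numbers_def by meson
      have "v (of_rat q) \<le> real p ^ M"
        using v_diff_le_max[of x "x - of_rat q"] q x(2) M by (simp add: max_def split: if_splits)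
      define s where "s = of_nat p ^ M * q"
      have s: "of_rat s = P * of_rat q" by (simp add: s_def P_def of_rat_mult of_rat_power)
      have "v (of_rat s) \<le> 1"
        using \<open>v (of_rat q) \<le> real p ^ M\<close> p1 by (simp add: s v_mult vP field_simps)
      obtain a b where ab: "quotient_of s = (a, b)" by fastforce
      have b: "b > 0" "coprime a b" using quotient_of_denom_pos[OF ab] quotient_of_coprime[OF ab] by auto
      have sab: "(of_rat s :: 'a) * of_int b = of_int a"
        using quotient_of_div[OF ab] b by (simp add: of_rat_divide)
      \<comment> \<open>If \<open>p\<close> divided \<open>b\<close>, then \<open>a\<close> would be
        prime to \<open>p\<close> and the sizes of \<open>s\<close> and \<open>b\<close> would
        multiply to 1, although the first is at most 1 and the second at most
        \<open>1 / p\<close>.\<close>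
      have pb: "\<not> int p dvd b"
      proof
        assume "int p dvd b"
        moreover have "\<not> is_unit (int p)" using prime_gt_1_nat[OF p] by simp
        ultimately have "\<not> int p dvd a" using b(2) coprime_common_divisor[of a b "int p"] by blast
        then have "v (of_rat s) * v (of_int b) = 1" using int_1[of a] unfolding sab[symmetric] v_mult by simp
        moreover have "v (of_int b) \<le> 1 / real p" using div_le[of 1 b] \<open>int p dvd b\<close> by (simp only: power_one_right)
        moreover have "1 / real p < 1" using p1 by simp
        moreover have "v (of_rat s) * v (of_int b) \<le> 1 * v (of_int b)"
          using \<open>v (of_rat s) \<le> 1\<close> by (intro mult_right_mono) auto
        ultimately show False by linarith
      qed
      have "coprime b (int p ^ (M + l))"
        using prime_imp_coprime[of "int p" b] pb p by (simp add: coprime_commute)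
      \<comment> \<open>\<open>s'\<close> inverts \<open>b\<close> modulo
        \<open>p ^ (M + l)\<close>, so \<open>a * s'\<close> represents \<open>s = a / b\<close>
        there.\<close>
      then obtain s' t where st: "s' * b + t * int p ^ (M + l) = 1"
        using bezout_int[of b "int p ^ (M + l)"] by (auto simp: coprime_iff_gcd_eq_1)
      define c where "c = (a * s') mod int p ^ (M + l)"
      have c_eq: "c = a * s' - int p ^ (M + l) * (a * s' div int p ^ (M + l))"
        by (simp add: c_def minus_mult_div_eq_mod)
      have "b * c - a = a * (s' * b - 1) - int p ^ (M + l) * (b * (a * s' div int p ^ (M + l)))"
        by (subst c_eq) (simp add: algebra_simps)
      also have "s' * b - 1 = int p ^ (M + l) * (- t)" using st by (simp add: algebra_simps)
      also have "a * (int p ^ (M + l) * (- t)) = int p ^ (M + l) * (a * (- t))" by simp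
      finally have "int p ^ (M + l) dvd (b * c - a)" by (metis dvd_diff dvd_triv_left)
      then have "v (of_int (b * c - a)) \<le> 1 / real p ^ (M + l)" by (rule div_le)
      also have "of_int (b * c - a) = of_int b * (of_int c - of_rat s :: 'a)"
        by (simp add: algebra_simps flip: sab)
      finally have vs: "v (of_int c - of_rat s) \<le> 1 / real p ^ (M + l)"
        by (simp add: v_mult int_1[OF pb])
      have "v (of_rat q - of_int c / P) = v ((of_int c - of_rat s) / P)"
        using P0 by (subst v_minus_commute) (simp add: s diff_divide_distrib)
      also have "\<dots> \<le> 1 / real p ^ l"
        using vs p1 by (simp add: v_divide vP power_add field_simps)
      also have "\<dots> < e" using l e p1 by (simp add: field_simps)
      finally have "v (of_rat q - of_int c / P) < e" .
      moreover have "v (x - of_rat q) < e" using q by simp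
      ultimately have "v (x - of_int c / P) < e" by (rule v_triangle[rotated])
      moreover have "of_int c / P \<in> R"
        using prime_gt_0_nat[OF p] by (auto simp: R_def c_def)
      ultimately show ?thesis by blast
    qed
    moreover have "finite R" by (simp add: R_def)
    ultimately show "\<exists>R. finite R \<and> (\<forall>x\<in>F. v x \<le> C \<longrightarrow> (\<exists>r\<in>R. v (x - r) < e))" by blast
  qed
qed

section \<open>Square roots, and squares modulo the maximal ideal\<close>

lemma card_image_eq_of_kernel_eq:
  assumes "\<And>x y. x \<in> A \<Longrightarrow> y \<in> A \<Longrightarrow> h x = h y \<longleftrightarrow> f x = f y"
  shows "card (h ` A) = card (f ` A)"
proof -
  obtain r where r: "\<And>y. y \<in> f ` A \<Longrightarrow> r y \<in> A \<and> f (r y) = y"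
    using bchoice[of "f ` A" "\<lambda>y x. x \<in> A \<and> f x = y"] by blast
  have "inj_on (\<lambda>y. h (r y)) (f ` A)"
  proof (rule inj_onI)
    fix y z assume "y \<in> f ` A" "z \<in> f ` A" "h (r y) = h (r z)"
    then show "y = z" using r[of y] r[of z] assms[of "r y" "r z"] by simp
  qed
  moreover have "(\<lambda>y. h (r y)) ` f ` A = h ` A"
  proof -
    have "h (r (f x)) = h x" if "x \<in> A" for x using r[of "f x"] assms[of "r (f x)" x] that by simp
    then show ?thesis by (auto simp: image_image)
  qed
  ultimately show ?thesis by (metis card_image)
qed

context nonarchimedean
begin

text \<open>Put \<open>s = a + t\<close>. Then \<open>s^2 = d\<close> is the fixed point equation
  \<open>t = (d - a^2 - t^2) / (2 * a)\<close>, and its right-hand side \<open>g\<close> contracts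
  by the factor \<open>\<rho>\<close> on \<open>v t \<le> \<rho>\<close>, because
  \<open>2 * a\<close> is a unit and \<open>g x - g y = (y - x) * (y + x) / (2 * a)\<close>.\<close>

lemma hensel_sqrt:
  assumes k: "type_subfield k" "seq_complete k" and two: "v 2 = 1"
    and a: "a \<in> k" "v a = 1" and d: "d \<in> k" "v (d - a\<^sup>2) < 1"
  shows "\<exists>s\<in>k. s\<^sup>2 = d \<and> v (s - a) < 1"
proof -
  note k' = type_subfieldD[OF k(1)]
  define \<rho> where "\<rho> = v (d - a\<^sup>2)"
  have \<rho>: "0 \<le> \<rho>" "\<rho> < 1" using d by (simp_all add: \<rho>_def)
  define g where "g t = (d - a\<^sup>2 - t\<^sup>2) / (2 * a)" for t
  define T where "T n = (g ^^ n) 0" for n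
  have a0: "a \<noteq> 0" and t0: "(2::'a) \<noteq> 0" using a(2) two by force+
  have T_Suc: "T (Suc n) = g (T n)" for n by (simp add: T_def)
  have vg: "v (g t) = v (d - a\<^sup>2 - t\<^sup>2)" for t by (simp add: g_def v_divide v_mult two a)
  have g_diff: "g x - g y = (y - x) * (y + x) / (2 * a)" for x y
    unfolding g_def diff_divide_distrib[symmetric] by (simp add: power2_eq_square algebra_simps)
  have T: "T n \<in> k \<and> v (T n) \<le> \<rho>" for n
  proof (induction n)
    case 0 then show ?case using k'(1) \<rho> by (simp add: T_def)
  next
    case (Suc n)
    have "v (T n) ^ 2 \<le> \<rho> * 1" unfolding power2_eq_square using Suc \<rho> by (intro mult_mono) auto
    then have "v (g (T n)) \<le> \<rho>" unfolding vg using v_diff_le[of "d - a\<^sup>2" \<rho> "(T n)\<^sup>2"] by (simp add: \<rho>_def v_power)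
    moreover have "g (T n) \<in> k" unfolding g_def using Suc a d by (intro k'(7,8,9,4,11)) auto
    ultimately show ?case by (simp add: T_Suc)
  qed
  have step: "v (T (Suc n) - T n) \<le> \<rho> ^ Suc n" for n
  proof (induction n)
    case 0
    then show ?case by (simp add: T_def vg \<rho>_def)
  next
    case (Suc n)
    have "T (Suc (Suc n)) - T (Suc n) = (T n - T (Suc n)) * (T n + T (Suc n)) / (2 * a)"
      using g_diff[of "T (Suc n)" "T n"] T_Suc by simp
    then have "v (T (Suc (Suc n)) - T (Suc n)) = v (T (Suc n) - T n) * v (T n + T (Suc n))"
      by (simp add: v_divide v_mult two a v_minus_commute)
    also have "\<dots> \<le> \<rho> ^ Suc n * \<rho>"
      using Suc T \<rho> by (intro mult_mono v_add_le) auto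
    finally show ?case by (simp add: mult.commute)
  qed
  have dist: "v (T (n + i) - T n) \<le> \<rho> ^ Suc n" for n i
  proof (induction i)
    case (Suc i)
    have "\<rho> ^ Suc (n + i) \<le> \<rho> ^ Suc n" using \<rho> by (intro power_decreasing) auto
    then have "v (T (Suc (n + i)) - T (n + i)) \<le> \<rho> ^ Suc n" using step[of "n + i"] by simp
    from v_add_le[OF this Suc] show ?case by simp
  qed (use \<rho> in simp)
  have small: "\<exists>M. \<forall>n\<ge>M. \<rho> ^ Suc n < e" if e: "e > 0" for e
  proof -
    obtain M where "\<rho> ^ M < e" using real_arch_pow_inv[OF e \<rho>(2)] by blast
    moreover have "\<rho> ^ Suc n \<le> \<rho> ^ M" if "n \<ge> M" for n using \<rho> that by (intro power_decreasing) auto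
    ultimately show ?thesis by (meson le_less_trans)
  qed
  have "Cauchy_seq T"
    unfolding Cauchy_seq_def
  proof (intro allI impI)
    fix e :: real assume "0 < e"
    then obtain M where M: "\<rho> ^ Suc M < e" using small by blast
    have "v (T m - T M) < e" if "m \<ge> M" for m
      using dist[of M "m - M"] M that by simp
    then have "v (T m - T n) < e" if "m \<ge> M" "n \<ge> M" for m n
      using that v_triangle[of "T m" "T M" e "T n"] by (simp add: v_minus_commute[of "T M"])
    then show "\<exists>M. \<forall>m\<ge>M. \<forall>n\<ge>M. v (T m - T n) < e" by blast
  qed
  then obtain t where t: "t \<in> k" "tends_to T t"
    using k(2) T unfolding seq_complete_def by blast
  have vt: "v t < 1"
  proof -
    obtain M where M: "\<forall>n\<ge>M. v (T n - t) < 1" using t(2)[unfolded tends_to_def, rule_format, of 1] by auto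
    then have "v (T M - t) < 1" by blast
    moreover have "v (T M) < 1" using T[of M] \<rho> by simp
    ultimately show ?thesis using v_diff_less[of "T M" 1 "T M - t"] by simp
  qed
  have "v ((a + t)\<^sup>2 - d) < e" if e: "e > 0" for e
  proof -
    obtain M where M: "\<forall>n\<ge>M. v (T n - t) < e" using t(2) e unfolding tends_to_def by meson
    obtain M' where M': "\<forall>n\<ge>M'. \<rho> ^ Suc n < e" using small e by blast
    define n where "n = max M M'"
    have "2 * a * g (T n) = d - a\<^sup>2 - (T n)\<^sup>2" using a0 t0 by (simp add: g_def)
    \<comment> \<open>The defect at step \<open>n\<close> is a unit times the increment of the
      iteration, hence small.\<close>
    then have "(a + T n)\<^sup>2 - d = 2 * a * (T n - T (Suc n))"
      by (simp add: T_Suc power2_eq_square algebra_simps)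
    then have "v ((a + T n)\<^sup>2 - d) = v (T (Suc n) - T n)" by (simp add: v_mult two a v_minus_commute)
    also have "\<dots> < e" using step[of n] M'[rule_format, of n] by (simp add: n_def)
    finally have 1: "v ((a + T n)\<^sup>2 - d) < e" .
    have "v (2 * a + (t + T n)) \<le> 1"
      using vt T[of n] \<rho> by (intro v_add_le) (auto simp: v_mult two a)
    then have "v (t - T n) * v (2 * a + (t + T n)) \<le> v (t - T n) * 1" by (intro mult_left_mono) auto
    moreover have "v (t - T n) < e" using M by (simp add: n_def v_minus_commute)
    moreover have "(a + t)\<^sup>2 - (a + T n)\<^sup>2 = (t - T n) * (2 * a + (t + T n))"
      by (simp add: power2_eq_square algebra_simps)
    ultimately have "v ((a + t)\<^sup>2 - (a + T n)\<^sup>2) < e" by (simp add: v_mult)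
    from v_triangle[OF this 1] show ?thesis .
  qed
  then have "v ((a + t)\<^sup>2 - d) = 0" by (metis less_irrefl v_nonneg order_le_less)
  then show ?thesis using t vt a k'(3) by (intro bexI[of _ "a + t"]) auto
qed

text \<open>Pigeonhole in the residue field: squaring identifies only opposite classes, and 0 only
  with itself, so more than half of the classes are squares. The map sending \<open>b\<close> to
  \<open>u + d * b^2\<close> has the same fibres, hence also fills more than half, and the two
  images meet.\<close>

lemma residue_square_representation:
  assumes k: "type_subfield k" "bounded_covers k" and two: "v 2 = 1"
    and u: "u \<in> k" "v u \<le> 1" and d: "d \<in> k" "v d = 1"
  shows "\<exists>a\<in>k. \<exists>b\<in>k. v a \<le> 1 \<and> v b \<le> 1 \<and> v (a\<^sup>2 - (u + d * b\<^sup>2)) < 1"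
proof -
  note k' = type_subfieldD[OF k(1)]
  define O' where "O' = {x \<in> k. v x \<le> 1}"
  \<comment> \<open>Residue classes are taken as subsets of \<open>O'\<close> without forming a
    quotient field; \<open>cl x\<close> makes sense also for a covering centre \<open>x\<close>
    outside \<open>k\<close>.\<close>
  define cl where "cl x = {y \<in> O'. v (y - x) < 1}" for x
  have cl_cong: "cl x = cl y" if "v (x - y) < 1" for x y
  proof -
    have "v (z - x) < 1 \<longleftrightarrow> v (z - y) < 1" for z
      using that v_triangle[of z x 1 y] v_triangle[of z y 1 x] v_minus_commute[of x y] by auto
    then show ?thesis by (simp add: cl_def)
  qed
  have cl_eq: "cl x = cl y \<longleftrightarrow> v (x - y) < 1" if "x \<in> O'" "y \<in> O'" for x y
  proof
    assume "cl x = cl y"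
    moreover have "x \<in> cl x" using that by (simp add: cl_def)
    ultimately show "v (x - y) < 1" by (simp add: cl_def)
  qed (rule cl_cong)
  obtain R where R: "finite R" "\<And>x. x \<in> k \<Longrightarrow> v x \<le> 1 \<Longrightarrow> \<exists>r\<in>R. v (x - r) < 1"
    using k(2)[unfolded bounded_covers_def, rule_format, of 1 1] by auto
  define Q where "Q = cl ` O'"
  have "Q \<subseteq> cl ` R"
  proof
    fix q assume "q \<in> Q"
    then obtain x where x: "x \<in> O'" "q = cl x" by (auto simp: Q_def)
    then obtain r where r: "r \<in> R" "v (x - r) < 1" using R(2) by (auto simp: O'_def)
    then show "q \<in> cl ` R" using x r cl_cong by auto
  qed
  then have finQ: "finite Q" using R(1) finite_surj by blast
  define rep where "rep q = (SOME x. x \<in> O' \<and> cl x = q)" for q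
  have rep: "rep q \<in> O'" "cl (rep q) = q" if "q \<in> Q" for q
    using that someI_ex[of "\<lambda>x. x \<in> O' \<and> cl x = q"] unfolding rep_def Q_def by auto
  define f where "f q = cl ((rep q)\<^sup>2)" for q
  have sqO: "x\<^sup>2 \<in> O'" if "x \<in> O'" for x
    using that k'(9) by (auto simp: O'_def v_power power_le_one)
  have uO: "u + d * x\<^sup>2 \<in> O'" if "x \<in> O'" for x
    using sqO[OF that] k'(3,4) u d by (auto simp: O'_def v_mult intro!: v_add_le)
  have cl0: "cl 0 \<in> Q" using k'(1) by (auto simp: Q_def O'_def)
  have fibre: "q = q' \<or> q = cl (- rep q')" if "q \<in> Q" "q' \<in> Q" "f q = f q'" for q q'
  proof -
    let ?r = "rep q" and ?s = "rep q'"
    have O: "?r \<in> O'" "?s \<in> O'" "- ?s \<in> O'" using rep that k'(5) by (auto simp: O'_def)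
    have "v (?r\<^sup>2 - ?s\<^sup>2) < 1" using that(3) cl_eq sqO O unfolding f_def by simp
    also have "?r\<^sup>2 - ?s\<^sup>2 = (?r - ?s) * (?r - - ?s)" by (simp add: power2_eq_square algebra_simps)
    finally have "v (?r - ?s) * v (?r - - ?s) < 1" by (simp add: v_mult)
    moreover have "v (?r - ?s) \<le> 1" "v (?r - - ?s) \<le> 1" using O by (auto simp: O'_def intro: v_diff_le v_add_le)
    ultimately have "v (?r - ?s) < 1 \<or> v (?r - - ?s) < 1" by (metis less_irrefl mult_1 order_less_le)
    then have "cl ?r = cl ?s \<or> cl ?r = cl (- ?s)" using cl_eq O by blast
    then show ?thesis using rep that by simp
  qed
  have fibre0: "q = cl 0" if "q \<in> Q" "f q = f (cl 0)" for q
  proof -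
    have r0: "v (rep (cl 0)) < 1"
      using cl_eq[of "rep (cl 0)" 0] rep[OF cl0] k'(1) by (simp add: O'_def)
    then have "v (- rep (cl 0) - 0) < 1" by simp
    then have "cl (- rep (cl 0)) = cl 0"
      using cl_eq[of "- rep (cl 0)" 0] rep[OF cl0] k'(1,5) by (simp add: O'_def)
    then show ?thesis using fibre[OF that(1) cl0 that(2)] by auto
  qed
  have card: "card Q < 2 * card (f ` Q)"
  proof -
    have "card Q = (\<Sum>y\<in>f ` Q. card {q \<in> Q. f q = y})"
      using sum.image_gen[OF finQ, of "\<lambda>_. 1::nat" f] by simp
    also have "\<dots> < (\<Sum>y\<in>f ` Q. 2)"
    proof (rule sum_strict_mono_ex1)
      show "\<forall>y\<in>f ` Q. card {q \<in> Q. f q = y} \<le> 2"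
      proof
        fix y assume "y \<in> f ` Q"
        then obtain q' where q': "q' \<in> Q" "y = f q'" by blast
        have "card {q \<in> Q. f q = y} \<le> card {q', cl (- rep q')}"
          using fibre[OF _ q'(1)] q'(2) by (intro card_mono) auto
        also have "\<dots> \<le> 2" by (simp add: card_insert_if)
        finally show "card {q \<in> Q. f q = y} \<le> 2" .
      qed
      \<comment> \<open>The class of 0 is opposite to itself, so its fibre is a single class and the
        count becomes strict.\<close>
      have "card {q \<in> Q. f q = f (cl 0)} \<le> card {cl 0}" using fibre0 by (intro card_mono) auto
      then show "\<exists>y\<in>f ` Q. card {q \<in> Q. f q = y} < 2" using cl0 by (intro bexI[of _ "f (cl 0)"]) auto
    qed (use finQ in simp)
    finally show ?thesis by simp
  qed
  define h where "h q = cl (u + d * (rep q)\<^sup>2)" for q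
  \<comment> \<open>Differences of values of the two maps agree up to the unit factor
    \<open>d\<close>.\<close>
  have h: "h q = h q' \<longleftrightarrow> f q = f q'" if "q \<in> Q" "q' \<in> Q" for q q'
  proof -
    have "h q = h q' \<longleftrightarrow> v (u + d * (rep q)\<^sup>2 - (u + d * (rep q')\<^sup>2)) < 1"
      unfolding h_def using cl_eq uO rep that by simp
    also have "u + d * (rep q)\<^sup>2 - (u + d * (rep q')\<^sup>2) = d * ((rep q)\<^sup>2 - (rep q')\<^sup>2)" by (simp add: algebra_simps)
    finally show ?thesis unfolding f_def using cl_eq sqO rep that d by (simp add: v_mult)
  qed
  have card_h: "card (h ` Q) = card (f ` Q)"
    using h by (rule card_image_eq_of_kernel_eq)
  have sub: "f ` Q \<subseteq> Q" "h ` Q \<subseteq> Q" using sqO uO rep by (auto simp: f_def h_def Q_def)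
  have "f ` Q \<inter> h ` Q \<noteq> {}"
  proof
    assume "f ` Q \<inter> h ` Q = {}"
    then have "card (f ` Q \<union> h ` Q) = 2 * card (f ` Q)" using finQ card_h by (simp add: card_Un_disjoint)
    moreover have "card (f ` Q \<union> h ` Q) \<le> card Q" using sub finQ by (intro card_mono) auto
    ultimately show False using card by simp
  qed
  then obtain q q' where q: "q \<in> Q" "q' \<in> Q" "f q = h q'" by blast
  then have "v ((rep q)\<^sup>2 - (u + d * (rep q')\<^sup>2)) < 1"
    using cl_eq sqO uO rep unfolding f_def h_def by simp
  then show ?thesis using rep[OF q(1)] rep[OF q(2)] unfolding O'_def by blast
qed

end

section \<open>Unramified quadratic extensions\<close>

text \<open>All the arithmetic of k'/k that the lattices need. The subfield k survives only as the
  set of fixed points of \<sigma>. \<open>v_2\<close> records that p is odd,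
  \<open>value_group\<close> that k'/k is unramified, and \<open>quadratic_root\<close> is Hensel's
  lemma for a quadratic whose linear coefficient is a unit while the leading one, possibly 0, is
  not.\<close>

locale hermitian_field = nonarchimedean v for v :: "'a::field \<Rightarrow> real" +
  fixes \<sigma> :: "'a \<Rightarrow> 'a" and \<pi> :: 'a
  assumes conj_add: "\<sigma> (x + y) = \<sigma> x + \<sigma> y"
    and conj_mult: "\<sigma> (x * y) = \<sigma> x * \<sigma> y"
    and conj_conj [simp]: "\<sigma> (\<sigma> x) = x"
    and v_conj [simp]: "v (\<sigma> x) = v x"
    and v_2: "v 2 = 1"
    and conj_pi [simp]: "\<sigma> \<pi> = \<pi>"
    and pi_nonzero [simp]: "\<pi> \<noteq> 0"
    and v_pi_less_1: "v \<pi> < 1"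
    and value_group: "x \<noteq> 0 \<Longrightarrow> \<exists>m. v x = v \<pi> powi m"
    and unit_is_norm: "\<sigma> u = u \<Longrightarrow> v u = 1 \<Longrightarrow> \<exists>a. a * \<sigma> a = u"
    and quadratic_root: "\<lbrakk>\<sigma> \<alpha> = \<alpha>; v \<alpha> \<le> 1; \<sigma> \<epsilon> = \<epsilon>; v \<epsilon> = 1; \<sigma> q = q; v q < 1\<rbrakk> \<Longrightarrow>
      \<exists>c. \<sigma> c = c \<and> v c \<le> 1 \<and> \<alpha> + 2 * c * \<epsilon> + c\<^sup>2 * q = 0"

text \<open>Cramer's rule: \<open>D\<close> is the determinant of the coordinates of 1 and
  \<open>\<theta>\<close> with respect to \<open>w1\<close> and \<open>w2\<close>. It cannot vanish,
  since then \<open>\<theta>\<close> would be a quotient of elements of \<open>k\<close>.\<close>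

lemma dimension_2_basis:
  fixes k :: "'a::field set"
  assumes "ring.dimension ring_of_type_algebra 2 k UNIV" and sub: "subfield k ring_of_type_algebra"
    and t: "\<theta> \<notin> k"
  shows "\<exists>a\<in>k. \<exists>b\<in>k. x = a + b * \<theta>"
proof -
  interpret R: field "ring_of_type_algebra :: 'a ring" by (rule field_from_type_algebra)
  note k' = type_subfieldD[OF subfield_imp_type_subfield[OF sub]]
  have "R.dimension (Suc (Suc 0)) k UNIV" using assms(1) by (simp add: numeral_2_eq_2)
  then obtain w1 E where w1: "UNIV = R.line_extension k w1 E" "R.dimension (Suc 0) k E"
    using R.dimension_backwards[OF sub] by blast
  then obtain w2 E' where w2: "E = R.line_extension k w2 E'" "R.dimension 0 k E'"
    using R.dimension_backwards[OF sub] by blast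
  have "E' = {0}" using R.dimension_zero[OF sub w2(2)] by simp
  have span: "\<exists>a\<in>k. \<exists>b\<in>k. x = a * w1 + b * w2" for x
  proof -
    obtain a y where y: "a \<in> k" "y \<in> E" "x = a * w1 + y"
      using UNIV_I[of x] unfolding w1(1) R.line_extension_mem_iff by auto
    moreover obtain b where "b \<in> k" "y = b * w2"
      using y(2) \<open>E' = {0}\<close> unfolding w2(1) R.line_extension_mem_iff by auto
    ultimately show ?thesis by blast
  qed
  obtain a0 b0 where 0: "a0 \<in> k" "b0 \<in> k" "1 = a0 * w1 + b0 * w2" using span by blast
  obtain a1 b1 where 1: "a1 \<in> k" "b1 \<in> k" "\<theta> = a1 * w1 + b1 * w2" using span by blast
  define D where "D = a0 * b1 - a1 * b0"
  have "D \<noteq> 0"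
  proof
    assume "D = 0"
    then have D: "a0 * b1 = a1 * b0" by (simp add: D_def)
    have "a0 * \<theta> = a0 * a1 * w1 + (a0 * b1) * w2" by (simp add: 1(3) algebra_simps)
    also have "\<dots> = a1 * (a0 * w1 + b0 * w2)" unfolding D by (simp add: algebra_simps)
    finally have e1: "a0 * \<theta> = a1" using 0(3) by simp
    have "b0 * \<theta> = (a1 * b0) * w1 + b0 * b1 * w2" by (simp add: 1(3) algebra_simps)
    also have "\<dots> = b1 * (a0 * w1 + b0 * w2)" unfolding D[symmetric] by (simp add: algebra_simps)
    finally have e2: "b0 * \<theta> = b1" using 0(3) by simp
    have "a0 \<noteq> 0 \<or> b0 \<noteq> 0" using 0(3) by auto
    then have "\<theta> = a1 / a0 \<or> \<theta> = b1 / b0" using e1 e2 by (auto simp: field_simps)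
    then show False using t k'(8) 0 1 by auto
  qed
  obtain a b where x: "a \<in> k" "b \<in> k" "x = a * w1 + b * w2" using span by blast
  have "D * w1 = b1 * 1 - b0 * \<theta>" unfolding 0(3) 1(3) D_def by (simp add: algebra_simps)
  moreover have "D * w2 = a0 * \<theta> - a1 * 1" unfolding 0(3) 1(3) D_def by (simp add: algebra_simps)
  moreover have "D * x = a * (D * w1) + b * (D * w2)" unfolding x(3) by (simp add: algebra_simps)
  ultimately have "D * x = a * (b1 * 1 - b0 * \<theta>) + b * (a0 * \<theta> - a1 * 1)" by simp
  then have "D * x = (a * b1 - b * a1) + (b * a0 - a * b0) * \<theta>" by (simp add: algebra_simps)
  moreover have "x = y / D + z / D * \<theta>" if "D * x = y + z * \<theta>" for y z
    using that \<open>D \<noteq> 0\<close> by (simp add: field_simps)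
  ultimately have "x = (a * b1 - b * a1) / D + (b * a0 - a * b0) / D * \<theta>" by blast
  moreover have "D \<in> k" unfolding D_def using 0 1 by (intro k'(7,4))
  then have "(a * b1 - b * a1) / D \<in> k" "(b * a0 - a * b0) / D \<in> k" using 0 1 x by (auto intro!: k'(8,7,4))
  ultimately show ?thesis by blast
qed

text \<open>Everything is read off from a unit \<open>w\<close> with
  \<open>\<sigma> w = - w\<close>: then \<open>a + b * w\<close> has norm
  \<open>a^2 - d * b^2\<close>, where \<open>d = w^2\<close> is a unit of \<open>k\<close>.\<close>

lemma unramified_quadratic_hermitian_field:
  fixes v :: "'a::field_char_0 \<Rightarrow> real"
  assumes p: "prime p" "odd p" and av: "absolute_value v" and Qp: "padic_numbers p v Qp"
    and ext: "finite_extension Qp k" and unram: "unramified_quadratic v k"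
    and aut: "nontrivial_automorphism k \<sigma>" and pe: "prime_element_of v k \<pi>"
  shows "hermitian_field v \<sigma> \<pi>"
proof -
  interpret nonarchimedean v using padic_numbers_nonarchimedean[OF p(1) av Qp] .
  have "type_subfield Qp" "seq_complete Qp" "bounded_covers Qp"
    using Qp padic_numbers_bounded_covers[OF p(1) av Qp]
    by (auto simp: padic_numbers_def intro: subfield_imp_type_subfield mcomplete_imp_seq_complete)
  then have k: "seq_complete k" "bounded_covers k"
    using finite_dimension_complete ext unfolding finite_extension_def by blast+
  have sub: "subfield k (ring_of_type_algebra :: 'a ring)" using ext unfolding finite_extension_def by blast
  have ks: "type_subfield k" using sub by (rule subfield_imp_type_subfield)
  note k' = type_subfieldD[OF ks]
  have two: "v 2 = 1"
  proof -
    have "\<not> p dvd 2" using p prime_gt_1_nat[OF p(1)] dvd_imp_le[of p 2] by (cases "p = 2") auto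
    then have "\<not> int p dvd 2" by (metis int_dvd_int_iff of_nat_numeral)
    then have "padic_abs p (of_int 2) = 1" using padic_abs_of_int(2)[OF p(1)] by blast
    moreover have "v (of_rat 2) = padic_abs p 2" using Qp unfolding padic_numbers_def by blast
    ultimately show ?thesis by simp
  qed
  have hom: "\<sigma> (x + y) = \<sigma> x + \<sigma> y" "\<sigma> (x * y) = \<sigma> x * \<sigma> y" "\<sigma> 1 = 1" for x y
    using aut unfolding nontrivial_automorphism_def ring_iso_def Ring.ring_hom_def by auto
  have fixk: "\<sigma> x = x" if "x \<in> k" for x using aut that unfolding nontrivial_automorphism_def by blast
  have s0: "\<sigma> 0 = 0" using fixk k'(1) by blast
  have sp: "\<sigma> (x ^ n) = \<sigma> x ^ n" for x n by (induction n) (simp_all add: hom)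
  obtain \<theta> where \<theta>: "\<sigma> \<theta> \<noteq> \<theta>" using aut unfolding nontrivial_automorphism_def by (auto simp: fun_eq_iff)
  have dim: "ring.dimension (ring_of_type_algebra :: 'a ring) 2 k UNIV"
    using unram unfolding unramified_quadratic_def by blast
  have value_in_k: "\<exists>c\<in>k. c \<noteq> 0 \<and> v x = v c" if "x \<noteq> 0" for x
  proof -
    have "v x \<in> v ` (UNIV - {0})" using that by simp
    also have "\<dots> = v ` (k - {0})" using unram unfolding unramified_quadratic_def by blast
    finally show ?thesis by auto
  qed
  have "\<theta> \<notin> k" using \<theta> fixk by blast
  then obtain A B where AB: "A \<in> k" "B \<in> k" "\<theta>\<^sup>2 = A + B * \<theta>"
    using dimension_2_basis[OF dim sub] by blast
  \<comment> \<open>Completing the square in the quadratic equation of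
    \<open>\<theta>\<close>.\<close>
  define w0 where "w0 = \<theta> - B / 2"
  have B2: "B / 2 \<in> k" using AB k'(8,11) by blast
  have "w0\<^sup>2 = A + (B / 2)\<^sup>2"
    using AB(3) by (simp add: w0_def power2_eq_square algebra_simps)
  then have w0k: "w0\<^sup>2 \<in> k" using AB B2 k'(3,9) by simp
  have w0n: "\<sigma> w0 \<noteq> w0"
  proof
    assume "\<sigma> w0 = w0"
    then have "\<sigma> (w0 + B / 2) = w0 + B / 2" using hom(1) fixk[OF B2] by simp
    then show False using \<theta> by (simp add: w0_def)
  qed
  have "(\<sigma> w0)\<^sup>2 = w0\<^sup>2" using fixk[OF w0k] sp by simp
  then have sw0: "\<sigma> w0 = - w0" using w0n by (simp add: power2_eq_iff)
  have "w0 \<noteq> 0" using w0n s0 by auto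
  \<comment> \<open>Here unramifiedness enters: \<open>w0\<close> has the size of some element of
    \<open>k\<close> and can be scaled to a unit.\<close>
  then obtain c where c: "c \<in> k" "c \<noteq> 0" "v w0 = v c"
    using value_in_k by blast
  define w where "w = inverse c * w0"
  have vw: "v w = 1" using c by (simp add: w_def v_mult v_inverse)
  have sw: "\<sigma> w = - w" using sw0 fixk[OF k'(6)[OF c(1)]] by (simp add: w_def hom)
  define d where "d = w\<^sup>2"
  have "d = (inverse c)\<^sup>2 * w0\<^sup>2" by (simp add: d_def w_def power_mult_distrib)
  then have d: "d \<in> k" using k'(4,6,9) c w0k by simp
  have vd: "v d = 1" using vw by (simp add: d_def v_power)
  note d = d vd
  have wk: "w \<notin> k"
  proof
    assume "w \<in> k"
    then have "w - \<sigma> w = 0" using fixk by simp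
    then have "2 * w = 0" unfolding sw by (simp only: diff_minus_eq_add mult_2)
    then show False using vw by simp
  qed
  note basis = dimension_2_basis[OF dim sub wk]
  have s_basis: "\<sigma> (a + b * w) = a - b * w" if "a \<in> k" "b \<in> k" for a b
    using that fixk sw by (simp add: hom)
  have invol: "\<sigma> (\<sigma> x) = x" for x
  proof -
    obtain a b where ab: "a \<in> k" "b \<in> k" "x = a + b * w" using basis by blast
    have "\<sigma> x = a + (- b) * w" using s_basis ab by simp
    then show ?thesis using s_basis[of a "- b"] ab k'(5) by simp
  qed
  have fixed_in_k: "x \<in> k" if "\<sigma> x = x" for x
  proof -
    obtain a b where ab: "a \<in> k" "b \<in> k" "x = a + b * w" using basis by blast
    have "2 * (b * w) = x - \<sigma> x" unfolding ab(3) s_basis[OF ab(1,2)] by simp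
    then have "b * w = 0" using that by simp
    then show ?thesis using ab by auto
  qed
  obtain \<delta> where \<delta>: "\<delta> > 0" "\<And>e. e \<in> k \<Longrightarrow> \<delta> \<le> v (w - e)"
    using seq_complete_dist_pos[OF k(1) wk] by blast
  \<comment> \<open>\<open>\<sigma> x\<close> is \<open>x - 2 * b * w\<close>, and
    \<open>v b\<close> is at most \<open>v x / \<delta>\<close> since \<open>w\<close> keeps the
    distance \<open>\<delta>\<close> from \<open>k\<close>.\<close>
  have bound: "v (\<sigma> x) \<le> max 1 (1 / \<delta>) * v x" for x
  proof -
    obtain a b where ab: "a \<in> k" "b \<in> k" "x = a + b * w" using basis by blast
    have vb: "v b * \<delta> \<le> v x"
    proof (cases "b = 0")
      case False
      have "\<delta> \<le> v (w - - (a / b))" using \<delta>(2)[OF k'(5)[OF k'(8)[OF ab(1,2)]]] .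
      then have "v b * \<delta> \<le> v b * v (w + a / b)" by (simp add: mult_left_mono)
      also have "\<dots> = v (b * (w + a / b))" by (simp add: v_mult)
      also have "b * (w + a / b) = x" using False ab by (simp add: field_simps)
      finally show ?thesis .
    qed simp
    have "\<sigma> x = x - 2 * b * w" using s_basis ab by (simp add: algebra_simps)
    then have "v (\<sigma> x) \<le> max (v x) (v b)" using v_diff_le_max[of x "2 * b * w"] by (simp add: v_mult two vw)
    also have "\<dots> \<le> max 1 (1 / \<delta>) * v x"
    proof (rule max.boundedI)
      show "v x \<le> max 1 (1 / \<delta>) * v x" using mult_right_mono[of 1 "max 1 (1/\<delta>)" "v x"] by simp
      have "v b \<le> 1 / \<delta> * v x" using vb \<delta>(1) by (simp add: field_simps)
      also have "\<dots> \<le> max 1 (1 / \<delta>) * v x" by (intro mult_right_mono) auto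
      finally show "v b \<le> max 1 (1 / \<delta>) * v x" .
    qed
    finally show ?thesis .
  qed
  \<comment> \<open>The bound applied to all powers of \<open>x\<close> loses its constant.\<close>
  have v_le: "v (\<sigma> x) \<le> v x" for x
  proof (rule ccontr)
    assume *: "\<not> v (\<sigma> x) \<le> v x"
    then have x0: "x \<noteq> 0" using s0 by auto
    define q where "q = v (\<sigma> x) / v x"
    have "1 < q" using * x0 by (simp add: q_def field_simps)
    then obtain n where n: "max 1 (1 / \<delta>) < q ^ n" using real_arch_pow by blast
    have "v (\<sigma> x) ^ n \<le> max 1 (1 / \<delta>) * v x ^ n"
      using bound[of "x ^ n"] by (simp add: sp v_power)
    then have "q ^ n \<le> max 1 (1 / \<delta>)" using x0 by (simp add: q_def power_divide pos_divide_le_eq)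
    then show False using n by simp
  qed
  have v_eq: "v (\<sigma> x) = v x" for x using v_le[of x] v_le[of "\<sigma> x"] invol by simp
  have pi: "\<pi> \<in> k" "\<pi> \<noteq> 0" "{x \<in> k. v x < 1} = (\<lambda>a. \<pi> * a) ` ring_of_integers v k"
    using pe unfolding prime_element_of_def by auto
  have vpi: "v \<pi> < 1"
  proof -
    have "\<pi> * 1 \<in> (\<lambda>a. \<pi> * a) ` ring_of_integers v k" using k'(2) by (intro imageI) (simp add: ring_of_integers_def)
    then show ?thesis unfolding pi(3)[symmetric] by simp
  qed
  have vpi0: "0 < v \<pi>" using pi(2) by simp
  show ?thesis
  proof
    show "\<sigma> (x + y) = \<sigma> x + \<sigma> y" "\<sigma> (x * y) = \<sigma> x * \<sigma> y" "\<sigma> (\<sigma> x) = x" "v (\<sigma> x) = v x"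
      "v 2 = 1" "\<sigma> \<pi> = \<pi>" "\<pi> \<noteq> 0" "v \<pi> < 1" for x y
      using hom invol v_eq two fixk pi vpi by auto
  next
    fix x :: 'a assume "x \<noteq> 0"
    then obtain y where y: "y \<in> k" "y \<noteq> 0" "v x = v y"
      using value_in_k by blast
    \<comment> \<open>\<open>m\<close> is the floor of the logarithm of \<open>v y\<close> to the
      base \<open>v \<pi>\<close>, so \<open>y / \<pi> powi m\<close> has size above
      \<open>v \<pi>\<close> and at most 1. Below 1 this is impossible because \<pi> generates the
      maximal ideal.\<close>
    define L where "L = ln (v y) / ln (v \<pi>)"
    define m where "m = \<lfloor>L\<rfloor>"
    have lnpi: "ln (v \<pi>) < 0" using vpi vpi0 by simp
    have yL: "v y = v \<pi> powr L" using y(2) vpi0 lnpi by (simp add: powr_def L_def)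
    have "v y \<le> v \<pi> powr m" unfolding yL m_def using vpi vpi0 by (intro powr_mono') auto
    moreover have "v \<pi> powr (m + 1) < v y"
      unfolding yL m_def using vpi vpi0 by (intro powr_less_mono') (linarith | simp)+
    ultimately have ym: "v y \<le> v \<pi> powi m" "v \<pi> powi m * v \<pi> < v y"
      using vpi0 by (simp_all add: powr_real_of_int' powr_add)
    define z where "z = y / \<pi> powi m"
    have zk: "z \<in> k" unfolding z_def using y pi by (intro k'(8,10))
    have pm: "0 < v \<pi> powi m" using vpi0 by simp
    have vz: "v z = v y / v \<pi> powi m" by (simp add: z_def v_divide v_powi)
    have vz1: "v z \<le> 1" "v \<pi> < v z" using ym pm by (simp_all add: vz field_simps)
    have "v z = 1"
    proof (rule ccontr)
      assume "v z \<noteq> 1"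
      then have "z \<in> (\<lambda>a. \<pi> * a) ` ring_of_integers v k" using vz1 zk unfolding pi(3)[symmetric] by simp
      then obtain a where "v a \<le> 1" "z = \<pi> * a" by (auto simp: ring_of_integers_def)
      then have "v z \<le> v \<pi> * 1" unfolding v_mult using v_mult mult_left_mono[of "v a" 1 "v \<pi>"] by simp
      then show False using vz1 by simp
    qed
    then show "\<exists>m. v x = v \<pi> powi m" using y(3) vz pm by (intro exI[of _ m]) (simp add: field_simps)
  next
    fix u assume u: "\<sigma> u = u" "v u = 1"
    have uk: "u \<in> k" using u fixed_in_k by blast
    \<comment> \<open>Modulo the maximal ideal \<open>u\<close> is the norm
      \<open>a^2 - d * b^2\<close>. If \<open>a\<close> is a unit, it is corrected by Hensel's lemma
      while \<open>b\<close> is kept; otherwise \<open>b\<close> is a unit, \<open>u\<close> is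
      close to \<open>- d * b^2\<close>, and correcting \<open>b\<close> to \<open>s\<close> makes
      \<open>u\<close> the norm of \<open>s * w\<close>.\<close>
    obtain a b where ab: "a \<in> k" "b \<in> k" "v a \<le> 1" "v b \<le> 1" "v (a\<^sup>2 - (u + d * b\<^sup>2)) < 1"
      using residue_square_representation[OF ks k(2) two uk _ d] u by auto
    show "\<exists>a. a * \<sigma> a = u"
    proof (cases "v a = 1")
      case True
      have "u + d * b\<^sup>2 \<in> k" using uk d ab by (intro k'(3,4,9))
      then obtain s where s: "s \<in> k" "s\<^sup>2 = u + d * b\<^sup>2"
        using hensel_sqrt[OF ks k(1) two ab(1) True] ab(5) v_minus_commute by metis
      have "(s + b * w) * \<sigma> (s + b * w) = s\<^sup>2 - d * b\<^sup>2"
        unfolding s_basis[OF s(1) ab(2)] by (simp add: d_def power2_eq_square algebra_simps)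
      then show ?thesis using s by auto
    next
      case False
      then have "v (a\<^sup>2) < 1" using ab(3) by (simp add: v_power power_less_one_iff)
      then have small: "v (u + d * b\<^sup>2) < 1" using v_diff_less[OF _ ab(5), of "a\<^sup>2"] by simp
      then have "v (u - - (d * b\<^sup>2)) < v u" using u by simp
      then have "v (- (d * b\<^sup>2)) = 1" using v_eq_of_close[of "- (d * b\<^sup>2)" u] u v_minus_commute by metis
      then have "(v b)\<^sup>2 = 1" using d by (simp add: v_mult v_power)
      moreover have "v b \<noteq> - 1" using v_nonneg[of b] by linarith
      ultimately have vb: "v b = 1" by (simp add: power2_eq_1_iff)
      have d0: "d \<noteq> 0" using d by force
      have "- u / d - b\<^sup>2 = - (u + d * b\<^sup>2) / d" using d0 by (simp add: field_simps)
      then have "v (- u / d - b\<^sup>2) < 1" using small d by (simp only: v_divide v_uminus)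
      moreover have "- u / d \<in> k" using uk d by (intro k'(5,8))
      ultimately obtain s where s: "s \<in> k" "s\<^sup>2 = - u / d"
        using hensel_sqrt[OF ks k(1) two ab(2) vb] by blast
      have "(s * w) * \<sigma> (s * w) = - (s\<^sup>2) * d"
        using sw fixk[OF s(1)] by (simp add: hom d_def power2_eq_square algebra_simps)
      also have "\<dots> = u" using s d0 by simp
      finally show ?thesis by blast
    qed
  next
    fix \<alpha> \<epsilon> q
    assume a: "\<sigma> \<alpha> = \<alpha>" "v \<alpha> \<le> 1" and e: "\<sigma> \<epsilon> = \<epsilon>" "v \<epsilon> = 1" and q: "\<sigma> q = q" "v q < 1"
    have mem: "\<alpha> \<in> k" "\<epsilon> \<in> k" "q \<in> k" using a e q fixed_in_k by auto
    have "v (q * \<alpha>) < 1"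
      using a q mult_left_mono[of "v \<alpha>" 1 "v q"] by (simp add: v_mult)
    then have "v (\<epsilon>\<^sup>2 - q * \<alpha> - \<epsilon>\<^sup>2) < 1" by simp
    moreover have "\<epsilon>\<^sup>2 - q * \<alpha> \<in> k" using mem by (intro k'(7,4,9))
    ultimately obtain s where s: "s \<in> k" "s\<^sup>2 = \<epsilon>\<^sup>2 - q * \<alpha>" "v (s - \<epsilon>) < 1"
      using hensel_sqrt[OF ks k(1) two mem(2) e(2)] by blast
    have "v (2 * \<epsilon>) = 1" using two e by (simp add: v_mult)
    then have vs: "v (s + \<epsilon>) = 1" using v_add_eq_left[of "s - \<epsilon>" "2 * \<epsilon>"] s(3) by (simp add: algebra_simps)
    then have s0: "s + \<epsilon> \<noteq> 0" by force
    \<comment> \<open>This is the root \<open>(s - \<epsilon>) / q\<close> with its numerator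
      rationalised, which makes sense for \<open>q = 0\<close> as well.\<close>
    define c where "c = - \<alpha> / (s + \<epsilon>)"
    have c: "c * (s + \<epsilon>) = - \<alpha>" using s0 by (simp add: c_def)
    have "c \<in> k" unfolding c_def using s mem by (intro k'(8,5,3))
    moreover have "v c \<le> 1" using vs a by (simp add: c_def v_divide)
    moreover have "(s + \<epsilon>)\<^sup>2 * (\<alpha> + 2 * c * \<epsilon> + c\<^sup>2 * q)
        = \<alpha> * (s + \<epsilon>)\<^sup>2 + 2 * (c * (s + \<epsilon>)) * \<epsilon> * (s + \<epsilon>) + (c * (s + \<epsilon>))\<^sup>2 * q"
      by (simp add: power2_eq_square algebra_simps)
    then have "(s + \<epsilon>)\<^sup>2 * (\<alpha> + 2 * c * \<epsilon> + c\<^sup>2 * q) = \<alpha> * (s\<^sup>2 - (\<epsilon>\<^sup>2 - q * \<alpha>))"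
      unfolding c by (simp add: power2_eq_square algebra_simps)
    then have "\<alpha> + 2 * c * \<epsilon> + c\<^sup>2 * q = 0" using s(2) s0 by simp
    ultimately show "\<exists>c. \<sigma> c = c \<and> v c \<le> 1 \<and> \<alpha> + 2 * c * \<epsilon> + c\<^sup>2 * q = 0" using fixk by blast
  qed
qed

section \<open>Hermitian lattices with a selfadjoint involution\<close>

context hermitian_field
begin

lemma conj_0 [simp]: "\<sigma> 0 = 0"
  by (metis add.right_neutral add_left_cancel conj_add)

lemma conj_1 [simp]: "\<sigma> 1 = 1"
  by (metis conj_conj conj_mult mult_1 mult.comm_neutral)

lemma conj_uminus [simp]: "\<sigma> (- x) = - \<sigma> x"
  using conj_add[of x "- x"] by (simp add: add_eq_0_iff)

lemma conj_eq_0_iff [simp]: "\<sigma> x = 0 \<longleftrightarrow> x = 0"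
  by (metis conj_0 conj_conj)

lemma conj_inverse: "\<sigma> (inverse x) = inverse (\<sigma> x)"
proof (cases "x = 0")
  case False
  then have "\<sigma> x * \<sigma> (inverse x) = 1" by (simp flip: conj_mult)
  then show ?thesis by (metis inverse_unique)
qed simp

lemma conj_power: "\<sigma> (x ^ n) = \<sigma> x ^ n"
  by (induction n) (simp_all add: conj_mult)

lemma conj_divide: "\<sigma> (x / y) = \<sigma> x / \<sigma> y"
  by (simp add: divide_inverse conj_mult conj_inverse)

lemma conj_powi: "\<sigma> (x powi m) = \<sigma> x powi m"
  by (simp add: power_int_def conj_power conj_inverse)

lemma conj_of_nat [simp]: "\<sigma> (of_nat n) = of_nat n"
  by (induction n) (simp_all add: conj_add)

lemma conj_numeral [simp]: "\<sigma> (numeral n) = numeral n"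
  by (metis conj_of_nat of_nat_numeral)

lemma conj_sum: "\<sigma> (sum f A) = (\<Sum>i\<in>A. \<sigma> (f i))"
  by (induction A rule: infinite_finite_induct) (simp_all add: conj_add)

lemma two_nonzero [simp]: "(2 :: 'a) \<noteq> 0"
  using v_2 by force

text \<open>The value group is discrete: the sizes from \<open>v a0\<close> upwards that occur in
  \<open>A\<close> are \<open>v a0 * t ^ j\<close> with natural \<open>j\<close>, and boundedness
  leaves only finitely many \<open>j\<close>.\<close>

lemma exists_max_value:
  assumes "a0 \<in> A" "a0 \<noteq> 0" and bound: "\<And>a. a \<in> A \<Longrightarrow> v a \<le> M"
  shows "\<exists>a\<in>A. a \<noteq> 0 \<and> (\<forall>a'\<in>A. v a' \<le> v a)"
proof -
  define t where "t = 1 / v \<pi>"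
  have t: "1 < t" using v_pi_less_1 by (simp add: t_def)
  obtain J where J: "M / v a0 < t ^ J" using real_arch_pow[OF t] by blast
  define Q where "Q j \<longleftrightarrow> (\<exists>a\<in>A. v a = v a0 * t ^ j)" for j
  have Q0: "Q 0" using assms(1) by (auto simp: Q_def)
  have QJ: "j \<le> J" if "Q j" for j
  proof (rule ccontr)
    assume "\<not> j \<le> J"
    then have "t ^ J \<le> t ^ j" using t by (intro power_increasing) auto
    then have "M < v a0 * t ^ j" using J assms(2) by (simp add: field_simps) (smt (verit) mult_left_mono v_nonneg)
    then show False using that bound unfolding Q_def by fastforce
  qed
  define j where "j = (GREATEST j. Q j)"
  have Qj: "Q j" unfolding j_def using GreatestI_nat[of Q 0 J] Q0 QJ by blast
  have j_max: "j' \<le> j" if "Q j'" for j' unfolding j_def using Greatest_le_nat[of Q j' J] that QJ by blast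
  obtain a where a: "a \<in> A" "v a = v a0 * t ^ j" using Qj unfolding Q_def by blast
  have "v a' \<le> v a" if a': "a' \<in> A" for a'
  proof (cases "v a' \<le> v a0")
    case True
    also have "v a0 * 1 \<le> v a0 * t ^ j" using t by (intro mult_left_mono) auto
    finally show ?thesis using a by simp
  next
    case False
    then have a'0: "a' / a0 \<noteq> 0" using assms(2) by auto
    then obtain m where m: "v (a' / a0) = v \<pi> powi m" using value_group by blast
    have gt: "1 < v (a' / a0)" using False assms(2) by (simp add: v_divide)
    have "m < 0"
    proof (rule ccontr)
      assume "\<not> m < 0"
      then have "v \<pi> powi m \<le> 1" using v_pi_less_1 by (simp add: power_int_def power_le_one)
      then show False using gt m by simp
    qed
    then have "v (a' / a0) = t ^ nat (- m)" unfolding m t_def by (simp add: power_int_def inverse_eq_divide)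
    then have v': "v a' = v a0 * t ^ nat (- m)" using assms(2) by (simp add: v_divide field_simps)
    then have "nat (- m) \<le> j" using j_max a' unfolding Q_def by blast
    then have "t ^ nat (- m) \<le> t ^ j" using t by (intro power_increasing) auto
    then show ?thesis unfolding v' a(2) by (intro mult_left_mono) auto
  qed
  moreover have "a \<noteq> 0"
  proof
    assume "a = 0"
    then have "v a0 * t ^ j = 0" using a(2) by simp
    then show False using assms(2) t by simp
  qed
  ultimately show ?thesis using a(1) by blast
qed

end

text \<open>\<open>L_integral\<close> and \<open>L_dual\<close> together say that \<open>L\<close>
  is unimodular, \<open>L_absorbs\<close> that it spans, \<open>T_bounded\<close> that
  \<open>T\<close> maps \<open>L\<close> into a multiple of \<open>L\<close>. The form may have a
  radical: in the model the vectors are all functions on the naturals and \<open>h\<close> sees only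
  finitely many coordinates. Hence the action of \<open>T\<close> on what is left is described
  through values of \<open>h\<close>.\<close>

locale hermitian_lattice = hermitian_field v \<sigma> \<pi> + V: vector_space scale
  for v :: "'a::field_char_0 \<Rightarrow> real" and \<sigma> :: "'a \<Rightarrow> 'a" and \<pi> :: 'a
    and scale :: "'a \<Rightarrow> 'v::ab_group_add \<Rightarrow> 'v" (infixr "*\<^sub>s" 75) +
  fixes h :: "'v \<Rightarrow> 'v \<Rightarrow> 'a" and T :: "'v \<Rightarrow> 'v" and L :: "'v set"
  assumes h_add_left: "h (u + u') w = h u w + h u' w"
    and h_scale_left: "h (c *\<^sub>s u) w = c * h u w"
    and h_conj: "\<sigma> (h u w) = h w u"
    and T_add: "T (u + w) = T u + T w"
    and T_scale: "T (c *\<^sub>s u) = c *\<^sub>s T u"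
    and T_T [simp]: "T (T u) = u"
    and T_adjoint: "h (T u) w = h u (T w)"
    and L_add: "u \<in> L \<Longrightarrow> w \<in> L \<Longrightarrow> u + w \<in> L"
    and L_scale: "v c \<le> 1 \<Longrightarrow> u \<in> L \<Longrightarrow> c *\<^sub>s u \<in> L"
    and L_integral: "u \<in> L \<Longrightarrow> w \<in> L \<Longrightarrow> v (h u w) \<le> 1"
    and L_dual: "(\<And>w. w \<in> L \<Longrightarrow> v (h u w) \<le> 1) \<Longrightarrow> u \<in> L"
    and L_absorbs: "\<exists>c. c \<noteq> 0 \<and> c *\<^sub>s u \<in> L"
    and T_bounded: "\<exists>M. \<forall>u\<in>L. \<forall>w\<in>L. v (h (T u) w) \<le> M"
begin

lemma h_add_right: "h u (w + w') = h u w + h u w'"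
  by (metis conj_add h_add_left h_conj)

lemma h_scale_right: "h u (c *\<^sub>s w) = \<sigma> c * h u w"
  by (metis conj_mult h_conj h_scale_left)

lemma h_0_left [simp]: "h 0 w = 0"
  using h_add_left[of 0 0 w] by simp

lemma h_0_right [simp]: "h u 0 = 0"
  using h_add_right[of u 0 0] by simp

lemma h_uminus_left [simp]: "h (- u) w = - h u w"
  using h_add_left[of u "- u" w] by (simp add: add_eq_0_iff)

lemma h_uminus_right [simp]: "h u (- w) = - h u w"
  using h_add_right[of u w "- w"] by (simp add: add_eq_0_iff)

lemma h_diff_left: "h (u - u') w = h u w - h u' w"
  using h_add_left[of u "- u'" w] by simp

lemma h_diff_right: "h u (w - w') = h u w - h u w'"
  using h_add_right[of u w "- w'"] by simp

lemmas h_simps = h_add_left h_add_right h_scale_left h_scale_right h_diff_left h_diff_right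

lemma T_uminus: "T (- u) = - T u"
  using T_scale[of "- 1" u] by simp

lemma T_diff: "T (u - w) = T u - T w"
  using T_add[of u "- w"] T_uminus by simp

lemma L_uminus: "u \<in> L \<Longrightarrow> - u \<in> L"
  using L_scale[of "- 1" u] by simp

lemma L_diff: "u \<in> L \<Longrightarrow> w \<in> L \<Longrightarrow> u - w \<in> L"
  using L_add[of u "- w"] L_uminus by simp

text \<open>The values of \<open>h u\<close> on \<open>L\<close> are bounded and not all 0, so one
  of them has maximal size. Dividing \<open>u\<close> by it makes all values integral, and
  unimodularity puts the quotient into \<open>L\<close>.\<close>

lemma exists_normalized:
  assumes "h u w \<noteq> 0"
  shows "\<exists>c w'. c *\<^sub>s u \<in> L \<and> w' \<in> L \<and> h (c *\<^sub>s u) w' = 1"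
proof -
  obtain c where c: "c \<noteq> 0" "c *\<^sub>s u \<in> L" using L_absorbs by blast
  obtain d where d: "d \<noteq> 0" "d *\<^sub>s w \<in> L" using L_absorbs by blast
  have "h u (d *\<^sub>s w) \<noteq> 0" using assms d by (simp add: h_simps)
  moreover have "v a \<le> 1 / v c" if "a \<in> h u ` L" for a
  proof -
    obtain w' where w': "w' \<in> L" "a = h u w'" using \<open>a \<in> h u ` L\<close> by blast
    have "v c * v a \<le> 1" using L_integral[OF c(2) w'(1)] w' by (simp add: h_simps v_mult)
    then show ?thesis using c by (simp add: field_simps)
  qed
  ultimately obtain w' where w': "w' \<in> L" "h u w' \<noteq> 0" "\<And>w. w \<in> L \<Longrightarrow> v (h u w) \<le> v (h u w')"
    using exists_max_value[of "h u (d *\<^sub>s w)" "h u ` L" "1 / v c"] d by auto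
  have "inverse (h u w') *\<^sub>s u \<in> L"
  proof (rule L_dual)
    fix w assume "w \<in> L"
    then show "v (h (inverse (h u w') *\<^sub>s u) w) \<le> 1"
      using w' by (simp add: h_simps v_mult v_inverse v_divide pos_divide_le_eq flip: divide_inverse_commute)
  qed
  moreover have "h (inverse (h u w') *\<^sub>s u) w' = 1" using w' by (simp add: h_simps)
  ultimately show ?thesis using w'(1) by blast
qed

text \<open>Polarisation, which needs that 2 is a unit.\<close>

lemma maximal_diagonal_value:
  assumes B: "\<And>u u' w. B (u + u') w = B u w + B u' w" "\<And>c u w. B (c *\<^sub>s u) w = c * B u w"
      "\<And>u w. \<sigma> (B u w) = B w u"
    and S: "\<And>u w. u \<in> S \<Longrightarrow> w \<in> S \<Longrightarrow> u + w \<in> S" "\<And>c u. v c = 1 \<Longrightarrow> u \<in> S \<Longrightarrow> c *\<^sub>s u \<in> S"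
    and max: "u \<in> S" "w \<in> S" "B u w \<noteq> 0" "\<And>u' w'. u' \<in> S \<Longrightarrow> w' \<in> S \<Longrightarrow> v (B u' w') \<le> v (B u w)"
  shows "\<exists>z\<in>S. v (B z z) = v (B u w)"
proof -
  obtain m where m: "v (B u w) = v \<pi> powi m" using value_group max(3) by blast
  \<comment> \<open>The unit \<open>c\<close> rotates \<open>B u w\<close> to
    \<open>\<pi> powi m\<close>, which \<sigma> fixes; the two cross terms of
    \<open>B (u + y) (u + y)\<close> then add up to \<open>2 * \<pi> powi m\<close> and cannot
    cancel.\<close>
  define c where "c = \<sigma> (\<pi> powi m / B u w)"
  have vc: "v c = 1" using max(3) by (simp add: c_def v_divide v_powi m)
  define y where "y = c *\<^sub>s w"
  have y: "y \<in> S" using S(2) vc max(2) by (simp add: y_def)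
  have add_right: "B u (w + w') = B u w + B u w'" for u w w' by (metis B(1,3) conj_add)
  have "B u y = \<sigma> (c * B w u)" using B(3)[of "c *\<^sub>s w" u] by (simp add: y_def B(2))
  then have "B u y = \<sigma> c * B u w" by (simp add: conj_mult B(3))
  then have uy: "B u y = \<pi> powi m" using max(3) by (simp add: c_def)
  have yu: "B y u = \<pi> powi m" using B(3)[of u y] uy by (simp add: conj_powi)
  have v2: "v (2 * \<pi> powi m) = v (B u w)" by (simp add: v_mult v_2 v_powi m)
  have "B (u + y) (u + y) = (B u u + B y y) + 2 * \<pi> powi m"
    by (simp add: B(1) add_right uy yu)
  then have sum: "2 * \<pi> powi m + (B u u + B y y) = B (u + y) (u + y)" by simp
  show ?thesis
  proof (cases "v (B u u) = v (B u w) \<or> v (B y y) = v (B u w)")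
    case True then show ?thesis using max(1) y by blast
  next
    case False
    then have "v (B u u) < v (B u w)" "v (B y y) < v (B u w)"
      using max(4)[OF max(1,1)] max(4)[OF y y] by auto
    then have "v (B u u + B y y) < v (2 * \<pi> powi m)" unfolding v2 by (rule v_add_less)
    then have "v (B (u + y) (u + y)) = v (B u w)" using v_add_eq_left sum v2 by metis
    then show ?thesis using S(1)[OF max(1) y] by blast
  qed
qed

text \<open>Polarisation for \<open>h\<close> itself: on \<open>L\<close> the value 1 has maximal
  size, so some diagonal value is a unit. It is fixed by \<sigma>, and a scalar whose norm is its
  inverse rescales it to 1.\<close>

lemma exists_unit_vector:
  assumes S: "S \<subseteq> L" "\<And>u w. u \<in> S \<Longrightarrow> w \<in> S \<Longrightarrow> u + w \<in> S" "\<And>c u. v c = 1 \<Longrightarrow> u \<in> S \<Longrightarrow> c *\<^sub>s u \<in> S"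
    and "u \<in> S" "w \<in> S" "h u w = 1"
  shows "\<exists>z\<in>S. h z z = 1"
proof -
  obtain z where z: "z \<in> S" "v (h z z) = 1"
    using maximal_diagonal_value[of h S u w] S assms(4-6) L_integral
    by (auto simp: h_simps h_conj subset_iff)
  have "\<sigma> (inverse (h z z)) = inverse (h z z)" "v (inverse (h z z)) = 1"
    using z(2) by (simp_all add: conj_inverse h_conj v_inverse)
  then obtain a where a: "a * \<sigma> a = inverse (h z z)" using unit_is_norm by blast
  have "v a * v a = 1" using arg_cong[OF a, of v] z(2) by (simp add: v_mult v_inverse)
  then have "v a = 1" using v_nonneg[of a] by (metis abs_of_nonneg abs_1 real_sqrt_abs2 real_sqrt_one)
  have "h (a *\<^sub>s z) (a *\<^sub>s z) = (a * \<sigma> a) * h z z" by (simp add: h_simps)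
  moreover have "h z z \<noteq> 0" using z(2) by force
  ultimately have "h (a *\<^sub>s z) (a *\<^sub>s z) = 1" unfolding a by simp
  then show ?thesis using S(3)[OF \<open>v a = 1\<close>] z(1) by blast
qed

section \<open>Splitting off one hyperbolic plane\<close>

definition invariant_projection :: "('v \<Rightarrow> 'v) \<Rightarrow> bool" where
  "invariant_projection P \<longleftrightarrow> (\<forall>u w. P (u + w) = P u + P w) \<and> (\<forall>c u. P (c *\<^sub>s u) = c *\<^sub>s P u) \<and>
     (\<forall>u. P (P u) = P u) \<and> (\<forall>u w. h (P u) w = h u (P w)) \<and> (\<forall>u\<in>L. P u \<in> L) \<and> (\<forall>u. P (T u) = T (P u))"

text \<open>The value of \<open>T\<close> on \<open>f\<close> follows from
  \<open>T (T e) = e\<close>: it is \<open>\<pi> powi (- m) *\<^sub>s e\<close>.\<close>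

definition hyperbolic_pair :: "('v \<Rightarrow> 'v) \<Rightarrow> 'v \<Rightarrow> 'v \<Rightarrow> int \<Rightarrow> bool" where
  "hyperbolic_pair P e f m \<longleftrightarrow> e \<in> L \<and> f \<in> L \<and> P e = e \<and> P f = f \<and> h e e = 0 \<and> h f f = 0 \<and> h e f = 1 \<and>
     T e = \<pi> powi m *\<^sub>s f"

text \<open>Put \<open>p = \<pi> powi m\<close>. By maximality and duality
  \<open>p *\<^sub>s T u\<close> stays in \<open>L\<close> for \<open>u\<close> in what is left, and
  the Gram matrix of \<open>z\<close> and \<open>f0 = p *\<^sub>s T z\<close> has rows
  \<open>\<alpha>, \<epsilon>\<close> and \<open>\<epsilon>, q\<close>, where
  \<open>\<epsilon>\<close> is a unit and \<open>q = p^2 * \<alpha>\<close> is small. A root of the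
  resulting quadratic makes \<open>e1 = z + c *\<^sub>s f0\<close> isotropic; a selfadjoint
  involution preserves \<open>h\<close>, so \<open>f1\<close> is isotropic too.\<close>

lemma hyperbolic_pair_ramified:
  assumes P: "invariant_projection P" and z: "z \<in> L" "P z = z"
    and m: "m > 0" "v (h (T z) z) = v \<pi> powi (- m)"
    and bound: "\<And>u w. u \<in> L \<Longrightarrow> w \<in> L \<Longrightarrow> P u = u \<Longrightarrow> v (h (T u) w) \<le> v \<pi> powi (- m)"
  shows "\<exists>e f. hyperbolic_pair P e f m"
proof -
  have P': "P (u + w) = P u + P w" "P (c *\<^sub>s u) = c *\<^sub>s P u" "P (T u) = T (P u)" for u w c
    using P unfolding invariant_projection_def by auto
  define p where "p = \<pi> powi m"
  have p0: "p \<noteq> 0" by (simp add: p_def)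
  have sp [simp]: "\<sigma> p = p" by (simp add: p_def conj_powi)
  have vp: "v p = v \<pi> powi m" by (simp add: p_def v_powi)
  have vp1: "v p < 1" using m(1) v_pi_less_1 by (simp add: vp power_int_def power_less_one_iff)
  have vpm: "v \<pi> powi (- m) * v p = 1" by (simp add: vp power_int_minus)
  have TL: "p *\<^sub>s T u \<in> L" if "u \<in> L" "P u = u" for u
  proof (rule L_dual)
    fix w assume "w \<in> L"
    then have "v (h (T u) w) * v p \<le> v \<pi> powi (- m) * v p" using bound that by (intro mult_right_mono) auto
    then show "v (h (p *\<^sub>s T u) w) \<le> 1" unfolding vpm by (simp add: h_simps v_mult mult.commute)
  qed
  define \<alpha> where "\<alpha> = h z z"
  define \<epsilon> where "\<epsilon> = p * h (T z) z"
  define q where "q = p\<^sup>2 * \<alpha>"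
  have "\<sigma> (h (T z) z) = h (T z) z" by (simp add: h_conj T_adjoint)
  then have \<epsilon>: "\<sigma> \<epsilon> = \<epsilon>" "v \<epsilon> = 1" using vpm by (simp_all add: \<epsilon>_def conj_mult v_mult m mult.commute)
  have \<alpha>: "\<sigma> \<alpha> = \<alpha>" "v \<alpha> \<le> 1" using L_integral z by (simp_all add: \<alpha>_def h_conj)
  have p2: "v (p\<^sup>2) < 1" using vp1 by (simp add: v_power power_less_one_iff)
  have vq: "v q < 1" "\<sigma> q = q"
    using \<alpha> p2 mult_left_mono[of "v \<alpha>" 1 "v (p\<^sup>2)"] by (simp_all add: q_def v_mult conj_mult conj_power)
  obtain c where c: "\<sigma> c = c" "v c \<le> 1" "\<alpha> + 2 * c * \<epsilon> + c\<^sup>2 * q = 0"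
    using quadratic_root[OF \<alpha> \<epsilon> vq(2,1)] by blast
  define f0 where "f0 = p *\<^sub>s T z"
  have f0: "f0 \<in> L" "P f0 = f0" using TL z by (simp_all add: f0_def P')
  define e1 where "e1 = z + c *\<^sub>s f0"
  have e1: "e1 \<in> L" "P e1 = e1" using z f0 c by (auto simp: e1_def P' intro!: L_add L_scale)
  define f1 where "f1 = p *\<^sub>s T e1"
  have f1: "f1 \<in> L" "P f1 = f1" using TL e1 by (simp_all add: f1_def P')
  have hz: "h z f0 = \<epsilon>" "h f0 z = \<epsilon>" "h f0 f0 = q" "h z z = \<alpha>"
    using h_conj[of "T z" z] \<open>\<sigma> (h (T z) z) = h (T z) z\<close>
    by (simp_all add: f0_def \<epsilon>_def q_def \<alpha>_def h_simps T_adjoint power2_eq_square)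
  have "h e1 e1 = \<alpha> + 2 * c * \<epsilon> + c\<^sup>2 * q"
    by (simp add: e1_def h_simps hz c power2_eq_square algebra_simps)
  then have he: "h e1 e1 = 0" using c by simp
  have hf: "h f1 f1 = 0" by (simp add: f1_def h_simps T_adjoint he)
  have "f1 = f0 + (c * p\<^sup>2) *\<^sub>s z"
    by (simp add: f1_def e1_def f0_def T_add T_scale V.scale_right_distrib power2_eq_square algebra_simps)
  \<comment> \<open>All terms but \<open>\<epsilon>\<close> are small, so the pairing is a
    unit.\<close>
  then have "h e1 f1 = \<epsilon> + (2 * c * q + c\<^sup>2 * p\<^sup>2 * \<epsilon>)"
    by (simp add: e1_def h_simps hz c conj_mult conj_power q_def power2_eq_square algebra_simps)
  moreover have "v (2 * c * q) < 1"
    using vq(1) c(2) mult_right_mono[of "v c" 1 "v q"] by (simp add: v_mult v_2)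
  moreover have "v (c\<^sup>2) \<le> 1" using c(2) by (simp add: v_power power_le_one)
  then have "v (c\<^sup>2 * p\<^sup>2 * \<epsilon>) < 1"
    using p2 \<epsilon> mult_right_mono[of "v (c\<^sup>2)" 1 "v (p\<^sup>2)"] by (simp add: v_mult)
  ultimately have v\<eta>: "v (h e1 f1) = 1" using v_add_eq_left \<epsilon>(2) v_add_less by metis
  have s\<eta>: "\<sigma> (h e1 f1) = h e1 f1" by (simp add: h_conj f1_def h_simps T_adjoint conj_mult)
  obtain a where a: "a * \<sigma> a = inverse (h e1 f1)"
    using unit_is_norm[of "inverse (h e1 f1)"] v\<eta> s\<eta> by (auto simp: conj_inverse v_inverse)
  have "v a * v a = 1" using arg_cong[OF a, of v] v\<eta> by (simp add: v_mult v_inverse)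
  then have va: "v a = 1" using v_nonneg[of a] by (metis abs_of_nonneg abs_1 real_sqrt_abs2 real_sqrt_one)
  \<comment> \<open>The roles are exchanged: \<open>T f1 = p *\<^sub>s e1\<close> has the positive
    exponent, whereas \<open>T e1\<close> is \<open>f1\<close> divided by \<open>p\<close>.\<close>
  define e where "e = a *\<^sub>s f1"
  define f where "f = a *\<^sub>s e1"
  have "h e1 f1 \<noteq> 0" using v\<eta> by force
  have "h e f = (a * \<sigma> a) * h f1 e1" by (simp add: e_def f_def h_simps)
  also have "h f1 e1 = h e1 f1" using s\<eta> by (simp add: h_conj)
  finally have "h e f = 1" unfolding a using \<open>h e1 f1 \<noteq> 0\<close> by simp
  moreover have "T e = p *\<^sub>s f"
    by (simp add: e_def f_def f1_def T_scale mult.commute)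
  ultimately have "hyperbolic_pair P e f m"
    unfolding hyperbolic_pair_def using e1 f1 va
    by (simp add: e_def f_def P' L_scale h_simps he hf p_def)
  then show ?thesis by blast
qed

text \<open>Eigenvectors \<open>x\<close> and \<open>y\<close> of the selfadjoint \<open>T\<close>
  for 1 and -1 are orthogonal. If both have length 1 and \<open>a\<close>, \<open>c\<close> have the
  norms 1/2 and -1/2, then the sum and the difference of \<open>a *\<^sub>s x\<close> and
  \<open>c *\<^sub>s y\<close> are isotropic, pair to 1 and are exchanged by
  \<open>T\<close>.\<close>

lemma hyperbolic_pair_unramified:
  assumes P: "invariant_projection P" and TL: "\<And>u. u \<in> L \<Longrightarrow> P u = u \<Longrightarrow> T u \<in> L"
    and u: "P u = u" "T u = u" "h u w \<noteq> 0" and u': "P u' = u'" "T u' = - u'" "h u' w' \<noteq> 0"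
  shows "\<exists>e f. hyperbolic_pair P e f 0"
proof -
  have P': "P (u + w) = P u + P w" "P (c *\<^sub>s u) = c *\<^sub>s P u" "P (T u) = T (P u)"
     "P (P u) = P u" "h (P u) w = h u (P w)" "u \<in> L \<Longrightarrow> P u \<in> L" for u w c
    using P unfolding invariant_projection_def by auto
  have unit: "\<exists>z. z \<in> L \<and> P z = z \<and> T z = s *\<^sub>s z \<and> h z z = 1"
    if s: "s = 1 \<or> s = - 1" and x: "P x = x" "T x = s *\<^sub>s x" "h x y \<noteq> 0" for s x y
  proof -
    define S where "S = {z \<in> L. P z = z \<and> T z = s *\<^sub>s z}"
    obtain c y' where c: "c *\<^sub>s x \<in> L" "y' \<in> L" "h (c *\<^sub>s x) y' = 1" using exists_normalized x(3) by blast
    \<comment> \<open>The component of \<open>P y'\<close> in the eigenspace, integral because 2 is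
      a unit; its pairing with the eigenvector is the same as that of \<open>y'\<close>.\<close>
    define y2 where "y2 = (1/2) *\<^sub>s (P y' + s *\<^sub>s T (P y'))"
    have half: "v (1/2) \<le> 1" and vs: "v s \<le> 1" and ss: "s * s = 1" "\<sigma> s = s" using s v_2 by (auto simp: v_divide)
    have Py: "P y' \<in> L" "P (P y') = P y'" using P' c by auto
    then have "y2 \<in> L" unfolding y2_def using half vs TL by (auto intro!: L_scale L_add)
    moreover have "P y2 = y2" by (simp add: y2_def P' )
    moreover have "T y2 = s *\<^sub>s y2"
      using ss by (simp add: y2_def T_add T_scale V.scale_right_distrib add.commute mult.commute mult.left_commute)
    ultimately have "y2 \<in> S" by (simp add: S_def)
    moreover have "c *\<^sub>s x \<in> S" using c x by (simp add: S_def P' T_scale mult.commute)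
    moreover have "h (c *\<^sub>s x) y2 = 1"
    proof -
      have "h (c *\<^sub>s x) (P y') = h (c *\<^sub>s x) y'" using P'(5)[of "c *\<^sub>s x" y'] x(1) by (simp add: P')
      moreover have "h (c *\<^sub>s x) (T (P y')) = s * h (c *\<^sub>s x) (P y')"
        using T_adjoint[of "c *\<^sub>s x" "P y'"] x(2) by (auto simp: T_scale h_simps)
      ultimately show ?thesis using c(3) ss by (simp add: y2_def h_add_right h_scale_right conj_divide)
    qed
    ultimately have "\<exists>z\<in>S. h z z = 1"
      by (intro exists_unit_vector) (auto simp: S_def P' T_add T_scale V.scale_right_distrib mult.commute intro: L_add L_scale)
    then show ?thesis by (auto simp: S_def)
  qed
  obtain x where x: "x \<in> L" "P x = x" "T x = x" "h x x = 1" using unit[of 1 u w] u by auto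
  obtain y where y: "y \<in> L" "P y = y" "T y = - y" "h y y = 1" using unit[of "- 1" u' w'] u' by auto
  have "h x y = - h x y" using T_adjoint[of x y] x(3) y(3) by simp
  then have "2 * h x y = 0" by (simp only: mult_2 eq_neg_iff_add_eq_0)
  then have xy: "h x y = 0" by simp
  then have yx: "h y x = 0" using h_conj[of x y] by simp
  have v2: "v (1/2) = 1" "v (-1/2) = 1" using v_2 by (simp_all add: v_divide)
  obtain a where a: "a * \<sigma> a = 1/2" using unit_is_norm[of "1/2"] v2 by (auto simp: conj_divide)
  obtain c where c: "c * \<sigma> c = -1/2" using unit_is_norm[of "-1/2"] v2 by (auto simp: conj_divide)
  have v_le: "v b \<le> 1" if "v (b * \<sigma> b) = 1" for b
  proof -
    have "v b * v b = 1" using that by (simp add: v_mult)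
    then show ?thesis by (metis mult_le_one linear mult_le_cancel_left1 not_le v_nonneg order.refl mult_less_cancel_right1 less_1_mult less_irrefl)
  qed
  have va: "v a \<le> 1" "v c \<le> 1" using v_le[of a] v_le[of c] v2 unfolding a c by simp_all
  define e where "e = a *\<^sub>s x + c *\<^sub>s y"
  define f where "f = a *\<^sub>s x - c *\<^sub>s y"
  have "hyperbolic_pair P e f 0"
    unfolding hyperbolic_pair_def
  proof (intro conjI)
    show "e \<in> L" "f \<in> L" using x y va by (auto simp: e_def f_def intro!: L_add L_diff L_scale)
    show "P e = e" by (simp add: e_def P' x y)
    show "P f = f" using P'(2)[of "- 1" "c *\<^sub>s y"] P'(1)[of "a *\<^sub>s x" "- (c *\<^sub>s y)"] by (simp add: f_def P' x y)
    have "h e e = a * \<sigma> a + c * \<sigma> c" "h f f = a * \<sigma> a + c * \<sigma> c" "h e f = a * \<sigma> a - c * \<sigma> c"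
      by (simp_all add: e_def f_def h_simps x y xy yx)
    then show "h e e = 0" "h f f = 0" "h e f = 1" by (simp_all add: a c)
    show "T e = \<pi> powi 0 *\<^sub>s f" by (simp add: e_def f_def T_add T_scale x y)
  qed
  then show ?thesis by blast
qed

text \<open>The first alternative carries the bound along because it keeps later exponents from
  exceeding \<open>m\<close>. The second is phrased through \<open>h\<close>, where it also covers
  the case that what is left lies in the radical; either sign serves then.\<close>

lemma hyperbolic_pair_or_scalar:
  assumes P: "invariant_projection P"
  shows "(\<exists>e f m. 0 \<le> m \<and> hyperbolic_pair P e f m \<and>
       (\<forall>u\<in>L. \<forall>w\<in>L. v (h (T (P u)) (P w)) \<le> v \<pi> powi (- m))) \<or>
     (\<exists>s. (s = 1 \<or> s = - 1) \<and> (\<forall>u w. h (T (P u)) w = s * h (P u) w))"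
proof -
  have P': "P (u + w) = P u + P w" "P (c *\<^sub>s u) = c *\<^sub>s P u" "P (T u) = T (P u)"
     "P (P u) = P u" "h (P u) w = h u (P w)" "u \<in> L \<Longrightarrow> P u \<in> L" for u w c
    using P unfolding invariant_projection_def by auto
  have hTP: "h (T (P u)) w = h (T (P u)) (P w)" for u w
    by (metis P'(3,4,5))
  define S where "S = {u \<in> L. P u = u}"
  have PS: "P u \<in> S" if "u \<in> L" for u using that P' by (simp add: S_def)
  define B where "B u w = h (T u) w" for u w
  show ?thesis
  proof (cases "\<forall>u\<in>S. \<forall>w\<in>S. B u w = 0")
    case True
    have zero: "h (T (P u)) w = 0" for u w
    proof -
      obtain c d where c: "c \<noteq> 0" "c *\<^sub>s u \<in> L" and d: "d \<noteq> 0" "d *\<^sub>s w \<in> L" using L_absorbs by meson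
      have "B (P (c *\<^sub>s u)) (P (d *\<^sub>s w)) = 0" using True PS c d by blast
      then have "h (T (P u)) (P w) = 0" using c d by (simp add: B_def P' T_scale h_simps)
      then show ?thesis using hTP by simp
    qed
    then have "h (P u) w = 0" for u w using zero[of "T u" w] P'(3) by simp
    then show ?thesis using zero by (intro disjI2) auto
  next
    case False
    then obtain u1 w1 where "u1 \<in> S" "w1 \<in> S" "B u1 w1 \<noteq> 0" by blast
    moreover obtain M where "\<And>u w. u \<in> L \<Longrightarrow> w \<in> L \<Longrightarrow> v (B u w) \<le> M" using T_bounded unfolding B_def by blast
    ultimately obtain b where "b \<in> {B u w | u w. u \<in> S \<and> w \<in> S}" "b \<noteq> 0"
       "\<forall>b'\<in>{B u w | u w. u \<in> S \<and> w \<in> S}. v b' \<le> v b"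
      using exists_max_value[of "B u1 w1" "{B u w | u w. u \<in> S \<and> w \<in> S}" M] by (auto simp: S_def)
    then obtain u w where uw: "u \<in> S" "w \<in> S" "B u w \<noteq> 0" 
      and max: "\<And>u' w'. u' \<in> S \<Longrightarrow> w' \<in> S \<Longrightarrow> v (B u' w') \<le> v (B u w)" by blast
    have "\<exists>z\<in>S. v (B z z) = v (B u w)"
    proof (rule maximal_diagonal_value[where B = B and S = S, OF _ _ _ _ _ uw])
      show "\<sigma> (B u w) = B w u" for u w by (simp add: B_def h_conj T_adjoint)
    qed (use max in \<open>auto simp: B_def T_add T_scale h_simps S_def P' intro: L_add L_scale\<close>)
    then obtain z where z: "z \<in> S" "v (B z z) = v (B u w)" by blast
    obtain m' where m': "v (B u w) = v \<pi> powi m'" using value_group uw(3) by blast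
    define m where "m = - m'"
    have m: "v (B u w) = v \<pi> powi (- m)" by (simp add: m' m_def)
    have boundP: "v (h (T x) y) \<le> v \<pi> powi (- m)" if "x \<in> L" "P x = x" "y \<in> L" for x y
      using max[of x "P y"] hTP[of x y] that PS unfolding m by (simp add: S_def B_def)
    then have bound: "\<forall>u\<in>L. \<forall>w\<in>L. v (h (T (P u)) (P w)) \<le> v \<pi> powi (- m)"
      by (auto intro!: boundP P'(4,6))
    \<comment> \<open>For \<open>m < 0\<close> the operator \<open>T\<close> would be divisible by
      \<open>p\<close> on what is left of \<open>L\<close>. Writing
      \<open>T z = p *\<^sub>s z'\<close> and using that \<open>T\<close> preserves \<open>h\<close>
      bounds the maximal size \<open>v p\<close> by its cube.\<close>
    have "0 \<le> m"
    proof (rule ccontr)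
      assume "\<not> 0 \<le> m"
      then have small: "v \<pi> powi (- m) < 1" using v_pi_less_1 by (simp add: power_int_def power_less_one_iff)
      define p where "p = \<pi> powi (- m)"
      have p0: "p \<noteq> 0" and vp: "v p = v \<pi> powi (- m)" by (simp_all add: p_def v_powi)
      define z' where "z' = inverse p *\<^sub>s T z"
      have Tz: "T z = p *\<^sub>s z'" using p0 by (simp add: z'_def)
      have Pz: "P z' = z'" using z by (simp add: z'_def P' S_def)
      have z'L: "z' \<in> L"
      proof (rule L_dual)
        fix y assume "y \<in> L"
        then have "v (h (T z) y) \<le> v p" using boundP z by (simp add: S_def vp)
        then show "v (h z' y) \<le> 1" using p0 by (simp add: z'_def h_simps v_mult v_inverse v_divide field_simps)
      qed
      have "B z z = p * h z' z" by (simp add: B_def Tz h_simps)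
      also have "h z' z = h (T z') (T z)" by (simp add: T_adjoint)
      also have "\<dots> = p * h (T z') z'" by (simp add: Tz h_simps p_def conj_powi)
      finally have "v (B z z) = v p * (v p * v (h (T z') z'))" by (simp add: v_mult)
      also have "\<dots> \<le> v p * (v p * v p)" using boundP[OF z'L Pz z'L] by (intro mult_left_mono) (auto simp: vp)
      also have "\<dots> < v p * (1 * 1)" using small p0 by (intro mult_strict_left_mono mult_strict_mono) (auto simp: vp)
      finally show False using z(2) m vp by simp
    qed
    show ?thesis
    proof (cases "m > 0")
      case True
      have "\<exists>e f. hyperbolic_pair P e f m"
        using z m boundP by (intro hyperbolic_pair_ramified[OF P _ _ True]) (auto simp: S_def B_def)
      then show ?thesis using \<open>0 \<le> m\<close> bound by blast
    next
      case False
      then have m0: "m = 0" using \<open>0 \<le> m\<close> by simp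
      have TL: "T x \<in> L" if "x \<in> L" "P x = x" for x
        using boundP[OF that] m0 by (intro L_dual) simp
      show ?thesis
      proof (cases "\<exists>x y x' y'. P x = x \<and> T x = x \<and> h x y \<noteq> 0 \<and> P x' = x' \<and> T x' = - x' \<and> h x' y' \<noteq> 0")
        case True
        then have "\<exists>e f. hyperbolic_pair P e f m"
          unfolding m0 using hyperbolic_pair_unramified[OF P TL] by blast
        then show ?thesis using \<open>0 \<le> m\<close> bound by blast
      next
        case False
        \<comment> \<open>If one eigenspace is orthogonal to everything, the vectors
          \<open>P x + T (P x)\<close> or \<open>P x - T (P x)\<close>, which lie in it, vanish
          under \<open>h\<close>, and \<open>T\<close> acts as a sign.\<close>
        then consider "\<forall>x y. P x = x \<longrightarrow> T x = x \<longrightarrow> h x y = 0" | "\<forall>x y. P x = x \<longrightarrow> T x = - x \<longrightarrow> h x y = 0" by blast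
        then show ?thesis
        proof cases
          case 1
          have "h (P x + T (P x)) y = 0" for x y using 1 by (simp add: P' T_add add.commute)
          then have "h (T (P x)) y = - 1 * h (P x) y" for x y by (simp add: h_simps add_eq_0_iff)
          then show ?thesis by blast
        next
          case 2
          have "P (- y) = - P y" for y using P'(2)[of "- 1" y] by simp
          then have "P (P x - T (P x)) = P x - T (P x)" for x
            using P'(1)[of "P x" "- T (P x)"] by (simp add: P')
          then have "h (P x - T (P x)) y = 0" for x y using 2 by (simp add: T_diff)
          then have "h (T (P x)) y = 1 * h (P x) y" for x y by (simp add: h_simps)
          then show ?thesis by blast
        qed
      qed
    qed
  qed
qed

end

text \<open>Trace and rank are kept abstract. \<open>tr_cong\<close> fits a form with radical, and
  \<open>hyperbolic_rank_le\<close> stands for \<open>2 * r \<le> 2 * n + 1\<close>; it bounds the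
  number of planes, so that a maximal family exists.\<close>

locale hermitian_lattice_trace = hermitian_lattice v \<sigma> \<pi> scale h T L
  for v :: "'a::field_char_0 \<Rightarrow> real" and \<sigma> :: "'a \<Rightarrow> 'a" and \<pi> :: 'a
    and scale :: "'a \<Rightarrow> 'v::ab_group_add \<Rightarrow> 'v" (infixr "*\<^sub>s" 75) and h T L +
  fixes tr :: "('v \<Rightarrow> 'v) \<Rightarrow> 'a" and n :: nat
  assumes tr_diff_rank_1: "tr (\<lambda>u. F u - h u y *\<^sub>s x) = tr F - h x y"
    and tr_cong: "(\<And>u w. h (F u) w = h (G u) w) \<Longrightarrow> tr F = tr G"
    and tr_scale: "tr (\<lambda>u. c *\<^sub>s F u) = c * tr F"
    and tr_id: "tr (\<lambda>u. u) = of_nat (2 * n + 1)"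
    and tr_T: "tr T = 1"
    and hyperbolic_rank_le: "(\<And>i j. i < r \<Longrightarrow> j < r \<Longrightarrow>
      h (e i) (e j) = 0 \<and> h (f i) (f j) = 0 \<and> h (e i) (f j) = (if i = j then 1 else 0)) \<Longrightarrow> r \<le> n"
begin

text \<open>\<open>P\<close> projects onto the complement of the \<open>r\<close> planes; each plane
  takes 2 from the trace of the identity and nothing from that of \<open>T\<close>. The last clause
  hands the size bound to the next plane; the guard \<open>0 < r\<close> is there because at the
  start there is no last exponent.\<close>

definition hyperbolic_flag :: "nat \<Rightarrow> (nat \<Rightarrow> 'v) \<Rightarrow> (nat \<Rightarrow> 'v) \<Rightarrow> (nat \<Rightarrow> int) \<Rightarrow> ('v \<Rightarrow> 'v) \<Rightarrow> bool" where
  "hyperbolic_flag r e f l P \<longleftrightarrow>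
     (\<forall>i<r. \<forall>j<r. h (e i) (e j) = 0 \<and> h (f i) (f j) = 0 \<and> h (e i) (f j) = (if i = j then 1 else 0)) \<and>
     (\<forall>i<r. e i \<in> L \<and> f i \<in> L \<and> T (e i) = \<pi> powi l i *\<^sub>s f i \<and> 0 \<le> l i \<and> P (e i) = 0 \<and> P (f i) = 0) \<and>
     (\<forall>i j. i \<le> j \<longrightarrow> j < r \<longrightarrow> l j \<le> l i) \<and>
     invariant_projection P \<and> tr P = of_nat (2 * n + 1) - 2 * of_nat r \<and> tr (\<lambda>u. T (P u)) = 1 \<and>
     (0 < r \<longrightarrow> (\<forall>u\<in>L. \<forall>w\<in>L. v (h (T (P u)) (P w)) \<le> v \<pi> powi (- l (r - 1))))"

lemma hyperbolic_flag_0: "hyperbolic_flag 0 e f l (\<lambda>u. u)"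
  using tr_id tr_T by (simp add: hyperbolic_flag_def invariant_projection_def)

text \<open>For a hyperbolic pair the orthogonal projection onto its plane sends \<open>u\<close> to
  \<open>h u y *\<^sub>s x + h u x *\<^sub>s y\<close>, which is what \<open>P'\<close>
  removes.\<close>

lemma hyperbolic_flag_step:
  assumes flag: "hyperbolic_flag r e f l P" and pair: "0 \<le> m" "hyperbolic_pair P x y m"
    and bound: "\<And>u w. u \<in> L \<Longrightarrow> w \<in> L \<Longrightarrow> v (h (T (P u)) (P w)) \<le> v \<pi> powi (- m)"
  defines "P' \<equiv> \<lambda>u. P u - h u y *\<^sub>s x - h u x *\<^sub>s y"
  shows "hyperbolic_flag (Suc r) (e(r := x)) (f(r := y)) (l(r := m)) P'"
proof -
  have P: "P (u + w) = P u + P w" "P (c *\<^sub>s u) = c *\<^sub>s P u" "P (T u) = T (P u)"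
     "P (P u) = P u" "h (P u) w = h u (P w)" "u \<in> L \<Longrightarrow> P u \<in> L" for u w c
    using flag unfolding hyperbolic_flag_def invariant_projection_def by auto
  have xy: "x \<in> L" "y \<in> L" "P x = x" "P y = y" "h x x = 0" "h y y = 0" "h x y = 1" "T x = \<pi> powi m *\<^sub>s y"
    using pair(2) unfolding hyperbolic_pair_def by auto
  have yx: "h y x = 1" using h_conj[of x y] xy by simp
  have Ty: "T y = \<pi> powi (- m) *\<^sub>s x"
  proof -
    have "x = \<pi> powi m *\<^sub>s T y" using T_T[of x] unfolding xy(8) T_scale by simp
    then show ?thesis by (simp add: power_int_minus)
  qed
  have old: "h (e i) x = 0" "h (e i) y = 0" "h (f i) x = 0" "h (f i) y = 0"
    "h x (e i) = 0" "h y (e i) = 0" "h x (f i) = 0" "h y (f i) = 0" if "i < r" for i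
  proof -
    have e0: "P (e i) = 0" "P (f i) = 0" using flag that unfolding hyperbolic_flag_def by auto
    show "h (e i) x = 0" "h (e i) y = 0" "h (f i) x = 0" "h (f i) y = 0"
      using P(5)[of "e i"] P(5)[of "f i"] e0 xy(3,4) by (metis h_0_left)+
    then show "h x (e i) = 0" "h y (e i) = 0" "h x (f i) = 0" "h y (f i) = 0"
      by (metis h_conj conj_0)+
  qed
  have Px0: "P' x = 0" "P' y = 0" by (simp_all add: P'_def xy yx)
  have P'P: "P' (P u) = P' u" for u
    using P(5)[of u x] P(5)[of u y] by (simp add: P'_def P xy)
  have P'_add: "P' (u + w) = P' u + P' w" for u w
    by (simp add: P'_def P h_simps V.scale_left_distrib)
  have P'_scale: "P' (c *\<^sub>s u) = c *\<^sub>s P' u" for c u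
    by (simp add: P'_def P h_simps V.scale_right_diff_distrib)
  have P'_diff: "P' (u - w) = P' u - P' w" for u w
    using P'_add[of u "- w"] P'_scale[of "- 1" w] by simp
  have P'_P': "P' (P' u) = P' u" for u
    by (subst (2) P'_def) (simp add: P'_diff P'P P'_scale Px0)
  have P'_T: "P' (T u) = T (P' u)" for u
    by (simp add: P'_def P T_diff T_scale T_adjoint xy(8) Ty h_simps conj_powi mult.commute)
  have P'_L: "P' u \<in> L" if "u \<in> L" for u
    using that xy P by (auto simp: P'_def intro!: L_diff L_scale L_integral)
  have PP': "P (P' u) = P' u" for u
  proof -
    have Pd: "P (a - b) = P a - P b" for a b using P(1)[of a "- b"] P(2)[of "- 1" b] by simp
    show ?thesis by (simp add: P'_def Pd P xy)
  qed
  have inv: "invariant_projection P'"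
    unfolding invariant_projection_def
    using P'_add P'_scale P'_P' P'_T P'_L
    by (auto simp: P'_def h_simps P h_conj)
  have trP': "tr P' = of_nat (2 * n + 1) - 2 * of_nat (Suc r)"
  proof -
    have "tr P' = tr P - h x y - h y x"
      unfolding P'_def by (simp only: tr_diff_rank_1[of "\<lambda>u. P u - h u y *\<^sub>s x"] tr_diff_rank_1)
    then show ?thesis using flag xy yx unfolding hyperbolic_flag_def by (simp add: algebra_simps)
  qed
  have trTP': "tr (\<lambda>u. T (P' u)) = 1"
  proof -
    have "tr (\<lambda>u. T (P' u)) = tr (\<lambda>u. T (P u) - h u y *\<^sub>s T x - h u x *\<^sub>s T y)"
      by (simp add: P'_def T_diff T_scale)
    \<comment> \<open>\<open>T x\<close> and \<open>T y\<close> are multiples of the isotropic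
      vectors \<open>y\<close> and \<open>x\<close>, so both correction terms vanish.\<close>
    also have "\<dots> = tr (\<lambda>u. T (P u)) - h (T x) y - h (T y) x"
      by (simp only: tr_diff_rank_1[of "\<lambda>u. T (P u) - h u y *\<^sub>s T x"] tr_diff_rank_1)
    also have "\<dots> = 1" using flag unfolding hyperbolic_flag_def by (simp add: xy Ty h_simps)
    finally show ?thesis .
  qed
  \<comment> \<open>The new pair attains the size \<open>v \<pi> powi (- m)\<close> at
    \<open>h (T y) y\<close>, so the bound left by the previous plane compares \<open>m\<close> with
    the last exponent.\<close>
  have m_le: "m \<le> l i" if "i < r" for i
  proof -
    have "v \<pi> powi (- m) = v (h (T (P y)) (P y))" by (simp add: xy Ty h_simps v_powi)
    also have "\<forall>u\<in>L. \<forall>w\<in>L. v (h (T (P u)) (P w)) \<le> v \<pi> powi (- l (r - 1))"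
      using flag that unfolding hyperbolic_flag_def by auto
    then have "v (h (T (P y)) (P y)) \<le> v \<pi> powi (- l (r - 1))" using xy(2) by blast
    finally have "v \<pi> powi (- m) \<le> v \<pi> powi (- l (r - 1))" .
    then have "m \<le> l (r - 1)"
    proof (rule contrapos_pp)
      assume "\<not> m \<le> l (r - 1)"
      then have "v \<pi> powi (- l (r - 1)) < v \<pi> powi (- m)"
        using v_pi_less_1 by (intro power_int_strict_decreasing) auto
      then show "\<not> v \<pi> powi (- m) \<le> v \<pi> powi (- l (r - 1))" by simp
    qed
    also have "l (r - 1) \<le> l i" using flag that unfolding hyperbolic_flag_def by auto
    finally show ?thesis .
  qed
  have bound': "v (h (T (P' u)) (P' w)) \<le> v \<pi> powi (- m)" if "u \<in> L" "w \<in> L" for u w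
    using bound[of "P' u" "P' w"] that P'_L PP' by simp
  have zero': "P' (e i) = 0" "P' (f i) = 0" if "i < r" for i
    using flag that old unfolding hyperbolic_flag_def by (auto simp: P'_def)
  show ?thesis
    unfolding hyperbolic_flag_def
  proof (intro conjI allI impI)
    fix i j assume ij: "i < Suc r" "j < Suc r"
    let ?e = "e(r := x)" and ?f = "f(r := y)"
    show "h (?e i) (?e j) = 0" "h (?f i) (?f j) = 0" "h (?e i) (?f j) = (if i = j then 1 else 0)"
      using ij flag old xy(5-7) unfolding hyperbolic_flag_def by (cases "i = r"; cases "j = r"; simp)+
  next
    fix i j assume "i \<le> j" "j < Suc r"
    then show "(l(r := m)) j \<le> (l(r := m)) i"
      using flag m_le unfolding hyperbolic_flag_def by (auto simp: less_Suc_eq)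
  next
    fix i assume i: "i < Suc r"
    let ?e = "e(r := x)" and ?f = "f(r := y)" and ?l = "l(r := m)"
    show "?e i \<in> L" "?f i \<in> L" "T (?e i) = \<pi> powi ?l i *\<^sub>s ?f i" "0 \<le> ?l i" "P' (?e i) = 0" "P' (?f i) = 0"
      using i flag xy pair(1) Px0 zero' unfolding hyperbolic_flag_def by (cases "i = r"; simp)+
  qed (use inv trP' trTP' bound' in auto)
qed

text \<open>For a maximal flag \<open>T\<close> is a scalar \<open>s\<close> on what is left, so
  \<open>s * (2 * (n - r) + 1) = 1\<close>. In characteristic 0, with \<open>s\<close> equal to 1 or
  -1, this leaves only \<open>s = 1\<close> and \<open>r = n\<close>.\<close>

theorem adapted_basis:
  obtains e f l z where
    "\<And>i j. i < n \<Longrightarrow> j < n \<Longrightarrow> h (e i) (e j) = 0 \<and> h (f i) (f j) = 0 \<and> h (e i) (f j) = (if i = j then 1 else 0)"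
    "\<And>i. i < n \<Longrightarrow> e i \<in> L \<and> f i \<in> L \<and> T (e i) = \<pi> powi l i *\<^sub>s f i \<and> 0 \<le> l i"
    "\<And>i j. i \<le> j \<Longrightarrow> j < n \<Longrightarrow> l j \<le> l i"
    "z \<in> L" "h z z = 1" "\<And>i. i < n \<Longrightarrow> h z (e i) = 0 \<and> h z (f i) = 0" "\<And>w. h (T z) w = h z w"
proof -
  define Q where "Q r \<longleftrightarrow> (\<exists>e f l P. hyperbolic_flag r e f l P)" for r
  have Q0: "Q 0" using hyperbolic_flag_0 unfolding Q_def by blast
  have Qn: "r \<le> n" if "Q r" for r
  proof -
    obtain e f l P where "hyperbolic_flag r e f l P" using \<open>Q r\<close> unfolding Q_def by blast
    then show ?thesis by (intro hyperbolic_rank_le[of r e f]) (simp add: hyperbolic_flag_def)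
  qed
  define r where "r = (GREATEST r. Q r)"
  have "Q r" unfolding r_def using GreatestI_nat[of Q 0 n] Q0 Qn by blast
  then obtain e f l P where flag: "hyperbolic_flag r e f l P" unfolding Q_def by blast
  have "\<not> Q (Suc r)"
  proof
    assume "Q (Suc r)"
    then have "Suc r \<le> r" unfolding r_def using Greatest_le_nat[of Q "Suc r" n] Qn r_def by blast
    then show False by simp
  qed
  have P: "P (u + w) = P u + P w" "P (c *\<^sub>s u) = c *\<^sub>s P u" "P (T u) = T (P u)"
     "P (P u) = P u" "h (P u) w = h u (P w)" "u \<in> L \<Longrightarrow> P u \<in> L" for u w c
    using flag unfolding hyperbolic_flag_def invariant_projection_def by auto
  have inv: "invariant_projection P" using flag unfolding hyperbolic_flag_def by blast
  have "\<not> (0 \<le> m \<and> hyperbolic_pair P x y m \<and>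
       (\<forall>u\<in>L. \<forall>w\<in>L. v (h (T (P u)) (P w)) \<le> v \<pi> powi (- m)))" for x y m
  proof
    assume "0 \<le> m \<and> hyperbolic_pair P x y m \<and>
      (\<forall>u\<in>L. \<forall>w\<in>L. v (h (T (P u)) (P w)) \<le> v \<pi> powi (- m))"
    then have "hyperbolic_flag (Suc r) (e(r := x)) (f(r := y)) (l(r := m))
        (\<lambda>u. P u - h u y *\<^sub>s x - h u x *\<^sub>s y)"
      by (intro hyperbolic_flag_step[OF flag]) auto
    then show False using \<open>\<not> Q (Suc r)\<close> unfolding Q_def by blast
  qed
  then have "\<exists>s. (s = 1 \<or> s = - 1) \<and> (\<forall>u w. h (T (P u)) w = s * h (P u) w)"
    using hyperbolic_pair_or_scalar[OF inv] by blast
  then obtain s where s: "s = 1 \<or> s = - 1" "\<And>u w. h (T (P u)) w = s * h (P u) w" by blast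
  have trP: "tr P = of_nat (2 * n + 1) - 2 * of_nat r" "tr (\<lambda>u. T (P u)) = 1"
    using flag unfolding hyperbolic_flag_def by auto
  have "tr (\<lambda>u. T (P u)) = tr (\<lambda>u. s *\<^sub>s P u)" by (rule tr_cong) (simp add: s(2) h_simps)
  then have eq: "s * tr P = 1" using trP(2) tr_scale by simp
  have "r \<le> n" using Qn \<open>Q r\<close> by blast
  then have "tr P = of_nat (2 * (n - r) + 1)" unfolding trP(1) by (simp add: of_nat_diff algebra_simps)
  then have rn: "r = n \<and> s = 1"
    using s(1)
  proof (elim disjE)
    assume "s = 1" "tr P = of_nat (2 * (n - r) + 1)"
    then have "of_nat (2 * (n - r) + 1) = (of_nat 1 :: 'a)" using eq by simp
    then have "2 * (n - r) + 1 = 1" by (simp only: of_nat_eq_iff)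
    then show ?thesis using \<open>s = 1\<close> \<open>r \<le> n\<close> by simp
  next
    assume "s = - 1" and t: "tr P = of_nat (2 * (n - r) + 1)"
    then have "- tr P = 1" using eq by simp
    then have "tr P + 1 = 0" by (metis add.inverse_inverse add.left_inverse)
    moreover have "of_nat (2 * (n - r) + 2) = tr P + 1" unfolding t by simp
    ultimately have "of_nat (2 * (n - r) + 2) = (of_nat 0 :: 'a)" by simp
    then have "2 * (n - r) + 2 = 0" by (simp only: of_nat_eq_iff)
    then show ?thesis by simp
  qed
  \<comment> \<open>As \<open>tr P\<close> is not 0, the form \<open>h\<close> sees the image of
    \<open>P\<close>; a unit vector in it becomes \<open>z\<close>.\<close>
  have "\<exists>u w. h (P u) w \<noteq> 0"
  proof (rule ccontr)
    assume "\<not> ?thesis"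
    then have "tr P = tr (\<lambda>u. 0 *\<^sub>s P u)" by (intro tr_cong) simp
    also have "\<dots> = 0" by (simp only: tr_scale mult_zero_left)
    finally show False using eq by simp
  qed
  then obtain u w where "h (P u) w \<noteq> 0" by blast
  then obtain c w' where c: "c *\<^sub>s P u \<in> L" "w' \<in> L" "h (c *\<^sub>s P u) w' = 1" using exists_normalized by blast
  have "\<exists>z\<in>{z \<in> L. P z = z}. h z z = 1"
  proof (rule exists_unit_vector)
    show "c *\<^sub>s P u \<in> {z \<in> L. P z = z}" "P w' \<in> {z \<in> L. P z = z}" using c P by auto
    show "h (c *\<^sub>s P u) (P w') = 1" using c P(5)[of "c *\<^sub>s P u" w'] P by simp
  qed (auto simp: P intro: L_add L_scale)
  then obtain z where z: "z \<in> L" "P z = z" "h z z = 1" by blast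
  have zh: "h (T z) w = h z w" for w using s(2)[of z w] z rn by simp
  have z0: "h z (e i) = 0 \<and> h z (f i) = 0" if "i < n" for i
  proof -
    have "P (e i) = 0" "P (f i) = 0" using flag that rn unfolding hyperbolic_flag_def by auto
    then show ?thesis using P(5)[of z] z(2) by (metis h_0_right)
  qed
  show thesis
    by (rule that[of e f l z]) (use flag rn z zh z0 in \<open>auto simp: hyperbolic_flag_def\<close>)
qed

end

section \<open>Unitary matrices\<close>

lemma coeff_prod_linear:
  fixes a :: "nat \<Rightarrow> 'a::comm_ring_1"
  shows "coeff (\<Prod>i<Suc m. [:- a i, 1:]) m = - (\<Sum>i<Suc m. a i)"
proof -
  have *: "coeff (\<Prod>i<m. [:- a i, 1:]) m = 1 \<and> (\<forall>k>m. coeff (\<Prod>i<m. [:- a i, 1:]) k = 0)" for m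
  proof (induction m)
    case (Suc m)
    then show ?case by (auto simp: coeff_pCons algebra_simps split: nat.splits)
  qed (auto simp: coeff_eq_0)
  show ?thesis
  proof (induction m)
    case (Suc m)
    then show ?case using *[of "Suc m"]
      by (subst prod.lessThan_Suc) (simp add: algebra_simps del: prod.lessThan_Suc)
  qed simp
qed

text \<open>A permutation other than the identity moves some \<open>i\<close> and then also
  \<open>p i\<close>. Two factors of its product are therefore constants, its degree stays below
  \<open>m\<close>, and only the diagonal product counts.\<close>

lemma coeff_char_poly:
  fixes A :: "'a::comm_ring_1 mat"
  assumes A: "A \<in> carrier_mat (Suc m) (Suc m)"
  shows "coeff (char_poly A) m = - (\<Sum>i<Suc m. A $$ (i, i))"
proof -
  let ?B = "[:0, 1:] \<cdot>\<^sub>m 1\<^sub>m (Suc m) + map_mat (\<lambda>a. [:- a:]) A"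
  let ?t = "\<lambda>p. signof p * (\<Prod>i = 0..<Suc m. ?B $$ (i, p i))"
  let ?S = "{p. p permutes {0..<Suc m}}"
  have B: "?B \<in> carrier_mat (Suc m) (Suc m)" using A by auto
  have fin: "finite ?S" by (simp add: finite_permutations)
  have "char_poly A = (\<Sum>p\<in>?S. ?t p)"
    using A det_def'[OF B] by (simp add: char_poly_defs)
  also have "\<dots> = ?t id + (\<Sum>p\<in>?S - {id}. ?t p)"
    using fin by (intro sum.remove) (auto simp: permutes_id)
  finally have cp: "char_poly A = ?t id + (\<Sum>p\<in>?S - {id}. ?t p)" .
  have "coeff (?t p) m = 0" if p: "p \<in> ?S - {id}" for p
  proof -
    have perm: "p permutes {0..<Suc m}" and "p \<noteq> id" using p by auto
    then obtain i where i: "p i \<noteq> i" by (auto simp: fun_eq_iff)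
    have inj: "inj p" using perm permutes_inj by blast
    have i1: "i < Suc m" using permutes_not_in[OF perm, of i] i by fastforce
    then have i2: "p i < Suc m" using permutes_in_image[OF perm, of i] by simp
    have i3: "p (p i) \<noteq> p i" using i inj by (auto simp: inj_def)
    have "degree (\<Prod>k = 0..<Suc m. ?B $$ (k, p k)) \<le> (\<Sum>k = 0..<Suc m. degree (?B $$ (k, p k)))"
      by (rule order_trans[OF degree_prod_sum_le]) (simp_all add: comp_def)
    also have "\<dots> \<le> (\<Sum>k = 0..<Suc m. if k = i \<or> k = p i then 0 else 1)"
    proof (rule sum_mono)
      fix k assume "k \<in> {0..<Suc m}"
      then have "k < Suc m" "p k < Suc m" using permutes_in_image[OF perm, of k] by auto
      then show "degree (?B $$ (k, p k)) \<le> (if k = i \<or> k = p i then 0 else 1)"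
        using A i i3 by auto
    qed
    also have "\<dots> = (\<Sum>k \<in> {0..<Suc m} - {i, p i}. 1)"
      by (rule sum.mono_neutral_cong_right) auto
    also have "\<dots> = card ({0..<Suc m} - {i, p i})" by simp
    also have "\<dots> = Suc m - 2" using i i1 i2 by (subst card_Diff_subset) auto
    finally have deg: "degree (\<Prod>k = 0..<Suc m. ?B $$ (k, p k)) \<le> Suc m - 2" .
    \<comment> \<open>Two distinct indices below \<open>Suc m\<close> exclude \<open>m = 0\<close>,
      where the truncated \<open>Suc m - 2\<close> would not be smaller than
      \<open>m\<close>.\<close>
    have "m \<noteq> 0" using i i1 i2 by auto
    then have "degree (\<Prod>k = 0..<Suc m. ?B $$ (k, p k)) < m" using deg by simp
    then have "coeff (\<Prod>k = 0..<Suc m. ?B $$ (k, p k)) m = 0" by (rule coeff_eq_0)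
    then show ?thesis by (simp add: sign_def)
  qed
  then have "coeff (\<Sum>p\<in>?S - {id}. ?t p) m = 0" by (simp add: coeff_sum)
  moreover have "?t id = (\<Prod>i<Suc m. [:- A $$ (i, i), 1:])"
    using A by (auto simp: lessThan_atLeast0 sign_id intro!: prod.cong)
  ultimately show ?thesis unfolding cp using coeff_prod_linear[of "\<lambda>i. A $$ (i, i)" m] by simp
qed

text \<open>The roots are listed as \<open>n + 1\<close> times 1 and then \<open>n\<close> times -1,
  which serves both the trace of an element of X and the diagonal form of \<open>x_mat\<close> times
  j.\<close>

lemma split_poly_eq_prod:
  "([:0, 1:] ^ 2 - 1) ^ n * ([:0, 1:] - 1) = (\<Prod>i<2 * n + 1. [:- (if i \<le> n then 1 else - 1), 1 :: 'a::comm_ring_1:])"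
proof -
  have "(\<Prod>i<2 * n + 1. [:- (if i \<le> n then 1 else - 1), 1 :: 'a:]) =
     (\<Prod>i<Suc n. [:- 1, 1 :: 'a:]) * (\<Prod>i = Suc n..<2 * n + 1. [:1, 1:])"
  proof -
    have S: "{..<2 * n + 1} = {..<Suc n} \<union> {Suc n..<2 * n + 1}" by auto
    have "(\<Prod>i<2 * n + 1. [:- (if i \<le> n then 1 else - 1), 1 :: 'a:]) =
      (\<Prod>i<Suc n. [:- (if i \<le> n then 1 else - 1), 1 :: 'a:]) *
      (\<Prod>i=Suc n..<2 * n + 1. [:- (if i \<le> n then 1 else - 1), 1 :: 'a:])"
      unfolding S by (rule prod.union_disjoint) auto
    also have "(\<Prod>i<Suc n. [:- (if i \<le> n then 1 else - 1), 1 :: 'a:]) = (\<Prod>i<Suc n. [:- 1, 1 :: 'a:])"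
      by (rule prod.cong) auto
    also have "(\<Prod>i=Suc n..<2 * n + 1. [:- (if i \<le> n then 1 else - 1), 1 :: 'a:]) = (\<Prod>i = Suc n..<2 * n + 1. [:1, 1:])"
      by (rule prod.cong) auto
    finally show ?thesis .
  qed
  also have "\<dots> = [:- 1, 1:] ^ Suc n * [:1, 1:] ^ n" by (simp del: prod.lessThan_Suc)
  also have "\<dots> = ([:- 1, 1:] * [:1, 1:]) ^ n * [:- 1, 1:]" by (simp only: power_mult_distrib power_Suc mult.commute mult.left_commute)
  also have "[:- 1, 1:] * [:1, 1:] = ([:0, 1:] ^ 2 - 1 :: 'a poly)" by (simp add: power2_eq_square one_pCons)
  also have "[:- 1, 1:] = ([:0, 1:] - 1 :: 'a poly)" by (simp add: one_pCons)
  finally show ?thesis by simp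
qed

section \<open>The antidiagonal matrix j\<close>

lemma antidiag_carrier [simp]: "antidiag m \<in> carrier_mat m m"
  by (simp add: antidiag_def)

lemma antidiag_dim [simp]: "dim_row (antidiag m) = m" "dim_col (antidiag m) = m"
  by (simp_all add: antidiag_def)

lemma antidiag_index: "i < m \<Longrightarrow> j < m \<Longrightarrow> antidiag m $$ (i, j) = (if j = m - Suc i then 1 else 0)"
  by (auto simp: antidiag_def)

lemma mult_antidiag_index:
  fixes A :: "'a::semiring_1 mat"
  assumes "A \<in> carrier_mat l m" "i < l" "j < m"
  shows "(A * antidiag m) $$ (i, j) = A $$ (i, m - Suc j)"
proof -
  have "(A * antidiag m) $$ (i, j) = (\<Sum>a = 0..<m. A $$ (i, a) * antidiag m $$ (a, j))"
    using assms by (simp add: scalar_prod_def)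
  also have "\<dots> = (\<Sum>a = 0..<m. if a = m - Suc j then A $$ (i, a) else 0)"
    using assms(3) by (intro sum.cong) (auto simp: antidiag_index)
  also have "\<dots> = A $$ (i, m - Suc j)" using assms(3) by simp
  finally show ?thesis .
qed

lemma antidiag_mult_index:
  fixes A :: "'a::semiring_1 mat"
  assumes "A \<in> carrier_mat m l" "i < m" "j < l"
  shows "(antidiag m * A) $$ (i, j) = A $$ (m - Suc i, j)"
proof -
  have "(antidiag m * A) $$ (i, j) = (\<Sum>a = 0..<m. antidiag m $$ (i, a) * A $$ (a, j))"
    using assms by (simp add: scalar_prod_def)
  also have "\<dots> = (\<Sum>a = 0..<m. if a = m - Suc i then A $$ (a, j) else 0)"
    using assms(2) by (intro sum.cong) (auto simp: antidiag_index)
  also have "\<dots> = A $$ (m - Suc i, j)" using assms(2) by simp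
  finally show ?thesis .
qed

lemma antidiag_mult_antidiag [simp]: "antidiag m * antidiag m = (1\<^sub>m m :: 'a::semiring_1 mat)"
proof (rule eq_matI)
  fix i j assume "i < dim_row (1\<^sub>m m :: 'a mat)" "j < dim_col (1\<^sub>m m :: 'a mat)"
  then show "(antidiag m * antidiag m) $$ (i, j) = (1\<^sub>m m :: 'a mat) $$ (i, j)"
    by (subst mult_antidiag_index[of _ m]) (auto simp: antidiag_index)
qed auto

text \<open>A one-sided inverse of a square matrix is two-sided. The form with sums applies to
  families of functions, which are the vectors of the lattice model.\<close>

lemma sum_product_inverse_commute:
  fixes A B :: "nat \<Rightarrow> nat \<Rightarrow> 'a::field"
  assumes "\<And>i j. i < N \<Longrightarrow> j < N \<Longrightarrow> (\<Sum>a<N. A i a * B a j) = (if i = j then 1 else 0)"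
    and "i < N" "j < N"
  shows "(\<Sum>a<N. B i a * A a j) = (if i = j then 1 else 0)"
proof -
  define MA MB where "MA = mat N N (\<lambda>(i, j). A i j)" and "MB = mat N N (\<lambda>(i, j). B i j)"
  have "MA * MB = 1\<^sub>m N"
    by (rule eq_matI) (auto simp: MA_def MB_def scalar_prod_def assms(1) simp flip: lessThan_atLeast0)
  then have "MB * MA = 1\<^sub>m N"
    by (rule mat_mult_left_right_inverse[rotated 2]) (auto simp: MA_def MB_def)
  then have "(MB * MA) $$ (i, j) = 1\<^sub>m N $$ (i, j)" by simp
  then show ?thesis using assms(2,3) by (simp add: MA_def MB_def scalar_prod_def lessThan_atLeast0)
qed

section \<open>Conjugate transposes, adjoints and the groups G and K\<close>

lemma conj_transpose_carrier [simp]: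
  "A \<in> carrier_mat l m \<Longrightarrow> conj_transpose \<sigma> A \<in> carrier_mat m l"
  by (simp add: conj_transpose_def)

lemma conj_transpose_dim [simp]:
  "dim_row (conj_transpose \<sigma> A) = dim_col A" "dim_col (conj_transpose \<sigma> A) = dim_row A"
  by (simp_all add: conj_transpose_def)

lemma conj_transpose_index:
  "i < dim_col A \<Longrightarrow> j < dim_row A \<Longrightarrow> conj_transpose \<sigma> A $$ (i, j) = \<sigma> (A $$ (j, i))"
  by (simp add: conj_transpose_def)

context hermitian_field
begin

lemma conj_transpose_mult:
  assumes "A \<in> carrier_mat l m" "B \<in> carrier_mat m r"
  shows "conj_transpose \<sigma> (A * B) = conj_transpose \<sigma> B * conj_transpose \<sigma> A"
  by (rule eq_matI) (use assms in \<open>auto simp: conj_transpose_index scalar_prod_def conj_sum conj_mult mult.commute\<close>)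

lemma conj_transpose_conj_transpose [simp]: "conj_transpose \<sigma> (conj_transpose \<sigma> A) = A"
  by (rule eq_matI) (auto simp: conj_transpose_index)

lemma conj_transpose_antidiag [simp]: "conj_transpose \<sigma> (antidiag m) = antidiag m"
  by (rule eq_matI) (auto simp: conj_transpose_index antidiag_def)

lemma conj_transpose_one [simp]: "conj_transpose \<sigma> (1\<^sub>m m) = 1\<^sub>m m"
  by (rule eq_matI) (auto simp: conj_transpose_index)

text \<open>The adjoint with respect to the form with matrix j; membership in G means that it is the
  inverse.\<close>

definition adj :: "nat \<Rightarrow> 'a mat \<Rightarrow> 'a mat" where
  "adj m g = antidiag m * conj_transpose \<sigma> g * antidiag m"

lemma adj_dim [simp]: "dim_row (adj m g) = m" "dim_col (adj m g) = m"
  by (simp_all add: adj_def)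

lemma adj_carrier [simp]: "g \<in> carrier_mat m m \<Longrightarrow> adj m g \<in> carrier_mat m m"
  unfolding adj_def by (meson antidiag_carrier conj_transpose_carrier mult_carrier_mat)

lemma adj_index:
  assumes "g \<in> carrier_mat m m" "i < m" "j < m"
  shows "adj m g $$ (i, j) = \<sigma> (g $$ (m - Suc j, m - Suc i))"
proof -
  have "antidiag m * conj_transpose \<sigma> g \<in> carrier_mat m m"
    using assms(1) by (meson antidiag_carrier conj_transpose_carrier mult_carrier_mat)
  then show ?thesis unfolding adj_def
    using assms by (simp add: mult_antidiag_index[of _ m] antidiag_mult_index[of _ _ m] conj_transpose_index del: index_mult_mat)
qed

lemma adj_mult_eq_one_iff:
  assumes g: "g \<in> carrier_mat m m"
  shows "adj m g * g = 1\<^sub>m m \<longleftrightarrow> conj_transpose \<sigma> g * antidiag m * g = antidiag m"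
proof -
  let ?J = "antidiag m :: 'a mat" and ?c = "conj_transpose \<sigma> g"
  have c: "?c \<in> carrier_mat m m" "?c * ?J * g \<in> carrier_mat m m" using g by (auto intro!: mult_carrier_mat)
  have eq: "adj m g * g = ?J * (?c * ?J * g)"
    unfolding adj_def using g c by (simp add: assoc_mult_mat[of _ m m _ m _ m] mult_carrier_mat[of _ m m _ m])
  have "?J * (?J * (?c * ?J * g)) = (?J * ?J) * (?c * ?J * g)"
    using c(2) by (intro assoc_mult_mat[symmetric]) auto
  then have "?J * (?J * (?c * ?J * g)) = ?c * ?J * g" using left_mult_one_mat[OF c(2)] by simp
  then show ?thesis unfolding eq by (metis antidiag_carrier antidiag_mult_antidiag right_mult_one_mat)
qed

text \<open>In the order \<open>g * adj m g\<close> the condition prescribes the Gram matrix of the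
  rows of \<open>g\<close>, which is how \<open>g\<close> is later built from a basis.\<close>

lemma unitary_G_iff:
  "g \<in> unitary_G \<sigma> n \<longleftrightarrow> g \<in> carrier_mat (2 * n + 1) (2 * n + 1) \<and> g * adj (2 * n + 1) g = 1\<^sub>m (2 * n + 1)"
proof (cases "g \<in> carrier_mat (2 * n + 1) (2 * n + 1)")
  case True
  let ?m = "2 * n + 1"
  have a: "adj ?m g \<in> carrier_mat ?m ?m" using True by (rule adj_carrier)
  have "g \<in> unitary_G \<sigma> n \<longleftrightarrow> invertible_mat g \<and> adj ?m g * g = 1\<^sub>m ?m"
    unfolding unitary_G_def mem_Collect_eq adj_mult_eq_one_iff[OF True] using True by blast
  moreover have "adj ?m g * g = 1\<^sub>m ?m \<longleftrightarrow> g * adj ?m g = 1\<^sub>m ?m"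
    using mat_mult_left_right_inverse True a by blast
  moreover have "invertible_mat g" if "adj ?m g * g = 1\<^sub>m ?m" "g * adj ?m g = 1\<^sub>m ?m"
  proof -
    have d: "dim_row g = ?m" "dim_col g = ?m" "dim_row (adj ?m g) = ?m" using True a by (blast dest: carrier_matD)+
    show ?thesis unfolding invertible_mat_def inverts_mat_def square_mat.simps
      by (intro conjI exI[of _ "adj ?m g"]) (simp_all only: d that)
  qed
  ultimately show ?thesis using True by blast
next
  case False
  then show ?thesis by (simp add: unitary_G_def)
qed

lemma adj_adj: "g \<in> carrier_mat m m \<Longrightarrow> adj m (adj m g) = g"
  by (rule eq_matI) (auto simp: adj_index dest: adj_carrier)

lemma adj_mult:
  assumes "g \<in> carrier_mat m m" "g' \<in> carrier_mat m m"
  shows "adj m (g * g') = adj m g' * adj m g"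
proof -
  let ?J = "antidiag m :: 'a mat"
  let ?a = "conj_transpose \<sigma> g" and ?b = "conj_transpose \<sigma> g'"
  have c: "?a \<in> carrier_mat m m" "?b \<in> carrier_mat m m" using assms by auto
  have b: "?J * ?b \<in> carrier_mat m m" using c by (auto intro!: mult_carrier_mat)
  have "adj m g' * adj m g = ?J * ?b * (?J * ?J) * ?a * ?J"
    unfolding adj_def using c by (simp add: assoc_mult_mat[of _ m m _ m _ m] mult_carrier_mat[of _ m m _ m] del: antidiag_mult_antidiag)
  also have "\<dots> = ?J * ?b * ?a * ?J" using right_mult_one_mat[OF b] by simp
  also have "\<dots> = adj m (g * g')"
    unfolding adj_def conj_transpose_mult[OF assms] using c by (simp add: assoc_mult_mat[of _ m m _ m _ m] mult_carrier_mat[of _ m m _ m])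
  finally show ?thesis by simp
qed

lemma mult_adj_mult:
  assumes c: "g \<in> carrier_mat m m" "g' \<in> carrier_mat m m"
    and e: "g * adj m g = 1\<^sub>m m" "g' * adj m g' = 1\<^sub>m m"
  shows "g * g' * adj m (g * g') = 1\<^sub>m m"
proof -
  note a = adj_carrier[OF c(1)] adj_carrier[OF c(2)]
  have "g * g' * adj m (g * g') = g * (g' * adj m g') * adj m g"
    using c a by (simp add: adj_mult assoc_mult_mat[of _ m m _ m _ m] mult_carrier_mat[of _ m m _ m])
  then show ?thesis using e right_mult_one_mat[OF c(1)] by simp
qed

lemma unitary_G_inverse:
  assumes "g \<in> unitary_G \<sigma> n"
  shows "adj (2 * n + 1) g * g = 1\<^sub>m (2 * n + 1)"
  using assms mat_mult_left_right_inverse[of g "2 * n + 1"] adj_carrier unfolding unitary_G_iff by blast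

lemma adj_unitary_G: "g \<in> unitary_G \<sigma> n \<Longrightarrow> adj (2 * n + 1) g \<in> unitary_G \<sigma> n"
  using unitary_G_inverse unfolding unitary_G_iff by (simp add: adj_adj)

lemma mult_unitary_G: "g \<in> unitary_G \<sigma> n \<Longrightarrow> g' \<in> unitary_G \<sigma> n \<Longrightarrow> g * g' \<in> unitary_G \<sigma> n"
  unfolding unitary_G_iff using mult_adj_mult mult_carrier_mat by blast

lemma unitary_K_iff:
  "g \<in> unitary_K v \<sigma> n \<longleftrightarrow> g \<in> unitary_G \<sigma> n \<and> (\<forall>i<2 * n + 1. \<forall>j<2 * n + 1. v (g $$ (i, j)) \<le> 1)"
proof -
  have "dim_row g = 2 * n + 1" "dim_col g = 2 * n + 1" if "g \<in> unitary_G \<sigma> n"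
    using that unfolding unitary_G_def by auto
  then show ?thesis
    by (fastforce simp: unitary_K_def ring_of_integers_def elements_mat_def)
qed

lemma adj_unitary_K: "g \<in> unitary_K v \<sigma> n \<Longrightarrow> adj (2 * n + 1) g \<in> unitary_K v \<sigma> n"
  unfolding unitary_K_iff using adj_unitary_G by (auto simp: adj_index unitary_G_iff)

lemma mult_unitary_K:
  assumes "g \<in> unitary_K v \<sigma> n" "g' \<in> unitary_K v \<sigma> n"
  shows "g * g' \<in> unitary_K v \<sigma> n"
  unfolding unitary_K_iff
proof (intro conjI allI impI)
  show "g * g' \<in> unitary_G \<sigma> n" using assms mult_unitary_G unfolding unitary_K_iff by blast
  fix i j assume ij: "i < 2 * n + 1" "j < 2 * n + 1"
  have c: "g \<in> carrier_mat (2 * n + 1) (2 * n + 1)" "g' \<in> carrier_mat (2 * n + 1) (2 * n + 1)"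
    using assms unfolding unitary_K_iff unitary_G_iff by auto
  have eq: "(g * g') $$ (i, j) = (\<Sum>a = 0..<2 * n + 1. g $$ (i, a) * g' $$ (a, j))"
    using c ij by (simp add: scalar_prod_def)
  show "v ((g * g') $$ (i, j)) \<le> 1"
    unfolding eq using assms ij unfolding unitary_K_iff by (intro v_sum_le) (auto intro: v_mult_le_1)
qed

section \<open>Determinants modulo the maximal ideal\<close>

lemma v_det_le_1:
  assumes "A \<in> carrier_mat m m" "\<And>i j. i < m \<Longrightarrow> j < m \<Longrightarrow> v (A $$ (i, j)) \<le> 1"
  shows "v (det A) \<le> 1"
  unfolding det_def'[OF assms(1)]
proof (rule v_sum_le)
  fix p assume "p \<in> {p. p permutes {0..<m}}"
  then have "p i < m" if "i < m" for i using that permutes_in_image[of p "{0..<m}" i] by simp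
  then have "(\<Prod>i = 0..<m. v (A $$ (i, p i))) \<le> 1" using assms(2) by (intro prod_le_1) auto
  then show "v (signof p * (\<Prod>i = 0..<m. A $$ (i, p i))) \<le> 1" by (simp add: v_mult v_prod sign_def)
qed simp

text \<open>No permutation maps the \<open>r + 1\<close> rows up to \<open>r\<close> into the \<open>r\<close> columns below \<open>r\<close>.\<close>

lemma v_det_less_1:
  assumes A: "A \<in> carrier_mat m m" "\<And>i j. i < m \<Longrightarrow> j < m \<Longrightarrow> v (A $$ (i, j)) \<le> 1"
    and r: "r < m" "\<And>i j. i \<le> r \<Longrightarrow> r \<le> j \<Longrightarrow> j < m \<Longrightarrow> v (A $$ (i, j)) < 1"
  shows "v (det A) < 1"
  unfolding det_def'[OF assms(1)]
proof (rule v_sum_less)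
  fix p assume "p \<in> {p. p permutes {0..<m}}"
  then have perm: "p permutes {0..<m}" by simp
  have pm: "p i < m" if "i < m" for i using that permutes_in_image[OF perm, of i] by simp
  have "\<exists>i\<le>r. r \<le> p i"
  proof (rule ccontr)
    assume "\<not> ?thesis"
    then have "p ` {..r} \<subseteq> {..<r}" by auto
    then have "card (p ` {..r}) \<le> card {..<r}" by (intro card_mono) auto
    moreover have "card (p ` {..r}) = card {..r}"
      using permutes_inj[OF perm] by (intro card_image) (auto simp: inj_on_def inj_def)
    ultimately show False by simp
  qed
  then obtain i where i: "i \<le> r" "r \<le> p i" by blast
  then have im: "i \<in> {0..<m}" using r(1) by simp
  have "(\<Prod>i = 0..<m. v (A $$ (i, p i))) = v (A $$ (i, p i)) * (\<Prod>i \<in> {0..<m} - {i}. v (A $$ (i, p i)))"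
    using im by (intro prod.remove) auto
  also have "\<dots> \<le> v (A $$ (i, p i)) * 1"
    using A(2) pm by (intro mult_left_mono prod_le_1) auto
  also have "\<dots> < 1" using r(2)[OF i pm] im by simp
  finally show "v (signof p * (\<Prod>i = 0..<m. A $$ (i, p i))) < 1" by (simp add: v_mult v_prod sign_def)
qed simp

end

text \<open>For products with matrices supported on the diagonal and the antidiagonal. At
  \<open>i = n\<close> the two indices coincide and the term counts once.\<close>

lemma sum_supported_on_reflected_pair:
  fixes F :: "nat \<Rightarrow> 'a::comm_monoid_add"
  assumes "i \<le> 2 * n" "\<And>a. a \<le> 2 * n \<Longrightarrow> a \<noteq> i \<Longrightarrow> a \<noteq> 2 * n - i \<Longrightarrow> F a = 0"
  shows "(\<Sum>a = 0..<2 * n + 1. F a) = (if i = n then F n else F i + F (2 * n - i))"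
proof -
  have "(\<Sum>a = 0..<2 * n + 1. F a) = (\<Sum>a \<in> {i, 2 * n - i}. F a)"
    using assms by (intro sum.mono_neutral_right) auto
  then show ?thesis using assms(1) by auto
qed

context hermitian_field
begin

section \<open>The representatives and the action on X\<close>

definition x_entry :: "nat \<Rightarrow> int vec \<Rightarrow> nat \<Rightarrow> 'a" where
  "x_entry n l i = (if i < n then \<pi> powi (l $ i) else if i = n then 1 else \<pi> powi (- (l $ (2 * n - i))))"

lemma x_mat_eq: "x_mat \<pi> n l = mat_diag (2 * n + 1) (x_entry n l)"
  unfolding x_mat_def x_entry_def[abs_def] ..

lemma x_entry_nonzero [simp]: "x_entry n l i \<noteq> 0"
  by (simp add: x_entry_def)

lemma conj_x_entry [simp]: "\<sigma> (x_entry n l i) = x_entry n l i"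
  by (simp add: x_entry_def conj_powi)

lemma x_entry_reflect: "i \<le> 2 * n \<Longrightarrow> x_entry n l i * x_entry n l (2 * n - i) = 1"
  by (auto simp: x_entry_def power_int_minus)

lemma x_mat_carrier [simp]: "x_mat \<pi> n l \<in> carrier_mat (2 * n + 1) (2 * n + 1)"
  by (simp add: x_mat_eq)

lemma x_mat_index:
  "i < 2 * n + 1 \<Longrightarrow> j < 2 * n + 1 \<Longrightarrow> x_mat \<pi> n l $$ (i, j) = (if i = j then x_entry n l i else 0)"
  by (simp add: x_mat_eq mat_diag_def)

lemma x_mat_mult_index:
  assumes "A \<in> carrier_mat (2 * n + 1) m" "i < 2 * n + 1" "j < m"
  shows "(x_mat \<pi> n l * A) $$ (i, j) = x_entry n l i * A $$ (i, j)"
  unfolding x_mat_eq mat_diag_mult_left[OF assms(1)] using assms(2,3) by simp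

lemma mult_x_mat_index:
  assumes "A \<in> carrier_mat m (2 * n + 1)" "i < m" "j < 2 * n + 1"
  shows "(A * x_mat \<pi> n l) $$ (i, j) = A $$ (i, j) * x_entry n l j"
  unfolding x_mat_eq mat_diag_mult_right[OF assms(1)] using assms(2,3) by simp

lemma conj_transpose_x_mat: "conj_transpose \<sigma> (x_mat \<pi> n l) = x_mat \<pi> n l"
proof -
  have d: "dim_row (x_mat \<pi> n l) = 2 * n + 1" "dim_col (x_mat \<pi> n l) = 2 * n + 1"
    using x_mat_carrier[of n l] by auto
  show ?thesis
    by (rule eq_matI) (auto simp: conj_transpose_index x_mat_index d simp del: One_nat_def)
qed

lemma x_mat_unitary: "x_mat \<pi> n l \<in> unitary_G \<sigma> n"
  unfolding unitary_G_iff
proof (intro conjI eq_matI)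
  let ?m = "2 * n + 1"
  have a: "adj ?m (x_mat \<pi> n l) \<in> carrier_mat ?m ?m" by (intro adj_carrier x_mat_carrier)
  fix i j assume "i < dim_row (1\<^sub>m ?m :: 'a mat)" "j < dim_col (1\<^sub>m ?m :: 'a mat)"
  then have ij: "i < ?m" "j < ?m" by auto
  have "(x_mat \<pi> n l * adj ?m (x_mat \<pi> n l)) $$ (i, j) = x_entry n l i * adj ?m (x_mat \<pi> n l) $$ (i, j)"
    using ij a by (intro x_mat_mult_index)
  also have "adj ?m (x_mat \<pi> n l) $$ (i, j) = \<sigma> (x_mat \<pi> n l $$ (?m - Suc j, ?m - Suc i))"
    using ij by (intro adj_index x_mat_carrier)
  also have "\<dots> = (if i = j then x_entry n l (2 * n - i) else 0)"
    using ij by (subst x_mat_index) auto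
  finally show "(x_mat \<pi> n l * adj ?m (x_mat \<pi> n l)) $$ (i, j) = 1\<^sub>m ?m $$ (i, j)"
    using ij x_entry_reflect[of i n l] by auto
qed (use x_mat_carrier[of n l] in auto)

text \<open>For \<open>i < n\<close> and \<open>d = x_entry n l i\<close> the matrix exchanges the
  coordinates \<open>i\<close> and \<open>2 * n - i\<close> up to the factors \<open>d\<close> and
  \<open>1 / d\<close>. It is diagonalised explicitly: the columns of \<open>P\<close> are
  eigenvectors and \<open>Q\<close> is the inverse of \<open>P\<close>.\<close>

lemma char_poly_x_mat:
  "char_poly (x_mat \<pi> n l * antidiag (2 * n + 1)) = ([:0, 1:] ^ 2 - 1) ^ n * ([:0, 1:] - 1)"
proof -
  define m where "m = 2 * n + 1"
  let ?d = "x_entry n l"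
  have dr: "?d i * ?d (2 * n - i) = 1" if "i \<le> 2 * n" for i using x_entry_reflect that .
  \<comment> \<open>For \<open>i < n\<close> the block of \<open>P\<close> at \<open>i\<close>,
    \<open>2 * n - i\<close> has rows \<open>d, d\<close> and \<open>1, -1\<close>; its inverse has
    rows \<open>1 / (2 * d), 1 / 2\<close> and \<open>1 / (2 * d), - 1 / 2\<close>.
    \<open>\<alpha>\<close> and \<open>\<gamma>\<close> are the diagonal, \<open>\<beta>\<close> and
    \<open>\<delta>\<close> the antidiagonal entries.\<close>
  define \<alpha> \<beta> \<gamma> \<delta> where
    "\<alpha> i = (if i < n then ?d i else if i = n then 1 else - 1)" and
    "\<beta> i = (if i < n then ?d i else 1)" and
    "\<gamma> i = (if i < n then 1 / (2 * ?d i) else if i = n then 1 else - 1 / 2)" and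
    "\<delta> i = (if i < n then 1 / 2 else 1 / (2 * ?d (2 * n - i)))" for i
  define P Q where
    "P = mat m m (\<lambda>(i, k). if k = i then \<alpha> i else if k = 2 * n - i then \<beta> i else 0)" and
    "Q = mat m m (\<lambda>(i, k). if k = i then \<gamma> i else if k = 2 * n - i then \<delta> i else 0)"
  define s :: "nat \<Rightarrow> 'a" where "s i = (if i \<le> n then 1 else - 1)" for i
  define E where "E = mat_diag m s"
  define y where "y = x_mat \<pi> n l * antidiag m"
  have c: "P \<in> carrier_mat m m" "Q \<in> carrier_mat m m" "E \<in> carrier_mat m m" "y \<in> carrier_mat m m"
    "x_mat \<pi> n l \<in> carrier_mat m m"
    using x_mat_carrier[of n l] by (auto simp: P_def Q_def E_def y_def m_def)
  have PQ: "P * Q = 1\<^sub>m m"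
  proof (rule eq_matI)
    fix i k assume "i < dim_row (1\<^sub>m m :: 'a mat)" "k < dim_col (1\<^sub>m m :: 'a mat)"
    then have ik: "i < m" "k < m" "i \<le> 2 * n" "k \<le> 2 * n" by (auto simp: m_def)
    have "(P * Q) $$ (i, k) = (\<Sum>a = 0..<2 * n + 1. P $$ (i, a) * Q $$ (a, k))"
      using ik c by (simp add: scalar_prod_def m_def)
    also have "\<dots> = (if i = n then P $$ (i, n) * Q $$ (n, k)
        else P $$ (i, i) * Q $$ (i, k) + P $$ (i, 2 * n - i) * Q $$ (2 * n - i, k))"
      using ik by (intro sum_supported_on_reflected_pair) (auto simp: P_def m_def)
    also have "\<dots> = 1\<^sub>m m $$ (i, k)"
    proof (cases i n rule: linorder_cases)
      case less
      then have "P $$ (i, i) = ?d i" "P $$ (i, 2 * n - i) = ?d i"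
        "Q $$ (i, k) = (if k = i then 1 / (2 * ?d i) else if k = 2 * n - i then 1 / 2 else 0)"
        "Q $$ (2 * n - i, k) = (if k = 2 * n - i then - 1 / 2 else if k = i then 1 / (2 * ?d i) else 0)"
        using ik by (auto simp: P_def Q_def \<alpha>_def \<beta>_def \<gamma>_def \<delta>_def m_def)
      then show ?thesis using less ik by (auto simp: field_simps)
    next
      case equal
      then have "P $$ (i, n) = 1" "Q $$ (n, k) = (if k = n then 1 else 0)"
        using ik by (auto simp: P_def Q_def \<alpha>_def \<gamma>_def m_def)
      then show ?thesis using equal ik by simp
    next
      case greater
      then have "P $$ (i, i) = - 1" "P $$ (i, 2 * n - i) = 1"
        "Q $$ (i, k) = (if k = i then - 1 / 2 else if k = 2 * n - i then 1 / (2 * ?d (2 * n - i)) else 0)"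
        "Q $$ (2 * n - i, k) = (if k = 2 * n - i then 1 / (2 * ?d (2 * n - i)) else if k = i then 1 / 2 else 0)"
        using ik by (auto simp: P_def Q_def \<alpha>_def \<beta>_def \<gamma>_def \<delta>_def m_def)
      then show ?thesis using greater ik by (auto simp: field_simps)
    qed
    finally show "(P * Q) $$ (i, k) = 1\<^sub>m m $$ (i, k)" .
  qed (use c in auto)
  have yP: "y * P = P * E"
  proof (rule eq_matI)
    fix i k assume "i < dim_row (P * E)" "k < dim_col (P * E)"
    then have ik: "i < m" "k < m" "i \<le> 2 * n" "k \<le> 2 * n" using c by (auto simp: m_def)
    have JP: "antidiag m * P \<in> carrier_mat m m" using c by (auto intro!: mult_carrier_mat)
    have "(y * P) $$ (i, k) = (x_mat \<pi> n l * (antidiag m * P)) $$ (i, k)"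
      unfolding y_def using c by (subst assoc_mult_mat[of _ m m _ m _ m]) auto
    also have "\<dots> = ?d i * (antidiag m * P) $$ (i, k)"
      using JP ik unfolding m_def by (intro x_mat_mult_index)
    also have "(antidiag m * P) $$ (i, k) = P $$ (m - Suc i, k)" using c ik by (intro antidiag_mult_index)
    also have "?d i * P $$ (m - Suc i, k) = P $$ (i, k) * s k"
    proof (cases i n rule: linorder_cases)
      case less
      then show ?thesis using ik by (auto simp: P_def m_def \<alpha>_def \<beta>_def s_def)
    next
      case equal
      then show ?thesis using ik by (auto simp: P_def m_def \<alpha>_def \<beta>_def s_def x_entry_def)
    next
      case greater
      then show ?thesis using ik dr[of i] by (auto simp: P_def m_def \<alpha>_def \<beta>_def s_def)
    qed
    also have "\<dots> = (P * E) $$ (i, k)"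
      unfolding E_def using c ik by (simp add: mat_diag_mult_right[OF c(1)] mult.commute)
    finally show "(y * P) $$ (i, k) = (P * E) $$ (i, k)" .
  qed (use c in auto)
  have "y = y * (P * Q)" using PQ right_mult_one_mat[OF c(4)] by simp
  also have "\<dots> = y * P * Q" using c by (intro assoc_mult_mat[symmetric])
  finally have "y = P * E * Q" unfolding yP .
  moreover have "Q * P = 1\<^sub>m m" using mat_mult_left_right_inverse[OF c(1,2) PQ] .
  ultimately have "similar_mat y E" using PQ c by (intro similar_matI[of _ _ P Q m]) auto
  then have "char_poly y = char_poly E" by (rule char_poly_similar)
  also have "\<dots> = (\<Prod>a\<leftarrow>diag_mat E. [:- a, 1:])"
    using c(3) by (rule char_poly_upper_triangular) (auto simp: E_def mat_diag_def)
  also have "map (\<lambda>a. [:- a, 1:]) (diag_mat E) = map (\<lambda>i. [:- s i, 1:]) [0..<2 * n + 1]"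
    by (auto simp: diag_mat_def E_def mat_diag_def m_def simp del: upt_Suc)
  also have "prod_list \<dots> = (\<Prod>i<2 * n + 1. [:- s i, 1:])"
    using prod.distinct_set_conv_list[of "[0..<2 * n + 1]" "\<lambda>i. [:- s i, 1:]"]
    by (simp add: lessThan_atLeast0 del: upt_Suc)
  also have "\<dots> = ([:0, 1:] ^ 2 - 1) ^ n * ([:0, 1:] - 1)"
    unfolding s_def by (rule split_poly_eq_prod[symmetric])
  finally show ?thesis unfolding y_def m_def .
qed

lemma x_mat_in_unitary_X: "x_mat \<pi> n l \<in> unitary_X \<sigma> n"
  unfolding unitary_X_def using x_mat_unitary conj_transpose_x_mat char_poly_x_mat by blast

lemma conj_transpose_eq_adj:
  assumes "g \<in> carrier_mat m m"
  shows "conj_transpose \<sigma> g = antidiag m * adj m g * antidiag m"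
proof -
  let ?J = "antidiag m :: 'a mat" and ?c = "conj_transpose \<sigma> g"
  have c: "?c \<in> carrier_mat m m" using assms by simp
  have "?J * adj m g * ?J = (?J * ?J) * ?c * (?J * ?J)"
    unfolding adj_def using c by (simp add: assoc_mult_mat[of _ m m _ m _ m] mult_carrier_mat[of _ m m _ m] del: antidiag_mult_antidiag)
  then show ?thesis using left_mult_one_mat[OF c] right_mult_one_mat[OF c] by simp
qed

text \<open>As \<open>adj m g\<close> is the inverse of \<open>g\<close>, replacing \<open>x\<close>
  by its image under \<open>g\<close> conjugates \<open>x j\<close> by \<open>g\<close>, which keeps
  the characteristic polynomial.\<close>

lemma unitary_X_action:
  assumes x: "x \<in> unitary_X \<sigma> n" and g: "g \<in> unitary_G \<sigma> n"
  shows "g * x * conj_transpose \<sigma> g \<in> unitary_X \<sigma> n"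
proof -
  define m where "m = 2 * n + 1"
  let ?J = "antidiag m :: 'a mat" and ?c = "conj_transpose \<sigma> g"
  have c: "x \<in> carrier_mat m m" "g \<in> carrier_mat m m" "?c \<in> carrier_mat m m" "adj m g \<in> carrier_mat m m"
    using x g unfolding unitary_X_def unitary_G_iff m_def by (auto intro: adj_carrier conj_transpose_carrier)
  have xs: "conj_transpose \<sigma> x = x" "x \<in> unitary_G \<sigma> n"
    and cp: "char_poly (x * ?J) = ([:0, 1:] ^ 2 - 1) ^ n * ([:0, 1:] - 1)"
    using x unfolding unitary_X_def m_def by auto
  have inv: "g * adj m g = 1\<^sub>m m" "adj m g * g = 1\<^sub>m m"
    using g unitary_G_inverse[OF g] unfolding unitary_G_iff m_def by auto
  have herm: "conj_transpose \<sigma> (g * x * ?c) = g * x * ?c"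
    using c xs(1) by (simp add: conj_transpose_mult[of _ m m _ m] mult_carrier_mat[of _ m m _ m] assoc_mult_mat[of _ m m _ m _ m])
  have J: "?J \<in> unitary_G \<sigma> n"
  proof -
    have "adj m ?J = ?J" unfolding adj_def using left_mult_one_mat[of ?J m m] by simp
    then show ?thesis unfolding unitary_G_iff m_def[symmetric] by simp
  qed
  have "?J * adj m g * ?J \<in> unitary_G \<sigma> n"
    using J adj_unitary_G[OF g] unfolding m_def by (intro mult_unitary_G)
  then have "?c \<in> unitary_G \<sigma> n" using conj_transpose_eq_adj[OF c(2)] by simp
  then have G: "g * x * ?c \<in> unitary_G \<sigma> n" using g xs(2) by (intro mult_unitary_G)
  have eq: "g * x * ?c * ?J = g * (x * ?J) * adj m g"
  proof -
    have "g * x * ?c * ?J = g * x * (?J * ?J) * ?c * ?J"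
      using c right_mult_one_mat[of "g * x" m m] mult_carrier_mat[of g m m x m] by simp
    also have "\<dots> = g * (x * ?J) * adj m g"
      unfolding adj_def using c by (simp add: assoc_mult_mat[of _ m m _ m _ m] mult_carrier_mat[of _ m m _ m] del: antidiag_mult_antidiag)
    finally show ?thesis .
  qed
  have "similar_mat (g * x * ?c * ?J) (x * ?J)"
    by (rule similar_matI[of _ _ g "adj m g" m, OF _ inv eq]) (use c in \<open>auto intro!: mult_carrier_mat\<close>)
  then have "char_poly (g * x * ?c * ?J) = char_poly (x * ?J)" by (rule char_poly_similar)
  then show ?thesis using G herm cp unfolding unitary_X_def m_def by auto
qed

section \<open>Uniqueness of the exponents\<close>

lemma v_x_entry_le:
  assumes "l \<in> Lambda_plus n" "r < n" "i \<le> r"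
  shows "v (x_entry n l i) \<le> v \<pi> powi (l $ r)"
proof -
  have "l $ r \<le> l $ i" using assms unfolding Lambda_plus_def by auto
  then have "v \<pi> powi (l $ i) \<le> v \<pi> powi (l $ r)" using v_pi_less_1 by (intro power_int_decreasing) auto
  then show ?thesis using assms by (simp add: x_entry_def v_powi)
qed

text \<open>From index \<open>n\<close> on the exponents of \<pi> are at most 0, hence at most
  \<open>l $ r\<close>: this is where nonnegativity of \<open>l\<close> matters.\<close>

lemma v_x_entry_ge:
  assumes "l \<in> Lambda_plus n" "r < n" "r \<le> i" "i < 2 * n + 1"
  shows "v \<pi> powi (l $ r) \<le> v (x_entry n l i)"
proof -
  have nonneg: "0 \<le> l $ j" if "j < n" for j using assms(1) that unfolding Lambda_plus_def by auto
  have mono: "v \<pi> powi a \<le> v \<pi> powi b" if "b \<le> a" for a b :: int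
    using that v_pi_less_1 by (intro power_int_decreasing) auto
  consider "i < n" | "i = n" | "n < i" by linarith
  then show ?thesis
  proof cases
    case 1
    then have "l $ i \<le> l $ r" using assms unfolding Lambda_plus_def by auto
    then show ?thesis using 1 mono by (simp add: x_entry_def v_powi)
  next
    case 2
    then show ?thesis using mono[of 0 "l $ r"] nonneg[OF assms(2)] by (simp add: x_entry_def)
  next
    case 3
    then have "2 * n - i < n" using assms by auto
    then have "- (l $ (2 * n - i)) \<le> l $ r" using nonneg[of "2 * n - i"] nonneg[OF assms(2)] by simp
    from mono[OF this] show ?thesis using 3 by (simp add: x_entry_def v_powi)
  qed
qed

text \<open>\<open>det g\<close> and the determinant of the inverse \<open>adj (2 * n + 1) g\<close>
  are both integral.\<close>

lemma v_det_unitary_K: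
  assumes g: "g \<in> unitary_K v \<sigma> n"
  shows "v (det g) = 1"
proof -
  let ?m = "2 * n + 1"
  have le: "v (det g') \<le> 1" if "g' \<in> unitary_K v \<sigma> n" for g'
    using that unfolding unitary_K_iff unitary_G_iff by (intro v_det_le_1[of _ ?m]) auto
  have "g \<in> carrier_mat ?m ?m" "g * adj ?m g = 1\<^sub>m ?m" using g unfolding unitary_K_iff unitary_G_iff by auto
  then have "v (det g) * v (det (adj ?m g)) = 1"
    using det_mult[of g ?m "adj ?m g"] adj_carrier[of g ?m] by (simp flip: v_mult)
  moreover have "v (det g) * v (det (adj ?m g)) \<le> v (det g) * 1"
    using le[OF adj_unitary_K[OF g]] by (intro mult_left_mono) auto
  ultimately show ?thesis using le[OF g] by simp
qed

text \<open>By \<open>g^* j g = j\<close> the equation becomes linear in \<open>g\<close>: each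
  entry of \<open>g\<close> at \<open>i\<close>, \<open>j\<close> is the reflected entry times
  \<open>x_entry n l' i / x_entry n l j\<close>. For \<open>i \<le> r \<le> j\<close> this factor is
  small if \<open>l $ r < l' $ r\<close>, so \<open>r + 1\<close> rows are left with only
  \<open>r\<close> columns modulo \<pi>.\<close>

lemma exponent_le_of_orbit:
  fixes l l' :: "int vec"
  assumes g: "g \<in> unitary_K v \<sigma> n" and l: "l \<in> Lambda_plus n" and l': "l' \<in> Lambda_plus n"
    and eq: "g * x_mat \<pi> n l * conj_transpose \<sigma> g = x_mat \<pi> n l'" and r: "r < n"
  shows "l' $ r \<le> l $ r"
proof (rule ccontr)
  assume "\<not> l' $ r \<le> l $ r"
  then have less: "v \<pi> powi (l' $ r) < v \<pi> powi (l $ r)"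
    using v_pi_less_1 by (intro power_int_strict_decreasing) auto
  define m where "m = 2 * n + 1"
  let ?J = "antidiag m :: 'a mat" and ?x = "x_mat \<pi> n l" and ?x' = "x_mat \<pi> n l'"
  have c: "g \<in> carrier_mat m m" "conj_transpose \<sigma> g \<in> carrier_mat m m" "?x \<in> carrier_mat m m" "?x' \<in> carrier_mat m m"
    "?J \<in> carrier_mat m m"
    and u: "conj_transpose \<sigma> g * ?J * g = ?J"
    using g x_mat_carrier[of n] unfolding unitary_K_def unitary_G_def m_def by (auto intro: conj_transpose_carrier)
  have gi: "v (g $$ (i, j)) \<le> 1" if "i < m" "j < m" for i j using g that unfolding unitary_K_iff m_def by auto
  have "g * ?x * ?J = g * ?x * (conj_transpose \<sigma> g * ?J * g)" using u by simp
  also have "\<dots> = (g * ?x * conj_transpose \<sigma> g) * (?J * g)"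
    using c by (simp add: assoc_mult_mat[of _ m m _ m _ m] mult_carrier_mat[of _ m m _ m])
  finally have main: "g * ?x * ?J = ?x' * (?J * g)" unfolding eq .
  have entry: "g $$ (i, m - Suc j) * x_entry n l (m - Suc j) = x_entry n l' i * g $$ (m - Suc i, j)"
    if "i < m" "j < m" for i j
  proof -
    have "(g * ?x * ?J) $$ (i, j) = (g * ?x) $$ (i, m - Suc j)"
      using mult_antidiag_index[OF mult_carrier_mat[OF c(1,3)]] that .
    also have "\<dots> = g $$ (i, m - Suc j) * x_entry n l (m - Suc j)"
      using c(1) that unfolding m_def by (intro mult_x_mat_index) auto
    finally have 1: "(g * ?x * ?J) $$ (i, j) = g $$ (i, m - Suc j) * x_entry n l (m - Suc j)" .
    have "(?x' * (?J * g)) $$ (i, j) = x_entry n l' i * (?J * g) $$ (i, j)"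
      using c that unfolding m_def by (intro x_mat_mult_index mult_carrier_mat)
    also have "(?J * g) $$ (i, j) = g $$ (m - Suc i, j)" using c that by (intro antidiag_mult_index)
    finally show ?thesis using 1 main by simp
  qed
  have "v (g $$ (i, j)) < 1" if ij: "i \<le> r" "r \<le> j" "j < m" for i j
  proof -
    have im: "i < m" "m - Suc j < m" "m - Suc (m - Suc j) = j" "m - Suc i < m" using ij r by (auto simp: m_def)
    have "v (g $$ (i, j)) * v (x_entry n l j) = v (x_entry n l' i) * v (g $$ (m - Suc i, m - Suc j))"
      using entry[OF im(1,2)] im(3) by (metis v_mult)
    also have "\<dots> \<le> v (x_entry n l' i) * 1" using gi im by (intro mult_left_mono) auto
    also have "\<dots> \<le> v \<pi> powi (l' $ r)" using v_x_entry_le[OF l' r ij(1)] by simp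
    also have "\<dots> < v \<pi> powi (l $ r)" by (rule less)
    also have "\<dots> \<le> v (x_entry n l j)" using v_x_entry_ge[OF l r ij(2)] ij(3) by (simp add: m_def)
    finally show ?thesis by simp
  qed
  then have "v (det g) < 1" using c(1) gi r by (intro v_det_less_1[of g m r]) (auto simp: m_def)
  then show False using v_det_unitary_K[OF g] by simp
qed

lemma x_mat_orbit_unique:
  fixes l l' :: "int vec"
  assumes l: "l \<in> Lambda_plus n" and l': "l' \<in> Lambda_plus n"
    and x: "x \<in> K_orbit v \<sigma> n (x_mat \<pi> n l)" "x \<in> K_orbit v \<sigma> n (x_mat \<pi> n l')"
  shows "l = l'"
proof -
  define m where "m = 2 * n + 1"
  have le: "b $ r \<le> a $ r"
    if ab: "a \<in> Lambda_plus n" "b \<in> Lambda_plus n" "r < n"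
       "x \<in> K_orbit v \<sigma> n (x_mat \<pi> n a)" "x \<in> K_orbit v \<sigma> n (x_mat \<pi> n b)" for a b :: "int vec" and r
  proof -
    obtain g g' where g: "g \<in> unitary_K v \<sigma> n" "x = g * x_mat \<pi> n a * conj_transpose \<sigma> g"
      and g': "g' \<in> unitary_K v \<sigma> n" "x = g' * x_mat \<pi> n b * conj_transpose \<sigma> g'"
      using ab(4,5) unfolding K_orbit_def by blast
    \<comment> \<open>\<open>k\<close> is the inverse of \<open>g'\<close>, so \<open>k * g\<close>
      carries \<open>x_mat \<pi> n a\<close> to \<open>x_mat \<pi> n b\<close>.\<close>
    define k where "k = adj m g'"
    have kK: "k \<in> unitary_K v \<sigma> n" unfolding k_def m_def using g'(1) by (rule adj_unitary_K)
    have c: "g \<in> carrier_mat m m" "g' \<in> carrier_mat m m" "k \<in> carrier_mat m m"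
      "x_mat \<pi> n a \<in> carrier_mat m m" "x_mat \<pi> n b \<in> carrier_mat m m"
      using g(1) g'(1) kK x_mat_carrier[of n] unfolding unitary_K_iff unitary_G_iff m_def by blast+
    have kg: "k * g' = 1\<^sub>m m"
      using g'(1) unitary_G_inverse unfolding k_def m_def unitary_K_iff by blast
    have cc: "conj_transpose \<sigma> g \<in> carrier_mat m m" "conj_transpose \<sigma> g' \<in> carrier_mat m m" "conj_transpose \<sigma> k \<in> carrier_mat m m"
      using c by auto
    have "conj_transpose \<sigma> g' * conj_transpose \<sigma> k = 1\<^sub>m m"
      using conj_transpose_mult[OF c(3,2)] kg by simp
    then have "x_mat \<pi> n b = (k * g') * x_mat \<pi> n b * (conj_transpose \<sigma> g' * conj_transpose \<sigma> k)"
      using kg left_mult_one_mat[OF c(5)] right_mult_one_mat[OF c(5)] by simp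
    also have "\<dots> = k * (g' * x_mat \<pi> n b * conj_transpose \<sigma> g') * conj_transpose \<sigma> k"
      using c cc by (simp add: assoc_mult_mat[of _ m m _ m _ m] mult_carrier_mat[of _ m m _ m])
    also have "\<dots> = k * (g * x_mat \<pi> n a * conj_transpose \<sigma> g) * conj_transpose \<sigma> k"
      using g(2) g'(2) by simp
    also have "\<dots> = (k * g) * x_mat \<pi> n a * conj_transpose \<sigma> (k * g)"
      using c cc by (simp add: conj_transpose_mult[OF c(3,1)] assoc_mult_mat[of _ m m _ m _ m] mult_carrier_mat[of _ m m _ m])
    finally have "(k * g) * x_mat \<pi> n a * conj_transpose \<sigma> (k * g) = x_mat \<pi> n b" by simp
    then show ?thesis using exponent_le_of_orbit[OF mult_unitary_K[OF kK g(1)] ab(1,2)] ab(3) by blast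
  qed
  show ?thesis
  proof (rule eq_vecI)
    show "l $ r = l' $ r" if "r < dim_vec l'" for r
      using that le[OF l l' _ x] le[OF l' l _ x(2,1)] l' unfolding Lambda_plus_def by force
  qed (use l l' in \<open>auto simp: Lambda_plus_def\<close>)
qed

end

section \<open>Orbits\<close>

lemma sum_reflect: "(\<Sum>i<2 * n + 1. g (2 * n - i)) = (\<Sum>i<2 * n + 1. g i)"
  for g :: "nat \<Rightarrow> 'a::comm_monoid_add"
  using sum.nat_diff_reindex[of g "2 * n + 1"] by simp

lemma mult_mat_index_sum:
  assumes "A \<in> carrier_mat l m" "B \<in> carrier_mat m r" "i < l" "j < r"
  shows "(A * B) $$ (i, j) = (\<Sum>a<m. A $$ (i, a) * B $$ (a, j))"
  using assms by (simp add: scalar_prod_def lessThan_atLeast0)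

text \<open>The abstract setting is realised on functions of a natural number, whose coordinates
  below \<open>N\<close> form the row vectors; this avoids a type of vectors depending on
  \<open>n\<close>. The rows of \<open>g\<close> are the \<open>e i\<close>, then \<open>z\<close>,
  then the \<open>f i\<close> in descending order.\<close>

lemma exists_adapted_unitary_K:
  fixes v :: "'a::field_char_0 \<Rightarrow> real"
  assumes "hermitian_field v \<sigma> \<pi>" and x: "x \<in> unitary_X \<sigma> n"
  shows "\<exists>l\<in>Lambda_plus n. \<exists>g\<in>unitary_K v \<sigma> n. g * x * conj_transpose \<sigma> g = x_mat \<pi> n l"
proof -
  interpret hermitian_field v \<sigma> \<pi> by fact
  define N where "N = 2 * n + 1"
  have N: "i < N \<Longrightarrow> 2 * n - i < N" "i < N \<Longrightarrow> 2 * n - (2 * n - i) = i" "N - Suc i = 2 * n - i" for i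
    by (auto simp: N_def)
  have reflect: "(\<Sum>i<N. g (2 * n - i)) = (\<Sum>i<N. g i)" for g :: "nat \<Rightarrow> 'a"
    unfolding N_def by (rule sum_reflect)
  define Y where "Y i j = x $$ (i, j)" for i j
  have xc: "x \<in> carrier_mat N N" and xu: "x * adj N x = 1\<^sub>m N" and xh: "conj_transpose \<sigma> x = x"
    and cp: "char_poly (x * antidiag N) = ([:0, 1:] ^ 2 - 1) ^ n * ([:0, 1:] - 1)"
    using x unfolding unitary_X_def unitary_G_iff N_def by auto
  have Y_conj: "\<sigma> (Y i j) = Y j i" if "i < N" "j < N" for i j
    using arg_cong[OF xh, of "\<lambda>A. A $$ (j, i)"] xc that by (simp add: Y_def conj_transpose_index)
  \<comment> \<open>Since \<open>x\<close> is hermitian, the entries of \<open>adj N x\<close> are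
    reflected entries of \<open>x\<close>, and \<open>x * adj N x = 1\<close> turns into the
    statement that \<open>T\<close> is an involution.\<close>
  have Y_inv: "(\<Sum>i<N. Y a (2 * n - i) * Y i (2 * n - j)) = (if a = j then 1 else 0)" if aj: "a < N" "j < N" for a j
  proof -
    have "(if a = j then 1 else 0) = (x * adj N x) $$ (a, j)" unfolding xu using aj by simp
    also have "\<dots> = (\<Sum>i<N. Y a i * adj N x $$ (i, j))"
      using xc aj by (simp add: scalar_prod_def Y_def lessThan_atLeast0)
    also have "\<dots> = (\<Sum>i<N. Y a i * Y (2 * n - i) (2 * n - j))"
    proof (rule sum.cong)
      fix i assume "i \<in> {..<N}"
      then have "adj N x $$ (i, j) = \<sigma> (Y (2 * n - j) (2 * n - i))" using xc aj by (simp add: adj_index Y_def N)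
      then show "Y a i * adj N x $$ (i, j) = Y a i * Y (2 * n - i) (2 * n - j)"
        using \<open>i \<in> {..<N}\<close> aj Y_conj N by simp
    qed simp
    also have "\<dots> = (\<Sum>i<N. Y a (2 * n - i) * Y (2 * n - (2 * n - i)) (2 * n - j))"
      by (rule reflect[symmetric])
    also have "\<dots> = (\<Sum>i<N. Y a (2 * n - i) * Y i (2 * n - j))" by (rule sum.cong) (auto simp: N)
    finally show ?thesis by simp
  qed
  \<comment> \<open>The trace of x j is the sum of the prescribed roots, \<open>n + 1\<close> times
    1 and \<open>n\<close> times -1.\<close>
  have Y_trace: "(\<Sum>i<N. Y i (2 * n - i)) = 1"
  proof -
    have "x * antidiag N \<in> carrier_mat (Suc (2 * n)) (Suc (2 * n))" using xc by (auto simp: N_def)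
    from coeff_char_poly[OF this]
    have "- (\<Sum>i<N. (x * antidiag N) $$ (i, i)) = coeff (([:0, 1:] ^ 2 - 1) ^ n * ([:0, 1:] - 1 :: 'a poly)) (2 * n)"
      unfolding cp by (simp add: N_def)
    also have "\<dots> = - (\<Sum>i<Suc (2 * n). if i \<le> n then 1 else - 1)"
      unfolding split_poly_eq_prod using coeff_prod_linear[of "\<lambda>i. if i \<le> n then 1 else - 1 :: 'a" "2 * n"] by simp
    also have "(\<Sum>i<Suc (2 * n). if i \<le> n then 1 else - 1 :: 'a) = 1"
    proof -
      have S: "{..<Suc (2 * n)} = {..<Suc n} \<union> {Suc n..<Suc (2 * n)}" by auto
      have "(\<Sum>i<Suc (2 * n). if i \<le> n then 1 else - 1 :: 'a)
        = (\<Sum>i<Suc n. if i \<le> n then 1 else - 1) + (\<Sum>i = Suc n..<Suc (2 * n). if i \<le> n then 1 else - 1)"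
        unfolding S by (rule sum.union_disjoint) auto
      also have "(\<Sum>i<Suc n. if i \<le> n then 1 else - 1 :: 'a) = (\<Sum>i<Suc n. 1)" by (rule sum.cong) auto
      also have "(\<Sum>i = Suc n..<Suc (2 * n). if i \<le> n then 1 else - 1 :: 'a) = (\<Sum>i = Suc n..<Suc (2 * n). - 1)"
        by (rule sum.cong) auto
      finally show ?thesis by simp
    qed
    finally have "(\<Sum>i<N. (x * antidiag N) $$ (i, i)) = 1" by (simp only: neg_equal_iff_equal)
    moreover have "(x * antidiag N) $$ (i, i) = Y i (2 * n - i)" if "i < N" for i
      using mult_antidiag_index[OF xc that that] by (simp add: Y_def N)
    ultimately show ?thesis by simp
  qed
  define scale where "scale c u = (\<lambda>i. c * u i)" for c :: 'a and u :: "nat \<Rightarrow> 'a"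
  define h where "h u w = (\<Sum>i<N. u i * \<sigma> (w (2 * n - i)))" for u w :: "nat \<Rightarrow> 'a"
  text \<open>Only the coordinates below \<open>N\<close> matter; \<open>T\<close> fixes the others so that it is an involution on all functions.\<close>
  define T where "T u j = (if j < N then \<Sum>i<N. u i * Y i (2 * n - j) else u j)" for u :: "nat \<Rightarrow> 'a" and j
  define L where "L = {u :: nat \<Rightarrow> 'a. \<forall>i<N. v (u i) \<le> 1}"
  \<comment> \<open>The standard basis. Pairing with \<open>\<delta> (2 * n - i)\<close> reads off
    the coordinate \<open>i\<close>, which makes \<open>L\<close> self-dual and \<open>tr\<close>
    depend only on values of \<open>h\<close>.\<close>
  define \<delta> :: "nat \<Rightarrow> nat \<Rightarrow> 'a" where "\<delta> i j = (if j = i then 1 else 0)" for i j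
  define tr where "tr F = (\<Sum>i<N. F (\<delta> i) i)" for F :: "(nat \<Rightarrow> 'a) \<Rightarrow> nat \<Rightarrow> 'a"
  have h_delta: "h u (\<delta> (2 * n - i)) = u i" if "i < N" for u i
  proof -
    have "h u (\<delta> (2 * n - i)) = (\<Sum>j<N. if j = i then u j else 0)"
      unfolding h_def using that by (intro sum.cong) (auto simp: \<delta>_def N_def)
    then show ?thesis using that by simp
  qed
  have delta_h: "h (\<delta> i) w = \<sigma> (w (2 * n - i))" if "i < N" for w i
  proof -
    have "h (\<delta> i) w = (\<Sum>j<N. if j = i then \<sigma> (w (2 * n - j)) else 0)"
      unfolding h_def by (intro sum.cong) (auto simp: \<delta>_def)
    then show ?thesis using that by simp
  qed
  have hT: "h (T u) w = (\<Sum>i<N. \<Sum>j<N. u i * Y i j * \<sigma> (w j))" for u w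
  proof -
    have "h (T u) w = (\<Sum>j<N. \<Sum>i<N. u i * Y i (2 * n - j) * \<sigma> (w (2 * n - j)))"
      unfolding h_def T_def by (simp add: sum_distrib_right)
    also have "\<dots> = (\<Sum>j<N. \<Sum>i<N. u i * Y i j * \<sigma> (w j))" by (rule reflect)
    also have "\<dots> = (\<Sum>i<N. \<Sum>j<N. u i * Y i j * \<sigma> (w j))" by (rule sum.swap)
    finally show ?thesis .
  qed
  have h_conj': "\<sigma> (h u w) = h w u" for u w
  proof -
    have "\<sigma> (h u w) = (\<Sum>i<N. w (2 * n - i) * \<sigma> (u i))" unfolding h_def conj_sum by (simp add: conj_mult mult.commute)
    also have "\<dots> = (\<Sum>i<N. w (2 * n - (2 * n - i)) * \<sigma> (u (2 * n - i)))" by (rule reflect[symmetric])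
    also have "\<dots> = h w u" unfolding h_def by (rule sum.cong) (auto simp: N)
    finally show ?thesis .
  qed
  have T_T': "T (T u) = u" for u
  proof
    fix j
    show "T (T u) j = u j"
    proof (cases "j < N")
      case True
      have "T (T u) j = (\<Sum>i<N. \<Sum>a<N. u a * Y a (2 * n - i) * Y i (2 * n - j))"
        using True unfolding T_def by (simp add: sum_distrib_right)
      also have "\<dots> = (\<Sum>a<N. \<Sum>i<N. u a * Y a (2 * n - i) * Y i (2 * n - j))" by (rule sum.swap)
      also have "\<dots> = (\<Sum>a<N. u a * (\<Sum>i<N. Y a (2 * n - i) * Y i (2 * n - j)))"
        by (simp add: sum_distrib_left mult.assoc)
      also have "\<dots> = (\<Sum>a<N. if a = j then u a else 0)" using True by (intro sum.cong) (auto simp: Y_inv)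
      finally show ?thesis using True by simp
    qed (simp add: T_def)
  qed
  have h_ext: "u i = w i" if "\<And>y. h u y = h w y" "i < N" for u w i
    using h_delta[OF that(2)] that(1) by metis
  interpret W: hermitian_lattice_trace v \<sigma> \<pi> scale h T L tr n
  proof (unfold_locales, goal_cases)
    case (1 a x y) then show ?case by (simp add: scale_def fun_eq_iff algebra_simps)
  next
    case (2 a b x) then show ?case by (simp add: scale_def fun_eq_iff algebra_simps)
  next
    case (3 a b x) then show ?case by (simp add: scale_def fun_eq_iff algebra_simps)
  next
    case (4 x) then show ?case by (simp add: scale_def)
  next
    case (5 u u' w) then show ?case by (simp add: h_def sum.distrib algebra_simps)
  next
    case (6 c u w) then show ?case by (simp add: h_def scale_def sum_distrib_left mult.assoc)
  next
    case (7 u w) then show ?case by (rule h_conj')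
  next
    case (8 u w) then show ?case by (simp add: T_def fun_eq_iff sum.distrib algebra_simps)
  next
    case (9 c u) then show ?case by (simp add: T_def fun_eq_iff scale_def sum_distrib_left mult.assoc)
  next
    case (10 u) then show ?case by (rule T_T')
  next
    case (11 u w)
    have "h u (T w) = \<sigma> (h (T w) u)" by (simp add: h_conj')
    also have "\<dots> = (\<Sum>i<N. \<Sum>j<N. \<sigma> (w i) * \<sigma> (Y i j) * u j)" unfolding hT conj_sum by (simp add: conj_mult)
    also have "\<dots> = (\<Sum>i<N. \<Sum>j<N. \<sigma> (w i) * Y j i * u j)" by (intro sum.cong refl) (simp add: Y_conj)
    also have "\<dots> = (\<Sum>j<N. \<Sum>i<N. \<sigma> (w i) * Y j i * u j)" by (rule sum.swap)
    also have "\<dots> = h (T u) w" unfolding hT by (intro sum.cong refl) (simp add: mult_ac)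
    finally show ?case by simp
  next
    case (12 u w) then show ?case by (auto simp: L_def intro: v_add_le)
  next
    case (13 c u) then show ?case by (auto simp: L_def scale_def intro: v_mult_le_1)
  next
    case (14 u w) then show ?case unfolding h_def by (intro v_sum_le) (auto simp: L_def N_def intro!: v_mult_le_1)
  next
    case (15 u)
    have "v (u i) \<le> 1" if "i < N" for i
      using 15[of "\<delta> (2 * n - i)"] h_delta[OF that, of u] by (auto simp: L_def \<delta>_def)
    then show ?case by (simp add: L_def)
  next
    case (16 u)
    show ?case
    proof (cases "\<exists>i<N. u i \<noteq> 0")
      case True
      then obtain i0 where i0: "i0 < N" "u i0 \<noteq> 0" by blast
      have bnd: "v a \<le> (\<Sum>i<N. v (u i))" if "a \<in> u ` {..<N}" for a
        using that by (auto intro!: member_le_sum)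
      obtain a where a: "a \<noteq> 0" "\<forall>a'\<in>u ` {..<N}. v a' \<le> v a"
        using exists_max_value[of "u i0" "u ` {..<N}", OF _ i0(2) bnd] i0(1) by blast
      then have "scale (inverse a) u \<in> L"
        by (auto simp: L_def scale_def v_mult v_inverse v_divide field_simps)
      then show ?thesis using a(1) by (intro exI[of _ "inverse a"]) simp
    next
      case False
      then show ?thesis by (intro exI[of _ 1]) (auto simp: L_def scale_def)
    qed
  next
    case 17
    define M where "M = (\<Sum>i<N. \<Sum>j<N. v (Y i j))"
    have XM: "v (Y i j) \<le> M" if "i < N" "j < N" for i j
    proof -
      have "v (Y i j) \<le> (\<Sum>j<N. v (Y i j))" using that by (intro member_le_sum) auto
      also have "\<dots> \<le> M" unfolding M_def using that by (intro member_le_sum) (auto intro: sum_nonneg)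
      finally show ?thesis .
    qed
    have "v (u i * Y i j * \<sigma> (w j)) \<le> M" if "u \<in> L" "w \<in> L" "i < N" "j < N" for u w i j
    proof -
      have "v (u i) * v (Y i j) * v (w j) \<le> 1 * M * 1"
        using that XM[OF that(3,4)] by (intro mult_mono) (auto simp: L_def M_def intro!: sum_nonneg)
      then show ?thesis by (simp add: v_mult)
    qed
    moreover have "0 \<le> M" unfolding M_def by (intro sum_nonneg) auto
    ultimately have "v (h (T u) w) \<le> M" if "u \<in> L" "w \<in> L" for u w
      unfolding hT using that by (intro v_sum_le) auto
    then show ?case by blast
  next
    case (18 F y x)
    have "tr (\<lambda>u. F u - scale (h u y) x) = (\<Sum>i<N. F (\<delta> i) i - \<sigma> (y (2 * n - i)) * x i)"
      unfolding tr_def by (intro sum.cong refl) (simp add: scale_def delta_h)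
    then show ?case by (simp add: tr_def h_def sum_subtractf mult.commute)
  next
    case (19 F G)
    have "F (\<delta> i) i = G (\<delta> i) i" if "i < N" for i using h_ext[OF 19 that] .
    then show ?case by (simp add: tr_def)
  next
    case (20 c F) then show ?case by (simp add: tr_def scale_def sum_distrib_left)
  next
    case 21 then show ?case by (simp add: tr_def \<delta>_def N_def)
  next
    case 22
    have "T (\<delta> j) j = Y j (2 * n - j)" if "j < N" for j
    proof -
      have "T (\<delta> j) j = (\<Sum>i<N. if i = j then Y i (2 * n - j) else 0)"
        unfolding T_def if_P[OF that] by (rule sum.cong) (simp_all add: \<delta>_def)
      then show ?thesis using that by simp
    qed
    then show ?case using Y_trace by (simp add: tr_def)
  next
    case (23 r e f)
    note fam = 23
    show ?case
    proof (rule ccontr)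
      assume "\<not> r \<le> n"
      then have nr: "n < r" by simp
      \<comment> \<open>If \<open>n < r\<close>, the \<open>N\<close> vectors
        \<open>e 0, ..., e n, f 0, ..., f (n - 1)\<close> have the dual family \<open>R'\<close> and
        so form a basis. As \<open>e n\<close> is orthogonal to all of them, its coordinates vanish,
        against \<open>h (f n) (e n) = 1\<close>.\<close>
      define R where "R i = (if i \<le> n then e i else f (i - Suc n))" for i
      define R' where "R' i = (if i \<le> n then f i else e (i - Suc n))" for i
      have fe: "h (f i) (e j) = (if i = j then 1 else 0)" if "i < r" "j < r" for i j
        using fam[OF that(2,1)] h_conj'[of "e j" "f i"] by (auto split: if_splits)
      have RR: "(\<Sum>a<N. R i a * \<sigma> (R' j (2 * n - a))) = (if i = j then 1 else 0)" if "i < N" "j < N" for i j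
      proof -
        have "h (R i) (R' j) = (if i = j then 1 else 0)"
          using that nr fam fe by (auto simp: R_def R'_def N_def)
        then show ?thesis by (simp add: h_def)
      qed
      have R0: "(\<Sum>b<N. R i b * \<sigma> (e n (2 * n - b))) = 0" if "i < N" for i
      proof -
        have "h (R i) (e n) = 0" using that nr fam fe by (auto simp: R_def N_def)
        then show ?thesis by (simp add: h_def)
      qed
      have zero: "\<sigma> (e n (2 * n - a)) = 0" if "a < N" for a
      proof -
        have "\<sigma> (e n (2 * n - a)) = (\<Sum>b<N. if a = b then \<sigma> (e n (2 * n - b)) else 0)" using that by simp
        also have "\<dots> = (\<Sum>b<N. (if a = b then 1 else 0) * \<sigma> (e n (2 * n - b)))"
          by (intro sum.cong) auto
        \<comment> \<open>The Kronecker symbol is expanded by duality in the order that, after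
          exchanging the sums, leaves the pairings of \<open>R i\<close> with
          \<open>e n\<close>.\<close>
        also have "\<dots> = (\<Sum>b<N. (\<Sum>i<N. \<sigma> (R' i (2 * n - a)) * R i b) * \<sigma> (e n (2 * n - b)))"
          using sum_product_inverse_commute[of N R "\<lambda>a j. \<sigma> (R' j (2 * n - a))", OF RR that] by simp
        also have "\<dots> = (\<Sum>b<N. \<Sum>i<N. \<sigma> (R' i (2 * n - a)) * (R i b * \<sigma> (e n (2 * n - b))))"
          by (simp add: sum_distrib_right mult.assoc)
        also have "\<dots> = (\<Sum>i<N. \<Sum>b<N. \<sigma> (R' i (2 * n - a)) * (R i b * \<sigma> (e n (2 * n - b))))" by (rule sum.swap)
        also have "\<dots> = 0" using R0 by (simp flip: sum_distrib_left)
        finally show ?thesis .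
      qed
      have "h (f n) (e n) = 0" unfolding h_def using zero by simp
      then show False using fe nr by simp
    qed
  qed
  obtain e f l z where gram: "\<And>i j. i < n \<Longrightarrow> j < n \<Longrightarrow>
      h (e i) (e j) = 0 \<and> h (f i) (f j) = 0 \<and> h (e i) (f j) = (if i = j then 1 else 0)"
    and ef: "\<And>i. i < n \<Longrightarrow> e i \<in> L \<and> f i \<in> L \<and> T (e i) = scale (\<pi> powi l i) (f i) \<and> 0 \<le> l i"
    and l: "\<And>i j. i \<le> j \<Longrightarrow> j < n \<Longrightarrow> l j \<le> l i"
    and z: "z \<in> L" "h z z = 1" "\<And>i. i < n \<Longrightarrow> h z (e i) = 0 \<and> h z (f i) = 0" "\<And>w. h (T z) w = h z w"
    using W.adapted_basis by blast
  have fe: "h (f i) (e j) = (if i = j then 1 else 0)" if "i < n" "j < n" for i j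
    using gram[OF that(2,1)] h_conj'[of "e j" "f i"] by (auto split: if_splits)
  have z': "h (e i) z = 0" "h (f i) z = 0" if "i < n" for i
    using z(3)[OF that] h_conj' conj_0 by metis+
  have Tf: "T (f i) = scale (\<pi> powi (- l i)) (e i)" if "i < n" for i
  proof -
    have "e i = scale (\<pi> powi l i) (T (f i))" using W.T_T[of "e i"] ef[OF that] W.T_scale by metis
    then show ?thesis by (simp add: scale_def fun_eq_iff power_int_minus)
  qed
  define lv where "lv = vec n l"
  have lv: "lv \<in> Lambda_plus n" using ef l by (auto simp: lv_def Lambda_plus_def)
  \<comment> \<open>The descending order of the \<open>f i\<close> turns the hyperbolic relations
    into the Gram matrix j.\<close>
  define R where "R i = (if i < n then e i else if i = n then z else f (2 * n - i))" for i
  define g where "g = mat N N (\<lambda>(i, a). R i a)"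
  have gc: "g \<in> carrier_mat N N" by (simp add: g_def)
  have hR: "h (R i) (R j) = (if j = 2 * n - i then 1 else 0)" if "i < N" "j < N" for i j
    using that gram fe z z' by (auto simp: R_def N_def)
  have hTR: "h (T (R i)) (R j) = (if i = j then x_entry n lv i else 0)" if ij: "i < N" "j < N" for i j
  proof -
    consider "i < n" | "i = n" | "n < i" by linarith
    then show ?thesis
    proof cases
      case 1
      then have "T (R i) = scale (\<pi> powi l i) (f i)" using ef by (simp add: R_def)
      then have "h (T (R i)) (R j) = \<pi> powi l i * h (f i) (R j)" by (simp add: W.h_scale_left)
      also have "h (f i) (R j) = (if i = j then 1 else 0)"
        using 1 that gram fe z' by (auto simp: R_def N_def)
      finally show ?thesis using 1 by (simp add: x_entry_def lv_def)
    next
      case 2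
      then have "h (T (R i)) (R j) = h z (R j)" by (simp add: R_def z(4))
      also have "\<dots> = (if i = j then 1 else 0)" using 2 that z by (auto simp: R_def N_def)
      finally show ?thesis using 2 by (simp add: x_entry_def)
    next
      case 3
      define i' where "i' = 2 * n - i"
      have i': "i' < n" "i = 2 * n - i'" using 3 that by (auto simp: i'_def N_def)
      have "T (R i) = scale (\<pi> powi (- l i')) (e i')" using 3 Tf[OF i'(1)] by (simp add: R_def i'_def)
      then have "h (T (R i)) (R j) = \<pi> powi (- l i') * h (e i') (R j)" by (simp add: W.h_scale_left)
      moreover have "h (e i') (R j) = (if i = j then 1 else 0)"
      proof -
        consider "j < n" | "j = n" | "n < j" "2 * n - j < n" "(i' = 2 * n - j) = (i = j)"
          using ij 3 unfolding N_def i'_def by linarith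
        then show ?thesis using gram z' i'(1) 3 by cases (auto simp: R_def)
      qed
      moreover have "x_entry n lv i = \<pi> powi (- l i')"
        using 3 i'(1) by (simp add: x_entry_def lv_def i'_def)
      ultimately show ?thesis by auto
    qed
  qed
  have gu: "g * adj N g = 1\<^sub>m N"
  proof (rule eq_matI)
    fix i j assume "i < dim_row (1\<^sub>m N :: 'a mat)" "j < dim_col (1\<^sub>m N :: 'a mat)"
    then have ij: "i < N" "j < N" by auto
    have "(g * adj N g) $$ (i, j) = (\<Sum>a<N. g $$ (i, a) * adj N g $$ (a, j))"
      using gc ij by (simp add: scalar_prod_def lessThan_atLeast0)
    also have "\<dots> = h (R i) (R (2 * n - j))"
      unfolding h_def using gc ij by (intro sum.cong refl) (simp add: adj_index N g_def)
    also have "\<dots> = (if 2 * n - j = 2 * n - i then 1 else 0)" using hR[OF ij(1) N(1)[OF ij(2)]] .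
    also have "2 * n - j = 2 * n - i \<longleftrightarrow> i = j" using ij unfolding N_def by linarith
    also have "(if i = j then 1 else 0) = 1\<^sub>m N $$ (i, j)" using ij by simp
    finally show "(g * adj N g) $$ (i, j) = 1\<^sub>m N $$ (i, j)" .
  qed (use gc in auto)
  have "v (R i a) \<le> 1" if "i < N" "a < N" for i a
  proof -
    have "R i \<in> L" using that ef z by (auto simp: R_def N_def)
    then show ?thesis using that by (simp add: L_def)
  qed
  then have gK: "g \<in> unitary_K v \<sigma> n"
    unfolding unitary_K_iff unitary_G_iff N_def[symmetric] using gc gu by (simp add: g_def)
  have "g * x * conj_transpose \<sigma> g = x_mat \<pi> n lv"
  proof (rule eq_matI)
    fix i j assume "i < dim_row (x_mat \<pi> n lv)" "j < dim_col (x_mat \<pi> n lv)"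
    then have ij: "i < N" "j < N" using x_mat_carrier[of n lv] by (auto simp: N_def)
    have gx: "g * x \<in> carrier_mat N N" using gc xc by (rule mult_carrier_mat)
    have "(g * x * conj_transpose \<sigma> g) $$ (i, j) = (\<Sum>b<N. (g * x) $$ (i, b) * conj_transpose \<sigma> g $$ (b, j))"
      using gx conj_transpose_carrier[OF gc] ij by (rule mult_mat_index_sum)
    also have "\<dots> = (\<Sum>b<N. \<Sum>a<N. R i a * Y a b * \<sigma> (R j b))"
    proof (intro sum.cong refl)
      fix b assume "b \<in> {..<N}"
      then have b: "b < N" by simp
      have "(g * x) $$ (i, b) = (\<Sum>a<N. R i a * Y a b)"
        using gc xc ij b by (simp add: scalar_prod_def lessThan_atLeast0 g_def Y_def)
      moreover have "conj_transpose \<sigma> g $$ (b, j) = \<sigma> (R j b)" using gc b ij by (simp add: conj_transpose_index g_def)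
      ultimately show "(g * x) $$ (i, b) * conj_transpose \<sigma> g $$ (b, j) = (\<Sum>a<N. R i a * Y a b * \<sigma> (R j b))"
        by (simp add: sum_distrib_right)
    qed
    also have "\<dots> = h (T (R i)) (R j)" unfolding hT by (rule sum.swap)
    also have "\<dots> = x_mat \<pi> n lv $$ (i, j)" using hTR[OF ij] x_mat_index[of i n j lv] ij by (simp add: N_def)
    finally show "(g * x * conj_transpose \<sigma> g) $$ (i, j) = x_mat \<pi> n lv $$ (i, j)" .
  qed (use gc x_mat_carrier[of n lv] in \<open>auto simp: N_def\<close>)
  then show ?thesis using lv gK by blast
qed

theorem theorem1p1:
  fixes p n :: nat
    and v :: "'a::field_char_0 \<Rightarrow> real"
    and Qp k :: "'a set"
    and \<sigma> :: "'a \<Rightarrow> 'a"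
    and \<pi> :: 'a
  assumes "prime p" and "odd p"
    and "absolute_value v"
    and "padic_numbers p v Qp"
    and "finite_extension Qp k"
    and "unramified_quadratic v k"
    and "nontrivial_automorphism k \<sigma>"
    and "prime_element_of v k \<pi>"
    and "n \<ge> 1"
  shows "unitary_X \<sigma> n = (\<Union>l\<in>Lambda_plus n. K_orbit v \<sigma> n (x_mat \<pi> n l)) \<and>
    (\<forall>x\<in>unitary_X \<sigma> n. \<exists>!l. l \<in> Lambda_plus n \<and> x \<in> K_orbit v \<sigma> n (x_mat \<pi> n l))"
proof -
  have hf: "hermitian_field v \<sigma> \<pi>"
    using assms(1-8) by (rule unramified_quadratic_hermitian_field)
  interpret hermitian_field v \<sigma> \<pi> by (rule hf)
  define m where "m = 2 * n + 1"
  have in_orbit: "\<exists>l\<in>Lambda_plus n. x \<in> K_orbit v \<sigma> n (x_mat \<pi> n l)" if x: "x \<in> unitary_X \<sigma> n" for x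
  proof -
    obtain l g where l: "l \<in> Lambda_plus n" and g: "g \<in> unitary_K v \<sigma> n"
      and eq: "g * x * conj_transpose \<sigma> g = x_mat \<pi> n l"
      using exists_adapted_unitary_K[OF hf x] by blast
    \<comment> \<open>The inverse of \<open>g\<close>, which carries \<open>x_mat \<pi> n l\<close>
      back to \<open>x\<close>.\<close>
    define g' where "g' = adj m g"
    have g'K: "g' \<in> unitary_K v \<sigma> n" unfolding g'_def m_def using g by (rule adj_unitary_K)
    have c: "g \<in> carrier_mat m m" "g' \<in> carrier_mat m m" "x \<in> carrier_mat m m"
      using g g'K x unfolding unitary_K_iff unitary_X_def unitary_G_iff m_def by blast+
    have cc: "conj_transpose \<sigma> g \<in> carrier_mat m m" "conj_transpose \<sigma> g' \<in> carrier_mat m m" using c by auto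
    have inv: "g' * g = 1\<^sub>m m" using g unitary_G_inverse unfolding g'_def m_def unitary_K_iff by blast
    then have "conj_transpose \<sigma> g * conj_transpose \<sigma> g' = 1\<^sub>m m" using conj_transpose_mult[OF c(2,1)] by simp
    then have "x = (g' * g) * x * (conj_transpose \<sigma> g * conj_transpose \<sigma> g')"
      using inv left_mult_one_mat[OF c(3)] right_mult_one_mat[OF c(3)] by simp
    also have "\<dots> = g' * (g * x * conj_transpose \<sigma> g) * conj_transpose \<sigma> g'"
      using c cc by (simp add: assoc_mult_mat[of _ m m _ m _ m] mult_carrier_mat[of _ m m _ m])
    finally have "x = g' * x_mat \<pi> n l * conj_transpose \<sigma> g'" unfolding eq .
    then show ?thesis using l g'K unfolding K_orbit_def by blast
  qed
  have orbit_sub: "x \<in> unitary_X \<sigma> n" if "x \<in> K_orbit v \<sigma> n (x_mat \<pi> n l)" for x l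
    using that unitary_X_action[OF x_mat_in_unitary_X] unfolding K_orbit_def unitary_K_def by blast
  show ?thesis
  proof (intro conjI ballI ex_ex1I)
    show "unitary_X \<sigma> n = (\<Union>l\<in>Lambda_plus n. K_orbit v \<sigma> n (x_mat \<pi> n l))"
    proof (intro equalityI subsetI)
      fix x assume "x \<in> unitary_X \<sigma> n"
      then show "x \<in> (\<Union>l\<in>Lambda_plus n. K_orbit v \<sigma> n (x_mat \<pi> n l))" using in_orbit by simp
    next
      fix x assume "x \<in> (\<Union>l\<in>Lambda_plus n. K_orbit v \<sigma> n (x_mat \<pi> n l))"
      then show "x \<in> unitary_X \<sigma> n" using orbit_sub by auto
    qed
  next
    fix x assume "x \<in> unitary_X \<sigma> n"
    then show "\<exists>l. l \<in> Lambda_plus n \<and> x \<in> K_orbit v \<sigma> n (x_mat \<pi> n l)" using in_orbit by blast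
  next
    fix x l l'
    assume "l \<in> Lambda_plus n \<and> x \<in> K_orbit v \<sigma> n (x_mat \<pi> n l)"
      "l' \<in> Lambda_plus n \<and> x \<in> K_orbit v \<sigma> n (x_mat \<pi> n l')"
    then show "l = l'" using x_mat_orbit_unique by blast
  qed
qed

end
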